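(* For $R=\mathbb{F}_2[x]/(x^4)$, the natural surjective ring homomorphism $K_0^{MW}(R)\to GW(R)$, $\langle a\rangle\mapsto\langle a\rangle$ (for $a\in R^*$), has kernel isomorphic to $\mathbb{Z}/2$. In fact, there are isomorphisms of abelian groups $$GW(R)\cong\mathbb{Z}\oplus(\mathbb{Z}/2)^2\quad\text{and}\quad K_0^{MW}(R)\cong\mathbb{Z}\oplus(\mathbb{Z}/2)^3.$$
   Context: An inner product space over a commutative ring $R$ is a finitely generated projective $R$-module $V$ equipped with a non-degenerate symmetric $R$-bilinear form $\mathfrak{b}:V\times V\to R$. $GW(R)$ is the Grothendieck group of the abelian monoid of isometry classes of inner product spaces over $R$ under orthogonal sum, with ring structure induced by tensor product; for $a\in R^*$, $\langle a\rangle\in GW(R)$ is the class of the rank one inner product space $R$ with form $\mathfrak{b}(x,y)=axy$. In the group ring $\mathbb{Z}[R^*]$, $\langle a\rangle$ denotes the basis element corresponding to $a\in R^*$, $\langle\!\langle a\rangle\!\rangle=1-\langle a\rangle$ and $h=\langle 1\rangle+\langle -1\rangle$. For a commutative local ring $R$, $K_0^{MW}(R)$ is the quotient ring of $\mathbb{Z}[R^*]$ modulo the ideal generated by: $\langle\!\langle a^2\rangle\!\rangle$ for $a\in R^*$; $\langle\!\langle a\rangle\!\rangle\cdot h$ for $a\in R^*$; and $\langle\!\langle a\rangle\!\rangle\cdot\langle\!\langle 1-a\rangle\!\rangle$ for $a\in R^*$ with $1-a\in R^*$. For every commutative local ring $R$, the ring homomorphism $\mathbb{Z}[R^*]\to GW(R)$,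 $\langle a\rangle\mapsto\langle a\rangle$, factors through a surjective ring homomorphism $K_0^{MW}(R)\to GW(R)$, which is the natural surjection in the statement. *)

theory Defs
  imports "HOL-Algebra.Algebra" "HOL-Number_Theory.Residues" "HOL-Library.Poly_Mapping"
begin

definition linear_maps ::
    "('a, 'm) ring_scheme \<Rightarrow> ('a, 'b, 'n) module_scheme \<Rightarrow> ('a, 'c, 'k) module_scheme \<Rightarrow> ('b \<Rightarrow> 'c) set"
  where "linear_maps R M N = {f \<in> carrier M \<rightarrow> carrier N.
    (\<forall>x\<in>carrier M. \<forall>y\<in>carrier M. f (x \<oplus>\<^bsub>M\<^esub> y) = f x \<oplus>\<^bsub>N\<^esub> f y) \<and>
    (\<forall>r\<in>carrier R. \<forall>x\<in>carrier M. f (r \<odot>\<^bsub>M\<^esub> x) = r \<odot>\<^bsub>N\<^esub> f x)}"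

definition bilinear_maps ::
    "('a, 'm) ring_scheme \<Rightarrow> ('a, 'b, 'n) module_scheme \<Rightarrow> ('a, 'c, 'k) module_scheme \<Rightarrow>
      ('a, 'd, 'l) module_scheme \<Rightarrow> ('b \<Rightarrow> 'c \<Rightarrow> 'd) set"
  where "bilinear_maps R M N P = {t.
    (\<forall>x\<in>carrier M. t x \<in> linear_maps R N P) \<and>
    (\<forall>y\<in>carrier N. (\<lambda>x. t x y) \<in> linear_maps R M P)}"

definition self_module :: "('a, 'm) ring_scheme \<Rightarrow> ('a, 'a) module"
  where "self_module R = \<lparr>carrier = carrier R, monoid.mult = monoid.mult R, one = one R,
    ring.zero = ring.zero R, add = add R, smult = monoid.mult R\<rparr>"

definition finitely_generated :: "('a, 'm) ring_scheme \<Rightarrow> ('a, 'b, 'n) module_scheme \<Rightarrow> bool"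
  where "finitely_generated R M \<longleftrightarrow> (\<exists>S. finite S \<and> S \<subseteq> carrier M \<and>
    (\<forall>x\<in>carrier M. \<exists>c\<in>S \<rightarrow> carrier R. x = (\<Oplus>\<^bsub>M\<^esub>s\<in>S. c s \<odot>\<^bsub>M\<^esub> s)))"

text \<open>
  Every finitely generated module over \<open>R\<close> is a quotient of some \<open>R\<^sup>n\<close>, whose elements are the
  lists of length \<open>n\<close> over \<open>R\<close>; by choosing representatives it has an isomorphic copy with elements
  of type \<^typ>\<open>'a list\<close>, where \<^typ>\<open>'a\<close> is the type of the elements of \<open>R\<close>. Whenever modules have
  to be quantified over inside a definition, this type therefore serves as the universe.
  In the next definition this loses nothing for a finitely generated \<open>M\<close>: testing against a
  surjection from a copy of \<open>R\<^sup>n\<close> onto a copy of \<open>M\<close> already makes \<open>M\<close> a direct summand of \<open>R\<^sup>n\<close>.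
\<close>

definition projective :: "('a, 'm) ring_scheme \<Rightarrow> ('a, 'b, 'n) module_scheme \<Rightarrow> bool"
  where "projective R M \<longleftrightarrow> (\<forall>(N :: ('a, 'a list) module) (P :: ('a, 'a list) module).
    module R N \<and> module R P \<longrightarrow>
    (\<forall>f\<in>linear_maps R N P. f ` carrier N = carrier P \<longrightarrow>
      (\<forall>g\<in>linear_maps R M P. \<exists>h\<in>linear_maps R M N. \<forall>x\<in>carrier M. f (h x) = g x)))"

text \<open>
  The universal property of the tensor product. If \<open>M\<close> and \<open>N\<close> are finitely generated then so is
  their tensor product, so it has a copy in the universe, and the universal property within the
  universe determines \<open>T\<close> up to unique isomorphism.
\<close>

definition is_tensor_product ::
    "('a, 'm) ring_scheme \<Rightarrow> ('a, 'b, 'n) module_scheme \<Rightarrow> ('a, 'c, 'k) module_scheme \<Rightarrow>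
      ('a, 'a list, 'l) module_scheme \<Rightarrow> ('b \<Rightarrow> 'c \<Rightarrow> 'a list) \<Rightarrow> bool"
  where "is_tensor_product R M N T t \<longleftrightarrow> module R T \<and> t \<in> bilinear_maps R M N T \<and>
    (\<forall>P :: ('a, 'a list) module. module R P \<longrightarrow> (\<forall>f\<in>bilinear_maps R M N P.
      (\<exists>g\<in>linear_maps R T P. \<forall>x\<in>carrier M. \<forall>y\<in>carrier N. g (t x y) = f x y) \<and>
      (\<forall>g\<in>linear_maps R T P. \<forall>g'\<in>linear_maps R T P.
        (\<forall>x\<in>carrier M. \<forall>y\<in>carrier N. g (t x y) = f x y \<and> g' (t x y) = f x y) \<longrightarrow>
        (\<forall>z\<in>carrier T. g z = g' z))))"

text \<open>The ring fields \<open>mult\<close> and \<open>one\<close>, which \<^typ>\<open>('a, 'b) module\<close> inherits, play no role.\<close>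

record ('a, 'b) ips = "('a, 'b) module" +
  bform :: "'b \<Rightarrow> 'b \<Rightarrow> 'a"

text \<open>Non-degenerate means that \<open>v \<mapsto> b(v, -)\<close> is a bijection from \<open>V\<close> onto its dual module.\<close>

definition nondegenerate :: "('a, 'm) ring_scheme \<Rightarrow> ('a, 'b) ips \<Rightarrow> bool"
  where "nondegenerate R V \<longleftrightarrow> (\<forall>f\<in>linear_maps R V (self_module R).
    \<exists>!v. v \<in> carrier V \<and> (\<forall>w\<in>carrier V. bform V v w = f w))"

definition inner_product_space :: "('a, 'm) ring_scheme \<Rightarrow> ('a, 'b) ips \<Rightarrow> bool"
  where "inner_product_space R V \<longleftrightarrow>
    module R V \<and> finitely_generated R V \<and> projective R V \<and>
    bform V \<in> bilinear_maps R V V (self_module R) \<and>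
    (\<forall>x\<in>carrier V. \<forall>y\<in>carrier V. bform V x y = bform V y x) \<and>
    nondegenerate R V"

definition isometric :: "('a, 'm) ring_scheme \<Rightarrow> ('a, 'b) ips \<Rightarrow> ('a, 'c) ips \<Rightarrow> bool"
  where "isometric R V W \<longleftrightarrow> (\<exists>f\<in>linear_maps R V W. bij_betw f (carrier V) (carrier W) \<and>
    (\<forall>x\<in>carrier V. \<forall>y\<in>carrier V. bform W (f x) (f y) = bform V x y))"

definition zero_space :: "('a, 'm) ring_scheme \<Rightarrow> ('a, unit) ips"
  where "zero_space R = \<lparr>carrier = UNIV, monoid.mult = (\<lambda>_ _. ()), one = (), ring.zero = (),
    add = (\<lambda>_ _. ()), smult = (\<lambda>_ _. ()), bform = (\<lambda>_ _. \<zero>\<^bsub>R\<^esub>)\<rparr>"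

definition rank_one_space :: "('a, 'm) ring_scheme \<Rightarrow> 'a \<Rightarrow> ('a, 'a) ips"
  where "rank_one_space R a = \<lparr>carrier = carrier R, monoid.mult = monoid.mult R, one = one R,
    ring.zero = ring.zero R, add = add R, smult = monoid.mult R, bform = (\<lambda>x y. a \<otimes>\<^bsub>R\<^esub> x \<otimes>\<^bsub>R\<^esub> y)\<rparr>"

definition orthogonal_sum ::
    "('a, 'm) ring_scheme \<Rightarrow> ('a, 'b) ips \<Rightarrow> ('a, 'c) ips \<Rightarrow> ('a, 'b \<times> 'c) ips"
  where "orthogonal_sum R V W = \<lparr>carrier = carrier V \<times> carrier W,
    monoid.mult = undefined, one = undefined, ring.zero = (\<zero>\<^bsub>V\<^esub>, \<zero>\<^bsub>W\<^esub>),
    add = (\<lambda>(v, w) (v', w'). (v \<oplus>\<^bsub>V\<^esub> v', w \<oplus>\<^bsub>W\<^esub> w')),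
    smult = (\<lambda>r (v, w). (r \<odot>\<^bsub>V\<^esub> v, r \<odot>\<^bsub>W\<^esub> w)),
    bform = (\<lambda>(v, w) (v', w'). bform V v v' \<oplus>\<^bsub>R\<^esub> bform W w w')\<rparr>"

definition is_tensor_space ::
    "('a, 'm) ring_scheme \<Rightarrow> ('a, 'b) ips \<Rightarrow> ('a, 'c) ips \<Rightarrow> ('a, 'a list) ips \<Rightarrow> bool"
  where "is_tensor_space R V W U \<longleftrightarrow> (\<exists>t. is_tensor_product R V W U t \<and>
    (\<forall>v\<in>carrier V. \<forall>v'\<in>carrier V. \<forall>w\<in>carrier W. \<forall>w'\<in>carrier W.
      bform U (t v w) (t v' w') = bform V v v' \<otimes>\<^bsub>R\<^esub> bform W w w'))"

text \<open>Isometry classes are taken in the universe of spaces with elements of type \<^typ>\<open>'a list\<close>.\<close>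

definition isometry_class :: "('a, 'm) ring_scheme \<Rightarrow> ('a, 'b) ips \<Rightarrow> ('a, 'a list) ips set"
  where "isometry_class R V = {U. inner_product_space R U \<and> isometric R U V}"

definition isometry_classes :: "('a, 'm) ring_scheme \<Rightarrow> ('a, 'a list) ips set ring"
  where "isometry_classes R = \<lparr>
    carrier = isometry_class R ` {V :: ('a, 'a list) ips. inner_product_space R V},
    monoid.mult = (\<lambda>A B. {U. inner_product_space R U \<and> (\<exists>V\<in>A. \<exists>W\<in>B. is_tensor_space R V W U)}),
    one = isometry_class R (rank_one_space R \<one>\<^bsub>R\<^esub>),
    ring.zero = isometry_class R (zero_space R),
    add = (\<lambda>A B. {U. inner_product_space R U \<and>
      (\<exists>V\<in>A. \<exists>W\<in>B. isometric R U (orthogonal_sum R V W))})\<rparr>"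

text \<open>
  Grothendieck ring of a commutative semiring \<open>S\<close>, given as a record of type \<^typ>\<open>'s ring\<close>;
  the pair \<open>(a, b)\<close> represents the formal difference of \<open>a\<close> and \<open>b\<close>.
\<close>

definition groth_rel :: "('s, 'm) ring_scheme \<Rightarrow> (('s \<times> 's) \<times> ('s \<times> 's)) set"
  where "groth_rel S = {((a, b), (c, d)). a \<in> carrier S \<and> b \<in> carrier S \<and>
    c \<in> carrier S \<and> d \<in> carrier S \<and>
    (\<exists>e\<in>carrier S. (a \<oplus>\<^bsub>S\<^esub> d) \<oplus>\<^bsub>S\<^esub> e = (c \<oplus>\<^bsub>S\<^esub> b) \<oplus>\<^bsub>S\<^esub> e)}"

definition groth_class :: "('s, 'm) ring_scheme \<Rightarrow> 's \<Rightarrow> 's \<Rightarrow> ('s \<times> 's) set"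
  where "groth_class S a b = groth_rel S `` {(a, b)}"

definition grothendieck_ring :: "('s, 'm) ring_scheme \<Rightarrow> ('s \<times> 's) set ring"
  where "grothendieck_ring S = \<lparr>
    carrier = (carrier S \<times> carrier S) // groth_rel S,
    monoid.mult = (\<lambda>A B. \<Union> {groth_class S
      ((a \<otimes>\<^bsub>S\<^esub> c) \<oplus>\<^bsub>S\<^esub> (b \<otimes>\<^bsub>S\<^esub> d)) ((a \<otimes>\<^bsub>S\<^esub> d) \<oplus>\<^bsub>S\<^esub> (b \<otimes>\<^bsub>S\<^esub> c))
      | a b c d. (a, b) \<in> A \<and> (c, d) \<in> B}),
    one = groth_class S \<one>\<^bsub>S\<^esub> \<zero>\<^bsub>S\<^esub>,
    ring.zero = groth_class S \<zero>\<^bsub>S\<^esub> \<zero>\<^bsub>S\<^esub>,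
    add = (\<lambda>A B. \<Union> {groth_class S (a \<oplus>\<^bsub>S\<^esub> c) (b \<oplus>\<^bsub>S\<^esub> d)
      | a b c d. (a, b) \<in> A \<and> (c, d) \<in> B})\<rparr>"

definition GW :: "('a, 'm) ring_scheme \<Rightarrow>
    (('a, 'a list) ips set \<times> ('a, 'a list) ips set) set ring"
  where "GW R = grothendieck_ring (isometry_classes R)"

definition GW_unit :: "('a, 'm) ring_scheme \<Rightarrow> 'a \<Rightarrow>
    (('a, 'a list) ips set \<times> ('a, 'a list) ips set) set"
  where "GW_unit R a = groth_class (isometry_classes R)
    (isometry_class R (rank_one_space R a)) \<zero>\<^bsub>isometry_classes R\<^esub>"

definition int_group_ring :: "('a, 'm) monoid_scheme \<Rightarrow> ('a \<Rightarrow>\<^sub>0 int) ring"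
  where "int_group_ring G = \<lparr>
    carrier = {c. Poly_Mapping.keys c \<subseteq> carrier G},
    monoid.mult = (\<lambda>c d. frag_extend (\<lambda>a. frag_extend (\<lambda>b. frag_of (a \<otimes>\<^bsub>G\<^esub> b)) d) c),
    one = frag_of \<one>\<^bsub>G\<^esub>, ring.zero = 0, add = (+)\<rparr>"

text \<open>The elements \<open>\<langle>\<langle>a\<rangle>\<rangle> = 1 - \<langle>a\<rangle>\<close> and \<open>h = \<langle>1\<rangle> + \<langle>-1\<rangle>\<close>; the basis element \<open>\<langle>a\<rangle>\<close> is \<open>frag_of a\<close>.\<close>

definition pfister :: "('a, 'm) ring_scheme \<Rightarrow> 'a \<Rightarrow> ('a \<Rightarrow>\<^sub>0 int)"
  where "pfister R a = frag_of \<one>\<^bsub>R\<^esub> - frag_of a"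

definition hyp :: "('a, 'm) ring_scheme \<Rightarrow> ('a \<Rightarrow>\<^sub>0 int)"
  where "hyp R = frag_of \<one>\<^bsub>R\<^esub> + frag_of (\<ominus>\<^bsub>R\<^esub> \<one>\<^bsub>R\<^esub>)"

abbreviation unit_group_ring :: "('a, 'm) ring_scheme \<Rightarrow> ('a \<Rightarrow>\<^sub>0 int) ring"
  where "unit_group_ring R \<equiv> int_group_ring (units_of R)"

definition K0MW_ideal :: "('a, 'm) ring_scheme \<Rightarrow> ('a \<Rightarrow>\<^sub>0 int) set"
  where "K0MW_ideal R = genideal (unit_group_ring R)
    ({pfister R (a \<otimes>\<^bsub>R\<^esub> a) | a. a \<in> Units R} \<union>
     {pfister R a \<otimes>\<^bsub>unit_group_ring R\<^esub> hyp R | a. a \<in> Units R} \<union>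
     {pfister R a \<otimes>\<^bsub>unit_group_ring R\<^esub> pfister R (\<one>\<^bsub>R\<^esub> \<ominus>\<^bsub>R\<^esub> a) | a.
        a \<in> Units R \<and> \<one>\<^bsub>R\<^esub> \<ominus>\<^bsub>R\<^esub> a \<in> Units R})"

definition K0MW :: "('a, 'm) ring_scheme \<Rightarrow> ('a \<Rightarrow>\<^sub>0 int) set ring"
  where "K0MW R = unit_group_ring R Quot K0MW_ideal R"

definition K0MW_unit :: "('a, 'm) ring_scheme \<Rightarrow> 'a \<Rightarrow> ('a \<Rightarrow>\<^sub>0 int) set"
  where "K0MW_unit R a = K0MW_ideal R +>\<^bsub>unit_group_ring R\<^esub> frag_of a"

text \<open>
  The homomorphism from the group ring to \<open>GW(R)\<close> with \<open>\<langle>a\<rangle> \<mapsto> \<langle>a\<rangle>\<close>, and the map that it induces on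
  cosets; \<open>the_elem\<close> is meaningful because the former is constant on each coset.
\<close>

definition unit_group_ring_to_GW :: "('a, 'm) ring_scheme \<Rightarrow> ('a \<Rightarrow>\<^sub>0 int) \<Rightarrow>
    (('a, 'a list) ips set \<times> ('a, 'a list) ips set) set"
  where "unit_group_ring_to_GW R c =
    (\<Oplus>\<^bsub>GW R\<^esub>a\<in>Poly_Mapping.keys c. [Poly_Mapping.lookup c a] \<cdot>\<^bsub>GW R\<^esub> GW_unit R a)"

definition K0MW_to_GW :: "('a, 'm) ring_scheme \<Rightarrow> ('a \<Rightarrow>\<^sub>0 int) set \<Rightarrow>
    (('a, 'a list) ips set \<times> ('a, 'a list) ips set) set"
  where "K0MW_to_GW R C = the_elem (unit_group_ring_to_GW R ` C)"

definition F2x4 :: "(nat \<Rightarrow> int) set ring"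
  where "F2x4 = (let P = UP (residue_ring 2) in
    P Quot (PIdl\<^bsub>P\<^esub> (up_ring.monom P \<one>\<^bsub>residue_ring 2\<^esub> 4)))"

end

theory Submission
  imports Defs "Jordan_Normal_Form.Determinant"
begin

text \<open>Let \<open>R = F\<^sub>2[x]/(x\<^sup>4)\<close>. Since \<open>R\<close> is local, inner product spaces are free and isometry classes are congruence
  classes of unimodular symmetric matrices. After adding \<open>\<langle>1\<rangle>\<close> such a form becomes diagonal, and the
  relations \<open>\<langle>a, b\<rangle> \<cong> \<langle>c, a b c\<rangle>\<close> for units \<open>c = s\<^sup>2 a + t\<^sup>2 b\<close> and
  \<open>\<langle>a, a, 1, b\<rangle> \<cong> \<langle>1, 1, 1, b\<rangle>\<close> show that every form is stably
  \<open>\<langle>1, \<dots>, 1, d\<rangle>\<close> with \<open>d\<close> its determinant. So rank and discriminant identify \<open>GW(R)\<close> with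
  \<open>\<int> \<oplus> R\<^sup>*/R\<^sup>*\<^sup>2\<close>, and \<open>R\<^sup>*/R\<^sup>*\<^sup>2 = (\<int>/2)\<^sup>2\<close> is generated by \<open>1 + x\<close> and
  \<open>1 + x\<^sup>3\<close>.

  On the other side \<open>1 - a\<close> is never a unit for a unit \<open>a\<close>, and \<open>h = 2\<close> because \<open>-1 = 1\<close>. Hence
  \<open>K\<^sub>0\<^sup>M\<^sup>W(R) = \<int>[G]/2I\<close> for \<open>G = R\<^sup>*/R\<^sup>*\<^sup>2\<close> with augmentation ideal \<open>I\<close>, which
  is \<open>\<int> \<oplus> I/2I\<close> with \<open>I\<close> free of rank 3. The kernel of the map to \<open>GW(R)\<close> is \<open>I\<^sup>2/2I\<close>, which
  is generated by the product of the elements \<open>1 - \<langle>a\<rangle>\<close> for \<open>a = 1 + x\<close> and \<open>a = 1 + x\<^sup>3\<close>.\<close>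

section \<open>The truncated polynomial ring\<close>

text \<open>The kernel comes from the small residue field. With two residue classes the Steinberg
  relations are vacuous, so \<open>K0MW\<close> knows only square classes and the factor 2. Forms
  know more: <a, b> can be diagonalised in several ways, since it also represents units such as a +
  x^2 b, which may lie in other square classes. Stably this forces <a> + <b> = <1> + <ab>, that is
  (1 - <a>)(1 - <b>) = 0. For a = 1 + x and b = 1 + x^3 the left side contains each square class
  with coefficient 1 or -1, hence is not in 2I. As 2I has index 8 in I and I/I^2 = G has order 4,
  nothing else is lost.

  Two obstacles shape the work. Forms in characteristic 2 need not be diagonalisable, and
  cancellation fails: <a, a> represents only units in the square class of a, yet it is stably <1,
  1>. So normal forms are sought up to a common summand. Moreover \<open>F2x4\<close> consists of
  cosets of coefficient functions, while matrices live over types; the ring is therefore replaced by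
  the type below, four bits for 1, x, x^2, x^3, and matrix arguments are transported along a
  bijection \<open>\<psi>\<close>.\<close>

datatype trunc = Trunc (c0: bool) (c1: bool) (c2: bool) (c3: bool)

instantiation trunc :: comm_ring_1
begin

definition "0 = Trunc False False False False"
definition "1 = Trunc True False False False"
definition "p + q = Trunc (c0 p \<noteq> c0 q) (c1 p \<noteq> c1 q) (c2 p \<noteq> c2 q) (c3 p \<noteq> c3 q)"
definition "(p :: trunc) - q = p + q"
definition "- (p :: trunc) = p"
definition "p * q = Trunc
  (c0 p \<and> c0 q)
  ((c0 p \<and> c1 q) \<noteq> (c1 p \<and> c0 q))
  ((c0 p \<and> c2 q) \<noteq> ((c1 p \<and> c1 q) \<noteq> (c2 p \<and> c0 q)))
  ((c0 p \<and> c3 q) \<noteq> ((c1 p \<and> c2 q) \<noteq> ((c2 p \<and> c1 q) \<noteq> (c3 p \<and> c0 q))))"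

instance
proof
  fix a b c :: trunc
  show "a * b * c = a * (b * c)"
    unfolding times_trunc_def trunc.sel trunc.inject by argo
  show "(a + b) * c = a * c + b * c"
    unfolding times_trunc_def plus_trunc_def trunc.sel trunc.inject by argo
qed (auto simp: plus_trunc_def times_trunc_def minus_trunc_def uminus_trunc_def
    zero_trunc_def one_trunc_def trunc.expand)

end

lemmas trunc_defs = plus_trunc_def times_trunc_def minus_trunc_def uminus_trunc_def
    zero_trunc_def one_trunc_def

instance trunc :: finite
proof
  have "(UNIV :: trunc set) \<subseteq> (\<lambda>(a, b, c, d). Trunc a b c d) ` UNIV"
  proof
    fix p :: trunc
    show "p \<in> (\<lambda>(a, b, c, d). Trunc a b c d) ` UNIV"
      by (rule image_eqI[of _ _ "(c0 p, c1 p, c2 p, c3 p)"]) simp_all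
  qed
  then show "finite (UNIV :: trunc set)"
    by (rule finite_subset) simp
qed

lemma trunc_add_self [simp]: "(p :: trunc) + p = 0"
  by (simp add: trunc_defs)

lemma trunc_minus [simp]: "- (p :: trunc) = p" "(p :: trunc) - q = p + q"
  by (simp_all add: trunc_defs)

lemma trunc_unit_iff: "(p :: trunc) dvd 1 \<longleftrightarrow> c0 p"
proof
  assume "p dvd 1"
  then obtain q where "1 = p * q" by (elim dvdE)
  then show "c0 p" by (simp add: trunc_defs)
next
  assume "c0 p"
  moreover obtain a b c d where "p = Trunc a b c d" by (cases p)
  \<comment> \<open>Squaring is additive in characteristic 2, so squaring twice leaves only the
    constant term modulo x^4. Every unit has fourth power 1 and inverse p^3.\<close>
  ultimately have "p * p * (p * p) = 1" by (simp add: trunc_defs)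
  then show "p dvd 1" by (metis dvd_triv_left mult.assoc)
qed

lemma trunc_square_square: "c0 (p :: trunc) \<Longrightarrow> p * p * (p * p) = 1"
  by (cases p) (simp add: trunc_defs)

definition trunc_x :: trunc where "trunc_x = Trunc False True False False"

text \<open>The maximal ideal is generated by x. Together with the nilpotency of x this is the
  information on the ring that makes projective modules free in
  \<open>projective_frame\<close>.\<close>

lemma trunc_x_dvd: "\<not> (p :: trunc) dvd 1 \<Longrightarrow> trunc_x dvd p"
  unfolding trunc_unit_iff
  by (rule dvdI[of _ _ "Trunc (c1 p) (c2 p) (c3 p) False"], cases p)
     (simp add: trunc_defs trunc_x_def)

lemma trunc_x_nilpotent: "trunc_x ^ 4 = 0"
  by (simp add: trunc_defs trunc_x_def numeral_eq_Suc)

text \<open>The discriminant of a unit, in coordinates on \<open>R\<^sup>*/R\<^sup>*\<^sup>2 = (\<int>/2)\<^sup>2\<close> with basis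
  \<open>1 + x\<close> and \<open>1 + x\<^sup>3\<close>.\<close>

definition disc1 :: "trunc \<Rightarrow> int" where "disc1 p = of_bool (c1 p)"
definition disc2 :: "trunc \<Rightarrow> int" where "disc2 p = of_bool (c3 p \<noteq> (c1 p \<and> c2 p))"

lemma disc_one: "disc1 1 = 0" "disc2 1 = 0"
  by (simp_all add: disc1_def disc2_def one_trunc_def)

lemma disc_mult:
  assumes "c0 p" "c0 q"
  shows "disc1 (p * q) = (disc1 p + disc1 q) mod 2" "disc2 (p * q) = (disc2 p + disc2 q) mod 2"
  using assms by (cases p; cases q; auto simp: disc1_def disc2_def times_trunc_def of_bool_def)+

text \<open>The squares of units are 1 and 1 + x^2, so every square class has just one
  representative without x^2 term. If \<open>c2 p\<close> holds, it is reached by multiplying with 1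
  + x^2, which adds \<open>c1 p\<close> to the x^3 coefficient; this is the origin of the formula
  for \<open>disc2\<close>.\<close>

lemma disc_eq_iff:
  assumes "c0 p" "c0 q"
  shows "disc1 p = disc1 q \<and> disc2 p = disc2 q \<longleftrightarrow> (\<exists>s. c0 s \<and> q = p * (s * s))"
proof
  assume eq: "disc1 p = disc1 q \<and> disc2 p = disc2 q"
  \<comment> \<open>The square of s is 1 or 1 + x^2, the latter exactly when the x^2 coefficients of
    p and q differ.\<close>
  define s where "s = Trunc True (c2 p \<noteq> c2 q) False False"
  have "c0 s \<and> q = p * (s * s)"
    using eq assms
    by (cases p; cases q) (auto simp: s_def disc1_def disc2_def times_trunc_def of_bool_def split: if_splits)
  then show "\<exists>s. c0 s \<and> q = p * (s * s)" ..
next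
  assume "\<exists>s. c0 s \<and> q = p * (s * s)"
  then show "disc1 p = disc1 q \<and> disc2 p = disc2 q"
    using assms by (cases p; cases q) (auto simp: disc1_def disc2_def times_trunc_def)
qed

lemma disc_times_square:
  assumes "c0 p" "s dvd 1"
  shows "disc1 (p * (s * s)) = disc1 p" "disc2 (p * (s * s)) = disc2 p" "c0 (p * (s * s))"
  using assms unfolding trunc_unit_iff by (cases p; cases s; auto simp: disc1_def disc2_def times_trunc_def)+

section \<open>Identification of \<open>F2x4\<close> with the truncated polynomials\<close>

definition trunc_ring :: "trunc ring" where
  "trunc_ring = \<lparr>carrier = UNIV, monoid.mult = (*), one = 1, ring.zero = 0, add = (+)\<rparr>"

lemma cring_trunc_ring: "cring trunc_ring"
proof (rule cringI)
  show "abelian_group trunc_ring"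
    by (rule abelian_groupI) (auto simp: trunc_ring_def algebra_simps intro: exI[where x = "- x" for x] trunc_add_self)
  show "comm_monoid trunc_ring"
    by (rule comm_monoidI) (auto simp: trunc_ring_def algebra_simps)
qed (auto simp: trunc_ring_def algebra_simps)

interpretation F2: residues 2 "residue_ring 2" by unfold_locales auto

definition trunc_of_poly :: "(nat \<Rightarrow> int) \<Rightarrow> trunc" where
  "trunc_of_poly f = Trunc (odd (f 0)) (odd (f 1)) (odd (f 2)) (odd (f 3))"

lemma UP_cring_F2: "UP_cring (residue_ring 2)"
  by unfold_locales

lemmas cring_F2x = UP_cring.UP_cring[OF UP_cring_F2]

lemma UP_F2_carrier: "f \<in> carrier (UP (residue_ring 2)) \<longleftrightarrow> (\<forall>n. f n \<in> {0..1}) \<and> (\<exists>n. \<forall>m>n. f m = 0)"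
  by (auto simp: UP_def up_def bound_def F2.res_carrier_eq F2.res_zero_eq Pi_iff)

text \<open>The convolution is a \<open>finsum\<close> in the residue ring. As an integer sum
  reduced modulo 2 it becomes accessible to parity arguments.\<close>

lemma F2x_mult_coeff:
  assumes f: "f \<in> carrier (UP (residue_ring 2))" and g: "g \<in> carrier (UP (residue_ring 2))"
  shows "(f \<otimes>\<^bsub>UP (residue_ring 2)\<^esub> g) n = (\<Sum>i\<le>n. f i * g (n - i)) mod 2"
proof -
  have fg: "f i \<in> {0..1}" "g i \<in> {0..1}" for i
    using f g unfolding UP_F2_carrier by auto
  have "(\<Oplus>\<^bsub>residue_ring 2\<^esub>i\<in>A. f i \<otimes>\<^bsub>residue_ring 2\<^esub> g (n - i)) = (\<Sum>i\<in>A. f i * g (n - i)) mod 2"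
    if "finite A" for A
    using that
  proof induction
    case empty
    then show ?case by (simp add: F2.zero_cong)
  next
    case (insert x A)
    have "(\<Oplus>\<^bsub>residue_ring 2\<^esub>i\<in>insert x A. f i \<otimes>\<^bsub>residue_ring 2\<^esub> g (n - i)) =
      (f x \<otimes>\<^bsub>residue_ring 2\<^esub> g (n - x)) \<oplus>\<^bsub>residue_ring 2\<^esub> (\<Oplus>\<^bsub>residue_ring 2\<^esub>i\<in>A. f i \<otimes>\<^bsub>residue_ring 2\<^esub> g (n - i))"
      by (rule F2.finsum_insert) (use insert fg F2.res_carrier_eq in \<open>auto simp: F2.res_mult_eq\<close>)
    then show ?case using insert by (simp add: F2.res_mult_eq F2.res_add_eq mod_simps)
  qed
  then show ?thesis using f g by (simp add: UP_def)
qed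


lemma trunc_of_poly_hom: "ring_hom_ring (UP (residue_ring 2)) trunc_ring trunc_of_poly"
proof (intro ring_hom_ringI2 cring.axioms(1) cring_F2x cring_trunc_ring ring_hom_memI)
  fix f g
  assume fg: "f \<in> carrier (UP (residue_ring 2))" "g \<in> carrier (UP (residue_ring 2))"
  have "(f \<oplus>\<^bsub>UP (residue_ring 2)\<^esub> g) n = (f n + g n) mod 2" for n
    using fg by (simp add: UP_def F2.res_add_eq)
  then show "trunc_of_poly (f \<oplus>\<^bsub>UP (residue_ring 2)\<^esub> g) =
    trunc_of_poly f \<oplus>\<^bsub>trunc_ring\<^esub> trunc_of_poly g"
    by (auto simp: trunc_of_poly_def trunc_ring_def plus_trunc_def even_add)
  show "trunc_of_poly (f \<otimes>\<^bsub>UP (residue_ring 2)\<^esub> g) =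
    trunc_of_poly f \<otimes>\<^bsub>trunc_ring\<^esub> trunc_of_poly g"
    by (auto simp: trunc_of_poly_def trunc_ring_def times_trunc_def F2x_mult_coeff[OF fg] atMost_Suc
        numeral_eq_Suc odd_iff_mod_2_eq_one[symmetric] simp del: odd_iff_mod_2_eq_one)
qed (auto simp: trunc_ring_def trunc_of_poly_def UP_def one_trunc_def F2.res_one_eq F2.res_zero_eq)

lemma trunc_of_poly_surj: "trunc_of_poly ` carrier (UP (residue_ring 2)) = carrier trunc_ring"
proof -
  have "p \<in> trunc_of_poly ` carrier (UP (residue_ring 2))" for p
  proof (rule image_eqI)
    let ?f = "\<lambda>n::nat. (if n = 0 then of_bool (c0 p) else if n = 1 then of_bool (c1 p)
      else if n = 2 then of_bool (c2 p) else if n = 3 then of_bool (c3 p) else 0) :: int"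
    show "?f \<in> carrier (UP (residue_ring 2))"
      unfolding UP_F2_carrier by (auto intro: exI[of _ 3])
    show "p = trunc_of_poly ?f"
      by (simp add: trunc_of_poly_def)
  qed
  then show ?thesis by (auto simp: trunc_ring_def)
qed

text \<open>Multiplication by x^4 shifts coefficients by four places, so the multiples of x^4 are
  the polynomials whose four lowest coefficients vanish. Coefficients are 0 or 1, hence vanish as
  soon as they are even; the cofactor is the polynomial shifted back.\<close>

lemma trunc_of_poly_kernel:
  "a_kernel (UP (residue_ring 2)) trunc_ring trunc_of_poly =
    PIdl\<^bsub>UP (residue_ring 2)\<^esub> (up_ring.monom (UP (residue_ring 2)) \<one>\<^bsub>residue_ring 2\<^esub> 4)"
proof -
  let ?P = "UP (residue_ring 2)"
  let ?m = "up_ring.monom ?P \<one>\<^bsub>residue_ring 2\<^esub> 4"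
  have m: "?m = (\<lambda>n. if n = 4 then 1 else 0)"
    by (auto simp: UP_def F2.res_one_eq F2.res_zero_eq F2.res_carrier_eq)
  have mc: "?m \<in> carrier ?P"
    unfolding m UP_F2_carrier by (auto intro: exI[of _ 4])
  have coeff: "(g \<otimes>\<^bsub>?P\<^esub> ?m) n = (if 4 \<le> n then g (n - 4) else 0)" if g: "g \<in> carrier ?P" for g n
  proof -
    have "(\<Sum>i\<le>n. g i * ?m (n - i)) = (\<Sum>i\<le>n. if i = n - 4 \<and> 4 \<le> n then g i else 0)"
      unfolding m by (intro sum.cong) auto
    also have "\<dots> = (if 4 \<le> n then g (n - 4) else 0)"
      by (simp add: sum.delta)
    finally have "(\<Sum>i\<le>n. g i * ?m (n - i)) = (if 4 \<le> n then g (n - 4) else 0)" .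
    moreover have "g (n - 4) \<in> {0..1}" using g unfolding UP_F2_carrier by blast
    ultimately show ?thesis unfolding F2x_mult_coeff[OF g mc] by auto
  qed
  show ?thesis
  proof (intro subset_antisym subsetI)
    fix f assume "f \<in> PIdl\<^bsub>?P\<^esub> ?m"
    then obtain g where g: "g \<in> carrier ?P" "f = g \<otimes>\<^bsub>?P\<^esub> ?m"
      by (auto simp: cgenideal_def)
    have "f \<in> carrier ?P" using g mc cring.cring_simprules(5)[OF cring_F2x] by auto
    then show "f \<in> a_kernel ?P trunc_ring trunc_of_poly"
      unfolding a_kernel_def' by (simp add: trunc_of_poly_def trunc_ring_def zero_trunc_def g(2) coeff[OF g(1)])
  next
    fix f assume "f \<in> a_kernel ?P trunc_ring trunc_of_poly"
    then have f: "f \<in> carrier ?P" and even: "even (f 0)" "even (f 1)" "even (f 2)" "even (f 3)"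
      by (auto simp: a_kernel_def' trunc_of_poly_def trunc_ring_def zero_trunc_def)
    have "f n \<in> {0, 1}" for n using f unfolding UP_F2_carrier by (metis atLeastAtMost_iff insert_iff int_one_le_iff_zero_less linorder_not_less order_antisym)
    then have low: "f 0 = 0" "f 1 = 0" "f 2 = 0" "f 3 = 0" using even by (metis empty_iff insert_iff odd_one)+
    let ?g = "\<lambda>n. f (n + 4)"
    have g: "?g \<in> carrier ?P"
      using f unfolding UP_F2_carrier by (metis trans_less_add1)
    have "f n = (?g \<otimes>\<^bsub>?P\<^esub> ?m) n" for n
    proof (cases "4 \<le> n")
      case False
      then have "n = 0 \<or> n = 1 \<or> n = 2 \<or> n = 3" by auto
      then show ?thesis using low coeff[OF g] by auto
    qed (simp add: coeff[OF g])
    then have "f = ?g \<otimes>\<^bsub>?P\<^esub> ?m" by blast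
    then show "f \<in> PIdl\<^bsub>?P\<^esub> ?m" using g unfolding cgenideal_def by blast
  qed
qed

lemma cring_F2x4: "cring F2x4"
proof -
  interpret h: ring_hom_ring "UP (residue_ring 2)" trunc_ring trunc_of_poly
    by (rule trunc_of_poly_hom)
  show ?thesis
    unfolding F2x4_def Let_def trunc_of_poly_kernel[symmetric]
    by (rule ideal.quotient_is_cring[OF h.kernel_is_ideal cring_F2x])
qed

lemma F2x4_iso: "F2x4 \<simeq> trunc_ring"
proof -
  interpret h: ring_hom_ring "UP (residue_ring 2)" trunc_ring trunc_of_poly
    by (rule trunc_of_poly_hom)
  show ?thesis
    unfolding F2x4_def Let_def trunc_of_poly_kernel[symmetric]
    by (rule h.FactRing_iso[OF trunc_of_poly_surj])
qed

text \<open>The bridge between a ring with an explicit carrier, as in the definitions, and a ring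
  type, over which vectors, matrices and determinants are available. Finiteness of the type allows
  the rank of a free module to be found by counting.\<close>

locale coordinate_ring =
  fixes R :: "('a, 'm) ring_scheme" (structure) and \<psi> :: "'r :: {comm_ring_1, finite} \<Rightarrow> 'a"
  assumes cring: "cring R"
    and bij: "bij_betw \<psi> UNIV (carrier R)"
    and psi_add: "\<psi> (p + q) = \<psi> p \<oplus> \<psi> q"
    and psi_mult: "\<psi> (p * q) = \<psi> p \<otimes> \<psi> q"
    and psi_one: "\<psi> 1 = \<one>"

lemma coordinate_ring_F2x4: "\<exists>\<psi> :: trunc \<Rightarrow> _. coordinate_ring F2x4 \<psi>"
proof -
  obtain h where h: "h \<in> ring_iso F2x4 trunc_ring"
    using F2x4_iso unfolding is_ring_iso_def by blast
  then have "inv_into (carrier F2x4) h \<in> ring_iso trunc_ring F2x4"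
    using ring_iso_set_sym[OF cring.axioms(1)[OF cring_F2x4]] by blast
  then have "coordinate_ring F2x4 (inv_into (carrier F2x4) h)"
    using cring_F2x4
    by (auto simp: coordinate_ring_def ring_iso_def Ring.ring_hom_def trunc_ring_def)
  then show ?thesis by blast
qed

section \<open>Congruence of symmetric matrices\<close>

definition block_sum :: "'r :: zero mat \<Rightarrow> 'r mat \<Rightarrow> 'r mat" where
  "block_sum A B = four_block_mat A (0\<^sub>m (dim_row A) (dim_col B)) (0\<^sub>m (dim_row B) (dim_col A)) B"

lemma block_sum_carrier [simp]:
  "A \<in> carrier_mat n n' \<Longrightarrow> B \<in> carrier_mat m m' \<Longrightarrow> block_sum A B \<in> carrier_mat (n + m) (n' + m')"
  by (simp add: block_sum_def)

lemma dim_block_sum [simp]: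
  "dim_row (block_sum A B) = dim_row A + dim_row B" "dim_col (block_sum A B) = dim_col A + dim_col B"
  by (simp_all add: block_sum_def)

lemma block_sum_index:
  "i < dim_row A + dim_row B \<Longrightarrow> j < dim_col A + dim_col B \<Longrightarrow> block_sum A B $$ (i, j) =
    (if i < dim_row A then if j < dim_col A then A $$ (i, j) else 0
     else if j < dim_col A then 0 else B $$ (i - dim_row A, j - dim_col A))"
  by (auto simp: block_sum_def)

lemma block_sum_assoc: "block_sum A (block_sum B C) = block_sum (block_sum A B) C"
  unfolding block_sum_def by (rule assoc_four_block_mat)

lemma block_sum_mult:
  fixes A :: "'r :: semiring_0 mat"
  assumes "A \<in> carrier_mat n k" "B \<in> carrier_mat m l" "C \<in> carrier_mat k n'" "D \<in> carrier_mat l m'"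
  shows "block_sum A B * block_sum C D = block_sum (A * C) (B * D)"
  using assms unfolding block_sum_def
  by (subst mult_four_block_mat[of _ n k _ l _ m _ _ n' _ m']) auto

lemma block_sum_transpose: "(block_sum A B)\<^sup>T = block_sum A\<^sup>T B\<^sup>T"
  unfolding block_sum_def by (subst transpose_four_block_mat) auto

lemma block_sum_one: "block_sum (1\<^sub>m n) (1\<^sub>m m) = 1\<^sub>m (n + m)"
  by (simp add: block_sum_def)

lemma block_sum_empty:
  "A \<in> carrier_mat 0 0 \<Longrightarrow> block_sum A B = B" "A \<in> carrier_mat 0 0 \<Longrightarrow> block_sum B A = B"
  by (rule eq_matI; auto simp: block_sum_index)+

text \<open>The library's determinant formula for block triangular matrices asks for an integral domain.\<close>

lemma det_block_sum:
  fixes A :: "'r :: comm_ring_1 mat"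
  assumes A: "A \<in> carrier_mat n n" and B: "B \<in> carrier_mat m m"
  shows "det (block_sum A B) = det A * det B"
proof -
  have left: "det (block_sum A (1\<^sub>m m)) = det A" for m
  proof (induction m)
    case 0
    then show ?case by (simp add: block_sum_empty)
  next
    case (Suc m)
    have "(1\<^sub>m (Suc m) :: 'r mat) = block_sum (1\<^sub>m m) (1\<^sub>m 1)"
      by (simp add: block_sum_one)
    then have "block_sum A (1\<^sub>m (Suc m)) = block_sum (block_sum A (1\<^sub>m m)) (1\<^sub>m 1)"
      by (simp only: block_sum_assoc)
    moreover have "det (block_sum (block_sum A (1\<^sub>m m)) (1\<^sub>m 1)) = det (block_sum A (1\<^sub>m m)) * det (1\<^sub>m 1 :: 'r mat)"
      using A unfolding block_sum_def[of "block_sum A (1\<^sub>m m)"]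
      by (intro det_four_block_mat_upper_right_zero_col[of _ "n + m"]) auto
    ultimately show ?case using Suc by simp
  qed
  have right: "det (block_sum (1\<^sub>m n) B) = det B" for n
  proof (induction n)
    case 0
    then show ?case by (simp add: block_sum_empty)
  next
    case (Suc n)
    have "(1\<^sub>m (Suc n) :: 'r mat) = block_sum (1\<^sub>m 1) (1\<^sub>m n)"
      by (simp add: block_sum_one)
    then have "block_sum (1\<^sub>m (Suc n)) B = block_sum (1\<^sub>m 1) (block_sum (1\<^sub>m n) B)"
      by (simp only: block_sum_assoc)
    moreover have "det (block_sum (1\<^sub>m 1) (block_sum (1\<^sub>m n) B)) = det (1\<^sub>m 1 :: 'r mat) * det (block_sum (1\<^sub>m n) B)"
      using B unfolding block_sum_def[of "1\<^sub>m 1"]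
      by (intro det_four_block_mat_lower_left_zero_col[of _ _ "n + m"]) auto
    ultimately show ?case using Suc by simp
  qed
  have "block_sum A B = block_sum A (1\<^sub>m m) * block_sum (1\<^sub>m n) B"
    using A B by (simp add: block_sum_mult[of A n n "1\<^sub>m m" m m "1\<^sub>m n" n B m])
  moreover have "det (block_sum A (1\<^sub>m m) * block_sum (1\<^sub>m n) B) = det (block_sum A (1\<^sub>m m)) * det (block_sum (1\<^sub>m n) B)"
    using A B by (intro det_mult[of _ "n + m"]) auto
  ultimately show ?thesis by (simp add: left right)
qed

section \<open>Unimodular matrices and the congruence relation\<close>

definition unimodular :: "'r :: comm_ring_1 mat \<Rightarrow> bool" where
  "unimodular A \<longleftrightarrow> square_mat A \<and> A\<^sup>T = A \<and> det A dvd 1"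

definition mat_congruent :: "'r :: comm_ring_1 mat \<Rightarrow> 'r mat \<Rightarrow> bool" where
  "mat_congruent A B \<longleftrightarrow> (\<exists>n P. A \<in> carrier_mat n n \<and> B \<in> carrier_mat n n \<and> P \<in> carrier_mat n n \<and>
    det P dvd 1 \<and> A = P\<^sup>T * B * P)"

lemma mat_congruentI:
  "A \<in> carrier_mat n n \<Longrightarrow> B \<in> carrier_mat n n \<Longrightarrow> P \<in> carrier_mat n n \<Longrightarrow> det P dvd 1 \<Longrightarrow>
    A = P\<^sup>T * B * P \<Longrightarrow> mat_congruent A B"
  unfolding mat_congruent_def by blast

lemma mat_congruentE:
  assumes "mat_congruent A B"
  obtains n P where "A \<in> carrier_mat n n" "B \<in> carrier_mat n n" "P \<in> carrier_mat n n"
    "det P dvd 1" "A = P\<^sup>T * B * P"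
  using assms unfolding mat_congruent_def by blast

lemma unit_mult: "(a :: 'r :: comm_ring_1) dvd 1 \<Longrightarrow> b dvd 1 \<Longrightarrow> a * b dvd 1"
  using mult_dvd_mono[of a 1 b 1] by simp

lemma unimodular_carrier: "unimodular A \<Longrightarrow> A \<in> carrier_mat (dim_row A) (dim_row A)"
  unfolding unimodular_def square_mat.simps by (intro carrier_matI) blast+

lemma unimodularD:
  assumes "unimodular A"
  shows "A\<^sup>T = A" "det A dvd 1" "dim_col A = dim_row A"
    "\<And>i j. i < dim_row A \<Longrightarrow> j < dim_row A \<Longrightarrow> A $$ (j, i) = A $$ (i, j)"
proof -
  show tr: "A\<^sup>T = A" "det A dvd 1" "dim_col A = dim_row A"
    using assms unfolding unimodular_def square_mat.simps by blast+
  show "A $$ (j, i) = A $$ (i, j)" if "i < dim_row A" "j < dim_row A" for i j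
    using index_transpose_mat(1)[of j A i] that tr(3) unfolding tr(1) by simp
qed

lemma unimodularI:
  assumes "A \<in> carrier_mat n n" "A\<^sup>T = A" "det A dvd 1"
  shows "unimodular A"
  using assms unfolding unimodular_def square_mat.simps by blast

lemma invertible_matrix:
  fixes P :: "'r :: comm_ring_1 mat"
  assumes P: "P \<in> carrier_mat n n" and "det P dvd 1"
  obtains Q where "Q \<in> carrier_mat n n" "P * Q = 1\<^sub>m n" "Q * P = 1\<^sub>m n" "det Q dvd 1"
proof -
  obtain d where d: "det P * d = 1" using assms(2) unfolding dvd_def by metis
  note a = adj_mat[OF P]
  let ?Q = "d \<cdot>\<^sub>m adj_mat P"
  have d1: "d \<cdot>\<^sub>m (det P \<cdot>\<^sub>m 1\<^sub>m n) = 1\<^sub>m n"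
    using d by (intro eq_matI) (auto simp: mult.commute)
  have 1: "P * ?Q = 1\<^sub>m n"
    using mult_smult_distrib[OF P a(1), of d] a(2) d1 by simp
  have 2: "?Q * P = 1\<^sub>m n"
    using mult_smult_assoc_mat[OF a(1) P, of d] a(3) d1 by simp
  have Q: "?Q \<in> carrier_mat n n" using a(1) by simp
  have "det P * det ?Q = 1" using det_mult[OF P Q] unfolding 1 by simp
  then have "det ?Q dvd 1" by (intro dvdI[of _ _ "det P"]) (simp only: mult.commute)
  then show ?thesis by (rule that[OF Q 1 2])
qed

lemma mat_congruent_refl: "A \<in> carrier_mat n n \<Longrightarrow> mat_congruent A A"
  by (rule mat_congruentI[of _ n _ "1\<^sub>m n"]) auto

lemma mat_congruent_sym:
  assumes "mat_congruent A B" shows "mat_congruent B A"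
proof -
  obtain n P where *: "A \<in> carrier_mat n n" "B \<in> carrier_mat n n" "P \<in> carrier_mat n n"
    "det P dvd 1" "A = P\<^sup>T * B * P" using assms(1) by (elim mat_congruentE)
  obtain Q where Q: "Q \<in> carrier_mat n n" "P * Q = 1\<^sub>m n" "Q * P = 1\<^sub>m n" "det Q dvd 1"
    using invertible_matrix[OF *(3,4)] by blast
  have QP: "Q\<^sup>T * P\<^sup>T = 1\<^sub>m n" using transpose_mult[OF *(3) Q(1)] Q(2) by simp
  have "Q\<^sup>T * A * Q = Q\<^sup>T * (P\<^sup>T * B * P) * Q" using * by simp
  also have "\<dots> = (Q\<^sup>T * P\<^sup>T) * B * (P * Q)"
    using *(1-3) Q(1) by (simp add: assoc_mult_mat[of _ n n _ n _ n])
  also have "\<dots> = B" using QP Q *(2) by simp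
  finally show ?thesis using *(1,2) Q by (intro mat_congruentI[of _ n _ Q]) auto
qed

lemma mat_congruent_trans [trans]:
  assumes "mat_congruent A B" "mat_congruent B C" shows "mat_congruent A C"
proof -
  obtain n P where *: "A \<in> carrier_mat n n" "B \<in> carrier_mat n n" "P \<in> carrier_mat n n"
    "det P dvd 1" "A = P\<^sup>T * B * P" using assms(1) by (elim mat_congruentE)
  obtain m Q where Q: "B \<in> carrier_mat m m" "C \<in> carrier_mat m m" "Q \<in> carrier_mat m m"
    "det Q dvd 1" "B = Q\<^sup>T * C * Q" using assms(2) by (elim mat_congruentE)
  have "m = n" using *(2) Q(1) by (metis carrier_matD(1))
  note Q = Q(2-5)[unfolded this]
  have "A = (Q * P)\<^sup>T * C * (Q * P)"
    unfolding *(5) Q(4) transpose_mult[OF Q(2) *(3)]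
    using *(1-3) Q(1,2) by (simp add: assoc_mult_mat[of _ n n _ n _ n])
  moreover have "det (Q * P) dvd 1"
    using det_mult[OF Q(2) *(3)] Q(3) *(4) by (simp add: unit_mult)
  ultimately show ?thesis using *(1-3) Q(1,2) by (intro mat_congruentI[of _ n _ "Q * P"]) auto
qed

lemma mat_congruent_det:
  assumes "mat_congruent A B"
  shows "\<exists>s. s dvd 1 \<and> det A = det B * (s * s)"
proof -
  obtain n P where *: "A \<in> carrier_mat n n" "B \<in> carrier_mat n n" "P \<in> carrier_mat n n"
    "det P dvd 1" "A = P\<^sup>T * B * P" using assms(1) by (elim mat_congruentE)
  then have "det A = det B * (det P * det P)"
    using det_mult[of "P\<^sup>T * B" n P] det_mult[of "P\<^sup>T" n B] det_transpose[OF *(3)]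
    by (simp add: ac_simps)
  then show ?thesis using *(4) by blast
qed

lemma mat_congruent_dim: "mat_congruent A B \<Longrightarrow> dim_row A = dim_row B"
  unfolding mat_congruent_def by auto

lemma mat_congruent_unimodular:
  assumes "mat_congruent A B" "unimodular B" shows "unimodular A"
proof -
  obtain n P where *: "A \<in> carrier_mat n n" "B \<in> carrier_mat n n" "P \<in> carrier_mat n n"
    "det P dvd 1" "A = P\<^sup>T * B * P" using assms(1) by (elim mat_congruentE)
  have "A\<^sup>T = A"
    unfolding *(5) using *(2,3) unimodularD(1)[OF assms(2)]
    by (simp add: transpose_mult[of _ n n _ n] assoc_mult_mat[of _ n n _ n _ n])
  moreover have "det A dvd 1"
    using mat_congruent_det[OF assms(1)] unimodularD(2)[OF assms(2)] unit_mult by metis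
  ultimately show ?thesis using *(1) by (intro unimodularI)
qed

text \<open>Since det A = (det P)^2 det B is a unit, so is det P. Explicit base changes thus need no
  determinant computation.\<close>

lemma mat_congruentI_unimodular:
  assumes "unimodular A" "A = P\<^sup>T * B * P" "B \<in> carrier_mat n n" "P \<in> carrier_mat n n"
  shows "mat_congruent A B"
proof -
  have "det A = det P * (det B * det P)"
    using det_mult[of "P\<^sup>T * B" n P] det_mult[of "P\<^sup>T" n B] det_transpose[OF assms(4)] assms(3,4)
    unfolding assms(2) by (simp add: ac_simps)
  then have "det P dvd 1" using unimodularD(2)[OF assms(1)] dvd_mult_left by metis
  then show ?thesis
    using assms by (intro mat_congruentI[of _ n _ P]) auto
qed

lemma unimodular_block_sum:
  assumes "unimodular A" "unimodular B" shows "unimodular (block_sum A B)"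
proof (rule unimodularI)
  note c = unimodular_carrier[OF assms(1)] unimodular_carrier[OF assms(2)]
  show "block_sum A B \<in> carrier_mat (dim_row A + dim_row B) (dim_row A + dim_row B)"
    by (rule block_sum_carrier[OF c])
  show "(block_sum A B)\<^sup>T = block_sum A B"
    unfolding block_sum_transpose unimodularD(1)[OF assms(1)] unimodularD(1)[OF assms(2)] ..
  show "det (block_sum A B) dvd 1"
    unfolding det_block_sum[OF c] by (rule unit_mult[OF unimodularD(2)[OF assms(1)] unimodularD(2)[OF assms(2)]])
qed

lemma mat_congruent_block_sum:
  assumes "mat_congruent A A'" "mat_congruent B B'"
  shows "mat_congruent (block_sum A B) (block_sum A' B')"
proof -
  obtain n P where *: "A \<in> carrier_mat n n" "A' \<in> carrier_mat n n" "P \<in> carrier_mat n n"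
    "det P dvd 1" "A = P\<^sup>T * A' * P" using assms(1) by (elim mat_congruentE)
  obtain m Q where Q: "B \<in> carrier_mat m m" "B' \<in> carrier_mat m m" "Q \<in> carrier_mat m m"
    "det Q dvd 1" "B = Q\<^sup>T * B' * Q" using assms(2) by (elim mat_congruentE)
  have "block_sum A B = (block_sum P Q)\<^sup>T * block_sum A' B' * block_sum P Q"
    unfolding *(5) Q(5) block_sum_transpose using *(1-3) Q(1-3)
    by (simp add: block_sum_mult[of _ n n _ m m])
  moreover have "det (block_sum P Q) dvd 1"
    using *(4) Q(4) unfolding det_block_sum[OF *(3) Q(3)] by (rule unit_mult)
  ultimately show ?thesis using *(1-3) Q(1-3) by (intro mat_congruentI[of _ "n + m" _ "block_sum P Q"]) auto
qed

lemma mult_index_sum: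
  "A \<in> carrier_mat n m \<Longrightarrow> B \<in> carrier_mat m l \<Longrightarrow> i < n \<Longrightarrow> j < l \<Longrightarrow>
    (A * B) $$ (i, j) = (\<Sum>k<m. A $$ (i, k) * B $$ (k, j))"
  by (simp add: scalar_prod_def atLeast0LessThan)

lemma transpose_mult_index_sum:
  "A \<in> carrier_mat m n \<Longrightarrow> B \<in> carrier_mat m l \<Longrightarrow> i < n \<Longrightarrow> j < l \<Longrightarrow>
    (A\<^sup>T * B) $$ (i, j) = (\<Sum>k<m. A $$ (k, i) * B $$ (k, j))"
  by (simp add: scalar_prod_def atLeast0LessThan)

text \<open>The permutation matrix satisfies \<open>P\<^sup>T * P = 1\<^sub>m n\<close>, so its
  determinant has square 1. This makes it a unit without any appeal to the sign of the
  permutation.\<close>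

lemma mat_congruent_reindex:
  fixes A :: "'r :: comm_ring_1 mat"
  assumes A: "A \<in> carrier_mat n n" and inj: "inj_on f {..<n}" and f: "f ` {..<n} \<subseteq> {..<n}"
  shows "mat_congruent (mat n n (\<lambda>(i, j). A $$ (f i, f j))) A"
proof -
  define P :: "'r mat" where "P = mat n n (\<lambda>(i, j). if i = f j then 1 else 0)"
  have P: "P \<in> carrier_mat n n" by (simp add: P_def)
  have fn: "f i < n" if "i < n" for i using f that by auto
  have BP: "(B * P) $$ (i, j) = B $$ (i, f j)" if B: "B \<in> carrier_mat n n" and ij: "i < n" "j < n" for B i j
  proof -
    have "(B * P) $$ (i, j) = (\<Sum>k<n. if k = f j then B $$ (i, k) else 0)"
      unfolding mult_index_sum[OF B P ij] by (rule sum.cong) (use ij in \<open>auto simp: P_def\<close>)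
    then show ?thesis using fn[OF ij(2)] by simp
  qed
  have PB: "(P\<^sup>T * B) $$ (i, j) = B $$ (f i, j)" if B: "B \<in> carrier_mat n n" and ij: "i < n" "j < n" for B i j
  proof -
    have "(P\<^sup>T * B) $$ (i, j) = (\<Sum>k<n. if k = f i then B $$ (k, j) else 0)"
      unfolding transpose_mult_index_sum[OF P B ij] by (rule sum.cong) (use ij in \<open>auto simp: P_def\<close>)
    then show ?thesis using fn[OF ij(1)] by simp
  qed
  have "P\<^sup>T * P = 1\<^sub>m n"
  proof (rule eq_matI)
    fix i j assume "i < dim_row (1\<^sub>m n :: 'r mat)" "j < dim_col (1\<^sub>m n :: 'r mat)"
    then have ij: "i < n" "j < n" by auto
    have "(P\<^sup>T * P) $$ (i, j) = (if f i = f j then 1 else 0)"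
      unfolding PB[OF P ij] using fn ij by (simp add: P_def)
    then show "(P\<^sup>T * P) $$ (i, j) = 1\<^sub>m n $$ (i, j)"
      using ij by (simp add: inj_on_eq_iff[OF inj])
  qed (use P in auto)
  then have "det P * det P = 1"
    using det_mult[of "P\<^sup>T" n P] P det_transpose[OF P] by simp
  then have "det P dvd 1" by (intro dvdI[of _ _ "det P"]) simp
  moreover have "mat n n (\<lambda>(i, j). A $$ (f i, f j)) = P\<^sup>T * A * P"
  proof (rule eq_matI)
    fix i j assume "i < dim_row (P\<^sup>T * A * P)" "j < dim_col (P\<^sup>T * A * P)"
    then have ij: "i < n" "j < n" using P by auto
    have "P\<^sup>T * A \<in> carrier_mat n n" using P A by simp
    from BP[OF this ij] PB[OF A ij(1) fn[OF ij(2)]]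
    show "mat n n (\<lambda>(i, j). A $$ (f i, f j)) $$ (i, j) = (P\<^sup>T * A * P) $$ (i, j)"
      using ij by simp
  qed (use P in auto)
  ultimately show ?thesis using A P by (intro mat_congruentI[of _ n _ P]) auto
qed

lemma mat_congruent_block_sum_commute:
  assumes A: "A \<in> carrier_mat n n" and B: "B \<in> carrier_mat m m"
  shows "mat_congruent (block_sum A B) (block_sum B A)"
proof -
  define f where "f i = (if i < n then m + i else i - n)" for i
  have "block_sum A B = mat (m + n) (m + n) (\<lambda>(i, j). block_sum B A $$ (f i, f j))"
    using A B by (intro eq_matI) (auto simp: block_sum_index f_def)
  moreover have "mat_congruent (mat (m + n) (m + n) (\<lambda>(i, j). block_sum B A $$ (f i, f j))) (block_sum B A)"
    by (rule mat_congruent_reindex) (use A B in \<open>auto simp: f_def inj_on_def split: if_splits\<close>)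
  ultimately show ?thesis by simp
qed

text \<open>Adding \<open>c j\<close> times the \<open>k\<close>-th basis vector to the \<open>j\<close>-th one, for all \<open>j\<close>.\<close>

lemma mat_congruent_shear:
  fixes A :: "'r :: comm_ring_1 mat"
  assumes A: "A \<in> carrier_mat n n" and k: "k < n" "c k = 0"
  shows "mat_congruent (mat n n (\<lambda>(i, j). A $$ (i, j) + A $$ (i, k) * c j +
    c i * (A $$ (k, j) + A $$ (k, k) * c j))) A"
proof -
  define P where "P c = mat n n (\<lambda>(i, j). (if i = j then 1 else 0) + (if i = k then c j else 0))"
    for c :: "nat \<Rightarrow> 'r"
  have P: "P c \<in> carrier_mat n n" for c by (simp add: P_def)
  have BP: "(B * P c) $$ (i, j) = B $$ (i, j) + B $$ (i, k) * c j"
    if B: "B \<in> carrier_mat n n" and ij: "i < n" "j < n" for B c i j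
  proof -
    have "(B * P c) $$ (i, j) =
      (\<Sum>l<n. (if l = j then B $$ (i, l) else 0) + (if l = k then B $$ (i, l) * c j else 0))"
      unfolding mult_index_sum[OF B P ij] by (rule sum.cong) (use ij in \<open>auto simp: P_def algebra_simps\<close>)
    then show ?thesis using ij k(1) by (simp add: sum.distrib)
  qed
  have PB: "((P c)\<^sup>T * B) $$ (i, j) = B $$ (i, j) + c i * B $$ (k, j)"
    if B: "B \<in> carrier_mat n n" and ij: "i < n" "j < n" for B c i j
  proof -
    have "((P c)\<^sup>T * B) $$ (i, j) =
      (\<Sum>l<n. (if l = i then B $$ (l, j) else 0) + (if l = k then c i * B $$ (l, j) else 0))"
      unfolding transpose_mult_index_sum[OF P B ij] by (rule sum.cong) (use ij in \<open>auto simp: P_def algebra_simps\<close>)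
    then show ?thesis using ij k(1) by (simp add: sum.distrib)
  qed
  \<comment> \<open>Shearing by -c undoes shearing by c because \<open>c k = 0\<close>: the k-th
    basis vector itself does not move.\<close>
  have "P c * P (\<lambda>j. - c j) = 1\<^sub>m n"
  proof (rule eq_matI)
    fix i j assume "i < dim_row (1\<^sub>m n :: 'r mat)" "j < dim_col (1\<^sub>m n :: 'r mat)"
    then show "(P c * P (\<lambda>j. - c j)) $$ (i, j) = 1\<^sub>m n $$ (i, j)"
      using BP[OF P[of c], of i j "\<lambda>j. - c j"] k by (simp add: P_def)
  qed (use P in auto)
  then have "det (P c) * det (P (\<lambda>j. - c j)) = 1"
    using det_mult[OF P P, of c "\<lambda>j. - c j"] by simp
  then have "det (P c) dvd 1" by (intro dvdI[of _ _ "det (P (\<lambda>j. - c j))"]) simp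
  moreover have "mat n n (\<lambda>(i, j). A $$ (i, j) + A $$ (i, k) * c j +
    c i * (A $$ (k, j) + A $$ (k, k) * c j)) = (P c)\<^sup>T * A * P c" (is "?M = _")
  proof (rule eq_matI)
    fix i j assume "i < dim_row ((P c)\<^sup>T * A * P c)" "j < dim_col ((P c)\<^sup>T * A * P c)"
    then have ij: "i < n" "j < n" using P[of c] by auto
    have "((P c)\<^sup>T * A * P c) $$ (i, j) = ((P c)\<^sup>T * A) $$ (i, j) + ((P c)\<^sup>T * A) $$ (i, k) * c j"
      using P[of c] A ij by (intro BP) auto
    then show "?M $$ (i, j) = ((P c)\<^sup>T * A * P c) $$ (i, j)"
      using PB[OF A ij(1)] ij k by (simp add: algebra_simps)
  qed (use P[of c] in auto)
  ultimately show ?thesis using A P[of c] by (intro mat_congruentI[of _ n _ "P c"]) auto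
qed

definition scal :: "'r \<Rightarrow> 'r mat" where "scal a = mat 1 1 (\<lambda>_. a)"

lemma scal_carrier [simp]: "scal a \<in> carrier_mat 1 1" "dim_row (scal a) = 1" "dim_col (scal a) = 1"
  by (simp_all add: scal_def)

lemmas scal_carrier_Suc [simp] = scal_carrier[unfolded One_nat_def]

lemma scal_index [simp]: "scal a $$ (0, 0) = a"
  by (simp add: scal_def)

lemma det_scal [simp]: "det (scal a) = a"
  by (simp add: scal_def det_single)

lemma unimodular_scal: "unimodular (scal a) \<longleftrightarrow> a dvd 1"
proof -
  have "(scal a)\<^sup>T = scal a" by (rule eq_matI) (auto simp: scal_def)
  then show ?thesis by (metis det_scal scal_carrier(1) unimodularD(2) unimodularI)
qed

lemma unimodular_one: "unimodular (1\<^sub>m n)"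
  by (rule unimodularI[of _ n]) simp_all

text \<open>One step of orthogonalisation: a vector of unit norm is split off by subtracting from
  every other basis vector its projection, and the transposition \<open>f\<close> brings the pivot
  to the front. The complement is given entry by entry because \<open>stable_normal_form\<close> has
  to inspect one of its diagonal entries.\<close>

lemma mat_congruent_split_pivot:
  fixes A :: "'r :: comm_ring_1 mat"
  assumes A: "A \<in> carrier_mat (Suc n) (Suc n)" "A\<^sup>T = A" and k: "k < Suc n" and b: "A $$ (k, k) * b = 1"
  defines "f \<equiv> Transposition.transpose 0 k"
  shows "mat_congruent A (block_sum (scal (A $$ (k, k)))
    (mat n n (\<lambda>(i, j). A $$ (f (Suc i), f (Suc j)) - b * A $$ (f (Suc i), k) * A $$ (f (Suc j), k))))"
    (is "mat_congruent A ?D")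
proof -
  have sym: "A $$ (k, i) = A $$ (i, k)" if "i < Suc n" for i
    using A k that index_transpose_mat(1)[of k A i] by simp
  \<comment> \<open>The coefficient for which e_j + c_j e_k is orthogonal to e_k; \<open>b\<close>
    is the inverse of the pivot.\<close>
  define c where "c j = (if j = k then 0 else - b * A $$ (j, k))" for j
  define M where "M = mat (Suc n) (Suc n) (\<lambda>(i, j). A $$ (i, j) + A $$ (i, k) * c j +
    c i * (A $$ (k, j) + A $$ (k, k) * c j))"
  have MA: "mat_congruent M A"
    unfolding M_def using A k by (intro mat_congruent_shear) (auto simp: c_def)
  have z: "A $$ (k, j) + A $$ (k, k) * c j = 0" if "j < Suc n" "j \<noteq> k" for j
  proof -
    have "A $$ (k, k) * c j = - (A $$ (k, k) * b) * A $$ (j, k)"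
      using that(2) by (simp add: c_def mult.assoc)
    then show ?thesis unfolding b using sym[OF that(1)] by simp
  qed
  have M: "M $$ (i, j) = (if i = k then if j = k then A $$ (k, k) else 0 else if j = k then 0
    else A $$ (i, j) - b * A $$ (i, k) * A $$ (j, k))" if ij: "i < Suc n" "j < Suc n" for i j
  proof -
    have M: "M $$ (i, j) = A $$ (i, j) + A $$ (i, k) * c j + c i * (A $$ (k, j) + A $$ (k, k) * c j)"
      using ij by (simp add: M_def)
    have ck: "c k = 0" by (simp add: c_def)
    consider "i = k" "j = k" | "i = k" "j \<noteq> k" | "i \<noteq> k" "j = k" | "i \<noteq> k" "j \<noteq> k" by blast
    then show ?thesis
    proof cases
      case 3
      have "A $$ (i, k) + A $$ (k, k) * c i = 0"
        using z[OF ij(1) 3(1)] sym[OF ij(1)] by simp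
      then show ?thesis using 3 M ck by (simp add: mult.commute)
    next
      case 4
      have "M $$ (i, j) = A $$ (i, j) + A $$ (i, k) * c j" unfolding M z[OF ij(2) 4(2)] by simp
      then show ?thesis using 4 by (simp add: c_def ac_simps)
    qed (use M ck z ij in simp_all)
  qed
  have fn: "f i < Suc n" if "i < Suc n" for i using that k by (simp add: f_def Transposition.transpose_def)
  have fk: "f i = k \<longleftrightarrow> i = 0" for i by (simp add: f_def Transposition.transpose_def)
  have "?D = mat (Suc n) (Suc n) (\<lambda>(i, j). M $$ (f i, f j))"
  proof (rule eq_matI)
    fix i j assume "i < dim_row (mat (Suc n) (Suc n) (\<lambda>(i, j). M $$ (f i, f j)))"
      "j < dim_col (mat (Suc n) (Suc n) (\<lambda>(i, j). M $$ (f i, f j)))"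
    then have ij: "i < Suc n" "j < Suc n" by auto
    then show "?D $$ (i, j) = mat (Suc n) (Suc n) (\<lambda>(i, j). M $$ (f i, f j)) $$ (i, j)"
      by (cases i; cases j) (simp_all add: block_sum_index M fn fk)
  qed auto
  moreover have "mat_congruent (mat (Suc n) (Suc n) (\<lambda>(i, j). M $$ (f i, f j))) M"
  proof (rule mat_congruent_reindex)
    show "inj_on f {..<Suc n}" unfolding f_def by (rule inj_on_subset[OF inj_transpose subset_UNIV])
  qed (use fn in \<open>auto simp: M_def\<close>)
  ultimately have "mat_congruent ?D A" using mat_congruent_trans[OF _ MA] by simp
  then show ?thesis by (rule mat_congruent_sym)
qed

text \<open>On Gram matrices this is equality of classes in the Grothendieck group. Unlike
  congruence it admits cancellation of unimodular summands, which is what the manipulations of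
  diagonal forms below rely on.\<close>

definition stably_congruent :: "'r :: comm_ring_1 mat \<Rightarrow> 'r mat \<Rightarrow> bool" where
  "stably_congruent A B \<longleftrightarrow> square_mat A \<and> square_mat B \<and> (\<exists>E. unimodular E \<and> mat_congruent (block_sum A E) (block_sum B E))"

lemma stably_congruent_congruent:
  assumes "mat_congruent A B" shows "stably_congruent A B"
proof -
  have sq: "square_mat A" "square_mat B"
    using assms by (auto elim!: mat_congruentE simp del: index_mult_mat)
  have "mat_congruent (block_sum A (1\<^sub>m 0)) (block_sum B (1\<^sub>m 0))"
    using assms unfolding block_sum_empty(2)[OF one_carrier_mat] .
  then show ?thesis
    unfolding stably_congruent_def using sq unimodular_one by blast
qed

lemma stably_congruent_refl: "A \<in> carrier_mat n n \<Longrightarrow> stably_congruent A A"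
  by (intro stably_congruent_congruent mat_congruent_refl)

lemma stably_congruent_sym: "stably_congruent A B \<Longrightarrow> stably_congruent B A"
  unfolding stably_congruent_def using mat_congruent_sym by blast

lemma block_sum_commute_right:
  assumes "square_mat A" "square_mat B" "square_mat C"
  shows "mat_congruent (block_sum (block_sum A B) C) (block_sum (block_sum A C) B)"
  unfolding block_sum_assoc[symmetric]
  using assms by (intro mat_congruent_block_sum mat_congruent_refl mat_congruent_block_sum_commute carrier_matI) auto

lemma stably_congruent_trans [trans]:
  assumes "stably_congruent A B" "stably_congruent B C" shows "stably_congruent A C"
proof -
  obtain E where E: "unimodular E" "mat_congruent (block_sum A E) (block_sum B E)"
    using assms(1) unfolding stably_congruent_def by blast
  obtain F where F: "unimodular F" "mat_congruent (block_sum B F) (block_sum C F)"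
    using assms(2) unfolding stably_congruent_def by blast
  have sq: "square_mat A" "square_mat B" "square_mat C" "square_mat E" "square_mat F"
    using assms E(1) F(1) unimodularD(3) unfolding stably_congruent_def square_mat.simps by blast+
  have r: "mat_congruent E E" "mat_congruent F F"
    using sq by (auto intro!: mat_congruent_refl carrier_matI)
  have "mat_congruent (block_sum (block_sum A E) F) (block_sum (block_sum B E) F)"
    by (rule mat_congruent_block_sum[OF E(2) r(2)])
  also have "mat_congruent \<dots> (block_sum (block_sum B F) E)"
    by (rule block_sum_commute_right) (use sq in auto)
  also have "mat_congruent \<dots> (block_sum (block_sum C F) E)"
    by (rule mat_congruent_block_sum[OF F(2) r(1)])
  also have "mat_congruent \<dots> (block_sum (block_sum C E) F)"
    by (rule block_sum_commute_right) (use sq in auto)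
  finally show ?thesis
    unfolding stably_congruent_def block_sum_assoc[symmetric] using sq unimodular_block_sum[OF E(1) F(1)] by blast
qed

lemma stably_congruent_block_sum:
  assumes "stably_congruent A A'" "stably_congruent B B'"
  shows "stably_congruent (block_sum A B) (block_sum A' B')"
proof -
  obtain E where E: "unimodular E" "mat_congruent (block_sum A E) (block_sum A' E)"
    using assms(1) unfolding stably_congruent_def by blast
  obtain F where F: "unimodular F" "mat_congruent (block_sum B F) (block_sum B' F)"
    using assms(2) unfolding stably_congruent_def by blast
  have sq: "square_mat A" "square_mat B" "square_mat A'" "square_mat B'" "square_mat E" "square_mat F"
    using assms E(1) F(1) unimodularD(3) unfolding stably_congruent_def square_mat.simps by blast+
  have swap: "mat_congruent (block_sum (block_sum C D) (block_sum E F)) (block_sum (block_sum C E) (block_sum D F))"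
    if "square_mat C" "square_mat D" for C D
    unfolding block_sum_assoc[of _ _ F]
    by (intro mat_congruent_block_sum[of _ _ F F] block_sum_commute_right mat_congruent_refl carrier_matI)
       (use sq that in auto)
  have "mat_congruent (block_sum (block_sum A B) (block_sum E F)) (block_sum (block_sum A E) (block_sum B F))"
    using sq by (intro swap)
  also have "mat_congruent \<dots> (block_sum (block_sum A' E) (block_sum B' F))"
    by (rule mat_congruent_block_sum[OF E(2) F(2)])
  also have "mat_congruent \<dots> (block_sum (block_sum A' B') (block_sum E F))"
    using sq by (intro mat_congruent_sym[OF swap])
  finally show ?thesis
    unfolding stably_congruent_def using sq unimodular_block_sum[OF E(1) F(1)] by auto
qed

lemma stably_congruent_cancel:
  assumes "stably_congruent (block_sum A C) (block_sum B C)" "unimodular C" "square_mat A" "square_mat B"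
  shows "stably_congruent A B"
proof -
  obtain E where "unimodular E" "mat_congruent (block_sum (block_sum A C) E) (block_sum (block_sum B C) E)"
    using assms(1) unfolding stably_congruent_def by blast
  then show ?thesis
    unfolding stably_congruent_def block_sum_assoc[symmetric]
    using unimodular_block_sum[OF assms(2)] assms(3,4) by blast
qed

section \<open>Kronecker products\<close>

text \<open>A pair (i, j) is coded row by row as \<open>i * m + j\<close>. This exchange of a single
  sum for a double sum underlies all computations with Kronecker products.\<close>

lemma sum_div_mod:
  "(\<Sum>k<n * m. g (k div m) (k mod m)) = (\<Sum>i<n. \<Sum>j<m. (g i j :: 'a :: comm_monoid_add))" for n m :: nat
proof -
  have "(\<Sum>i<n. \<Sum>j<m. g i j) = (\<Sum>i<n. \<Sum>k\<in>{i * m..<i * m + m}. g (k div m) (k mod m))"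
  proof (rule sum.cong[OF refl])
    fix i
    have "(\<Sum>k\<in>{i * m..<i * m + m}. g (k div m) (k mod m)) = (\<Sum>j\<in>{0..<m}. g ((j + i * m) div m) ((j + i * m) mod m))"
      using sum.shift_bounds_nat_ivl[of "\<lambda>k. g (k div m) (k mod m)" 0 "i * m" m] by (simp add: add.commute)
    also have "\<dots> = (\<Sum>j<m. g i j)"
      by (rule sum.cong) auto
    finally show "(\<Sum>j<m. g i j) = (\<Sum>k\<in>{i * m..<i * m + m}. g (k div m) (k mod m))" ..
  qed
  then show ?thesis by (simp add: sum.nat_group)
qed

definition kron :: "'r :: times mat \<Rightarrow> 'r mat \<Rightarrow> 'r mat" where
  "kron A B = mat (dim_row A * dim_row B) (dim_col A * dim_col B)
    (\<lambda>(i, j). A $$ (i div dim_row B, j div dim_col B) * B $$ (i mod dim_row B, j mod dim_col B))"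

lemma kron_carrier [simp]:
  "A \<in> carrier_mat n n' \<Longrightarrow> B \<in> carrier_mat m m' \<Longrightarrow> kron A B \<in> carrier_mat (n * m) (n' * m')"
  by (simp add: kron_def)

lemma dim_kron [simp]:
  "dim_row (kron A B) = dim_row A * dim_row B" "dim_col (kron A B) = dim_col A * dim_col B"
  by (simp_all add: kron_def)

lemma kron_index:
  "A \<in> carrier_mat n n' \<Longrightarrow> B \<in> carrier_mat m m' \<Longrightarrow> i < n * m \<Longrightarrow> j < n' * m' \<Longrightarrow>
    kron A B $$ (i, j) = A $$ (i div m, j div m') * B $$ (i mod m, j mod m')"
  by (simp add: kron_def)

lemma div_mod_less: "(i :: nat) < n * m \<Longrightarrow> i div m < n" "i < n * m \<Longrightarrow> i mod m < m"
  by (simp_all add: less_mult_imp_div_less) (metis mod_less_divisor mult_0_right not_gr_zero not_less0)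

lemma kron_mult:
  fixes A :: "'r :: comm_semiring_0 mat"
  assumes A: "A \<in> carrier_mat n n" and B: "B \<in> carrier_mat m m"
    and C: "C \<in> carrier_mat n n" and D: "D \<in> carrier_mat m m"
  shows "kron A B * kron C D = kron (A * C) (B * D)"
proof (rule eq_matI)
  fix i j assume "i < dim_row (kron (A * C) (B * D))" "j < dim_col (kron (A * C) (B * D))"
  then have ij: "i < n * m" "j < n * m" using A B C D by auto
  note dm = div_mod_less[OF ij(1)] div_mod_less[OF ij(2)]
  have "(kron A B * kron C D) $$ (i, j) = (\<Sum>k<n * m. kron A B $$ (i, k) * kron C D $$ (k, j))"
    by (rule mult_index_sum[OF kron_carrier[OF A B] kron_carrier[OF C D] ij])
  also have "\<dots> = (\<Sum>k<n * m. (A $$ (i div m, k div m) * C $$ (k div m, j div m)) *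
    (B $$ (i mod m, k mod m) * D $$ (k mod m, j mod m)))"
    by (rule sum.cong) (simp_all add: kron_index[OF A B ij(1)] kron_index[OF C D _ ij(2)] ac_simps)
  also have "\<dots> = (\<Sum>k<n. A $$ (i div m, k) * C $$ (k, j div m)) * (\<Sum>l<m. B $$ (i mod m, l) * D $$ (l, j mod m))"
    unfolding sum_product by (rule sum_div_mod)
  also have "\<dots> = (A * C) $$ (i div m, j div m) * (B * D) $$ (i mod m, j mod m)"
    using dm by (simp only: mult_index_sum[OF A C] mult_index_sum[OF B D])
  also have "\<dots> = kron (A * C) (B * D) $$ (i, j)"
    by (rule kron_index[OF mult_carrier_mat[OF A C] mult_carrier_mat[OF B D] ij, symmetric])
  finally show "(kron A B * kron C D) $$ (i, j) = kron (A * C) (B * D) $$ (i, j)" .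
qed (use A B C D in auto)

lemma kron_transpose: "(kron A B)\<^sup>T = kron A\<^sup>T B\<^sup>T"
proof (rule eq_matI)
  fix i j assume "i < dim_row (kron A\<^sup>T B\<^sup>T)" "j < dim_col (kron A\<^sup>T B\<^sup>T)"
  then have ij: "i < dim_col A * dim_col B" "j < dim_row A * dim_row B" by simp_all
  then show "(kron A B)\<^sup>T $$ (i, j) = kron A\<^sup>T B\<^sup>T $$ (i, j)"
    using div_mod_less[OF ij(1)] div_mod_less[OF ij(2)] by (simp add: kron_def)
qed simp_all

text \<open>In the row-by-row coding the product with an identity matrix is block diagonal with
  copies of \<open>B\<close>. Peeling off one copy gives the induction for its determinant.\<close>

lemma kron_one_Suc:
  fixes B :: "'r :: semiring_1 mat"
  assumes B: "B \<in> carrier_mat m m"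
  shows "kron (1\<^sub>m (Suc n)) B = block_sum B (kron (1\<^sub>m n) B)"
proof (rule eq_matI)
  fix i j assume "i < dim_row (block_sum B (kron (1\<^sub>m n) B))" "j < dim_col (block_sum B (kron (1\<^sub>m n) B))"
  then have ij: "i < m + n * m" "j < m + n * m" using B by simp_all
  have m: "m > 0" using ij by (cases m) auto
  have dm: "i' < m \<Longrightarrow> i' div m = 0 \<and> i' mod m = i'"
    "\<not> i' < m \<Longrightarrow> i' div m = Suc ((i' - m) div m) \<and> i' mod m = (i' - m) mod m" for i'
    using m by (auto simp: div_if mod_if)
  have lt: "i' < m + n * m \<Longrightarrow> \<not> i' < m \<Longrightarrow> i' - m < n * m" for i' by simp
  have lhs: "kron (1\<^sub>m (Suc n)) B $$ (i, j) = (if i div m = j div m then B $$ (i mod m, j mod m) else 0)"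
    using ij div_mod_less[of i "Suc n" m] div_mod_less[of j "Suc n" m]
    by (simp add: kron_index[OF one_carrier_mat B])
  have r: "kron (1\<^sub>m n) B $$ (i', j') = (if i' div m = j' div m then B $$ (i' mod m, j' mod m) else 0)"
    if "i' < n * m" "j' < n * m" for i' j'
    using that div_mod_less[OF that(1)] div_mod_less[OF that(2)] by (simp add: kron_index[OF one_carrier_mat B])
  show "kron (1\<^sub>m (Suc n)) B $$ (i, j) = block_sum B (kron (1\<^sub>m n) B) $$ (i, j)"
  proof (cases "i < m"; cases "j < m")
    assume "\<not> i < m" "\<not> j < m"
    then show ?thesis
      unfolding lhs using B ij dm[of i] dm[of j] r[OF lt lt, of i j] by (simp add: block_sum_index)
  qed (use lhs B ij dm[of i] dm[of j] in \<open>simp_all add: block_sum_index\<close>)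
qed (use B in auto)

lemma det_kron_one:
  fixes B :: "'r :: comm_ring_1 mat"
  assumes B: "B \<in> carrier_mat m m"
  shows "det (kron (1\<^sub>m n) B) = det B ^ n"
proof (induction n)
  case 0
  have "kron (1\<^sub>m 0) B \<in> carrier_mat 0 0" using kron_carrier[OF one_carrier_mat B, of 0] by simp
  then show ?case by simp
next
  case (Suc n)
  then show ?case
    unfolding kron_one_Suc[OF B] det_block_sum[OF B kron_carrier[OF one_carrier_mat B]] by simp
qed

text \<open>Exchanging the two tensor factors only recodes the index pairs, which is one permutation
  applied to rows and columns alike.\<close>

lemma kron_swap:
  fixes A :: "'r :: comm_ring_1 mat"
  assumes A: "A \<in> carrier_mat n n" and B: "B \<in> carrier_mat m m"
  shows "mat_congruent (kron A B) (kron B A)"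
proof -
  define f where "f k = (k mod m) * n + k div m" for k
  have f: "f k < m * n" "f k div n = k mod m" "f k mod n = k div m" if "k < n * m" for k
  proof -
    note dm = div_mod_less[OF that]
    have "f k < (k mod m) * n + n" using dm(1) by (simp add: f_def)
    also have "\<dots> = Suc (k mod m) * n" by simp
    also have "\<dots> \<le> m * n" using dm(2) by (intro mult_le_mono1) simp
    finally show "f k < m * n" .
    show "f k div n = k mod m" "f k mod n = k div m" using dm(1) by (simp_all add: f_def)
  qed
  have "kron A B = mat (m * n) (m * n) (\<lambda>(i, j). kron B A $$ (f i, f j))"
  proof (rule eq_matI)
    fix i j assume "i < dim_row (mat (m * n) (m * n) (\<lambda>(i, j). kron B A $$ (f i, f j)))"
      "j < dim_col (mat (m * n) (m * n) (\<lambda>(i, j). kron B A $$ (f i, f j)))"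
    then have ij: "i < n * m" "j < n * m" by (simp_all add: mult.commute)
    show "kron A B $$ (i, j) = mat (m * n) (m * n) (\<lambda>(i, j). kron B A $$ (f i, f j)) $$ (i, j)"
      using ij f[OF ij(1)] f[OF ij(2)]
      by (simp add: kron_index[OF A B] kron_index[OF B A] mult.commute)
  qed (use A B in \<open>auto simp: mult.commute\<close>)
  moreover have "mat_congruent (mat (m * n) (m * n) (\<lambda>(i, j). kron B A $$ (f i, f j))) (kron B A)"
  proof (rule mat_congruent_reindex)
    show "kron B A \<in> carrier_mat (m * n) (m * n)" using A B by simp
    show "inj_on f {..<m * n}"
    proof (rule inj_onI)
      fix k l assume "k \<in> {..<m * n}" "l \<in> {..<m * n}" and eq: "f k = f l"
      then have "k < n * m" "l < n * m" by (simp_all add: mult.commute)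
      then show "k = l" using f(2,3)[of k] f(2,3)[of l] eq by (metis div_mult_mod_eq)
    qed
    show "f ` {..<m * n} \<subseteq> {..<m * n}" using f(1) by (auto simp: mult.commute)
  qed
  ultimately show ?thesis by simp
qed

text \<open>The product factors as (A tensor 1)(1 tensor B). The second factor is block diagonal,
  while the first is only compared with its swapped version by a congruence; this costs a unit
  square, which is invisible to discriminants.\<close>

lemma det_kron:
  fixes A :: "'r :: comm_ring_1 mat"
  assumes A: "A \<in> carrier_mat n n" and B: "B \<in> carrier_mat m m"
  shows "\<exists>s. s dvd 1 \<and> det (kron A B) = det A ^ m * det B ^ n * (s * s)"
proof -
  obtain s where s: "s dvd 1" "det (kron A (1\<^sub>m m)) = det (kron (1\<^sub>m m) A) * (s * s)"
    using mat_congruent_det[OF kron_swap[OF A one_carrier_mat]] by blast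
  have "kron A B = kron A (1\<^sub>m m) * kron (1\<^sub>m n) B"
    using kron_mult[OF A one_carrier_mat one_carrier_mat B] A B by simp
  moreover have "det (kron A (1\<^sub>m m) * kron (1\<^sub>m n) B) = det (kron A (1\<^sub>m m)) * det (kron (1\<^sub>m n) B)"
    by (rule det_mult[OF kron_carrier[OF A one_carrier_mat] kron_carrier[OF one_carrier_mat B]])
  ultimately have "det (kron A B) = det A ^ m * det B ^ n * (s * s)"
    unfolding s(2) det_kron_one[OF A] det_kron_one[OF B] by (simp add: ac_simps)
  then show ?thesis using s(1) by blast
qed

lemma unit_power: "(a :: 'r :: comm_ring_1) dvd 1 \<Longrightarrow> a ^ n dvd 1"
proof (induction n)
  case (Suc n)
  then show ?case unfolding power_Suc by (intro unit_mult)
qed simp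

lemma unimodular_kron:
  assumes A: "unimodular A" and B: "unimodular B"
  shows "unimodular (kron A B)"
proof (rule unimodularI)
  show "kron A B \<in> carrier_mat (dim_row A * dim_row B) (dim_row A * dim_row B)"
    by (rule kron_carrier[OF unimodular_carrier[OF A] unimodular_carrier[OF B]])
  show "(kron A B)\<^sup>T = kron A B"
    unfolding kron_transpose unimodularD(1)[OF A] unimodularD(1)[OF B] ..
  obtain s where "s dvd 1" "det (kron A B) = det A ^ dim_row B * det B ^ dim_row A * (s * s)"
    using det_kron[OF unimodular_carrier[OF A] unimodular_carrier[OF B]] by blast
  then show "det (kron A B) dvd 1"
    by (simp only:) (intro unit_mult unit_power unimodularD(2)[OF A] unimodularD(2)[OF B])
qed

section \<open>Stable classification over the truncated polynomial ring\<close>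

lemma block_sum_mat_diag:
  "block_sum (mat_diag n d) (mat_diag m e) = mat_diag (n + m) (\<lambda>i. if i < n then d i else e (i - n))"
  by (rule eq_matI) (auto simp: block_sum_index mat_diag_def)

lemma scal_mat_diag: "scal a = mat_diag 1 (\<lambda>_. a)"
  by (rule eq_matI) (auto simp: scal_def mat_diag_def)

lemma congruent_mat_diag_index:
  fixes d :: "nat \<Rightarrow> 'r :: comm_ring_1"
  assumes ij: "i < n" "j < n"
  shows "((mat n n p)\<^sup>T * mat_diag n d * mat n n p) $$ (i, j) = (\<Sum>k<n. p (k, i) * d k * p (k, j))"
proof -
  have P: "mat n n p \<in> carrier_mat n n" by simp
  have "((mat n n p)\<^sup>T * mat_diag n d * mat n n p) $$ (i, j) =
    (\<Sum>k<n. ((mat n n p)\<^sup>T * mat_diag n d) $$ (i, k) * mat n n p $$ (k, j))"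
    using ij mult_carrier_mat[of "(mat n n p)\<^sup>T" n n "mat_diag n d" n]
    by (intro mult_index_sum[of _ n n _ n]) simp_all
  also have "\<dots> = (\<Sum>k<n. p (k, i) * d k * p (k, j))"
    using ij by (intro sum.cong refl) (simp add: mat_diag_mult_right[of _ n n])
  finally show ?thesis .
qed

text \<open>The columns of \<open>p\<close> are new basis vectors; the second hypothesis says that
  they are orthogonal for the form \<open>d\<close> with norms \<open>e\<close>. That they form a
  basis follows from the norms being units.\<close>

lemma mat_congruent_mat_diagI:
  fixes d e :: "nat \<Rightarrow> 'r :: comm_ring_1"
  assumes "\<And>i. i < n \<Longrightarrow> e i dvd 1"
    and "\<And>i j. i < n \<Longrightarrow> j < n \<Longrightarrow> (\<Sum>k<n. p (k, i) * d k * p (k, j)) = (if i = j then e i else 0)"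
  shows "mat_congruent (mat_diag n e) (mat_diag n d)"
proof (rule mat_congruentI_unimodular[of _ "mat n n p" _ n])
  show "mat_diag n e = (mat n n p)\<^sup>T * mat_diag n d * mat n n p"
  proof (rule eq_matI)
    fix i j assume "i < dim_row ((mat n n p)\<^sup>T * mat_diag n d * mat n n p)"
      "j < dim_col ((mat n n p)\<^sup>T * mat_diag n d * mat n n p)"
    then have ij: "i < n" "j < n" by simp_all
    show "mat_diag n e $$ (i, j) = ((mat n n p)\<^sup>T * mat_diag n d * mat n n p) $$ (i, j)"
      unfolding congruent_mat_diag_index[OF ij] assms(2)[OF ij] using ij by (simp add: mat_diag_def)
  qed (simp_all add: mat_diag_def)
  show "unimodular (mat_diag n e)"
  proof (rule unimodularI[of _ n])
    show "(mat_diag n e)\<^sup>T = mat_diag n e"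
      by (rule eq_matI) (auto simp: mat_diag_def)
    have "diag_mat (mat_diag n e) = map e [0..<n]"
      by (auto simp: diag_mat_def mat_diag_def)
    then have "det (mat_diag n e) = prod_list (map e [0..<n])"
      using det_upper_triangular[of "mat_diag n e" n] by (auto simp: mat_diag_def upper_triangular_def)
    moreover have "prod_list (map e [0..<k]) dvd 1" if "k \<le> n" for k
      using that
    proof (induction k)
      case (Suc k)
      then have "prod_list (map e [0..<k]) * e k dvd 1" by (intro unit_mult assms(1)) auto
      then show ?case by simp
    qed simp
    ultimately show "det (mat_diag n e) dvd 1" by simp
  qed simp
qed simp_all

lemma sum_lessThan_two: "(\<Sum>k<1 + 1. f k) = f 0 + f 1" for f :: "nat \<Rightarrow> 'a :: comm_monoid_add"
  by (simp add: lessThan_Suc add.commute)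

lemma sum_lessThan_four:
  "(\<Sum>k<1 + 1 + (1 + 1). f k) = f 0 + f 1 + f 2 + f 3" for f :: "nat \<Rightarrow> 'a :: comm_monoid_add"
  by (simp add: lessThan_Suc numeral_eq_Suc ac_simps)

text \<open>Take the vector s e_1 + t e_2 of norm c = s^2 a + t^2 b together with the vector -t b
  e_1 + s a e_2 orthogonal to it, whose norm is a b c.\<close>

lemma binary_congruent:
  fixes a b :: "'r :: comm_ring_1"
  assumes "a dvd 1" "b dvd 1" "s * s * a + t * t * b dvd 1"
  shows "mat_congruent (block_sum (scal a) (scal b))
    (block_sum (scal (s * s * a + t * t * b)) (scal (a * b * (s * s * a + t * t * b))))"
proof (rule mat_congruent_sym)
  let ?p = "\<lambda>(i, j). if i = (0::nat) then (if j = 0 then s else - (t * b)) else (if j = (0::nat) then t else s * a) :: 'r"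
  let ?e = "\<lambda>i. if i < 1 then s * s * a + t * t * b else a * b * (s * s * a + t * t * b)"
  show "mat_congruent (block_sum (scal (s * s * a + t * t * b)) (scal (a * b * (s * s * a + t * t * b))))
    (block_sum (scal a) (scal b))"
    unfolding scal_mat_diag block_sum_mat_diag
  proof (rule mat_congruent_mat_diagI[where p = ?p])
    show "(if i < 1 then s * s * a + t * t * b else a * b * (s * s * a + t * t * b)) dvd 1" for i :: nat
      using assms by (auto intro: unit_mult)
    fix i j :: nat assume "i < 1 + 1" "j < 1 + 1"
    then have "i = 0 \<or> i = 1" "j = 0 \<or> j = 1" by auto
    then show "(\<Sum>k<1 + 1. ?p (k, i) * (if k < 1 then a else b) * ?p (k, j)) = (if i = j then ?e i else 0)"
      unfolding sum_lessThan_two by (elim disjE) (simp_all add: algebra_simps)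
  qed
qed

text \<open>In characteristic 2, \<open>\<langle>a, a, 1, b\<rangle> \<cong> \<langle>1, 1, 1, b\<rangle>\<close> for \<open>a b = 1\<close>: the vector \<open>v = e\<^sub>1 + e\<^sub>2\<close> is
  isotropic, \<open>w = b e\<^sub>1 + e\<^sub>3 + e\<^sub>4\<close> satisfies \<open>(v, w) = (w, w) = 1\<close>, and \<open>e\<^sub>3 + v\<close>, \<open>e\<^sub>4 + b v\<close> are
  orthogonal to both. The basis below is \<open>v + w\<close>, \<open>w\<close>, \<open>e\<^sub>3 + v\<close>, \<open>e\<^sub>4 + b v\<close>.\<close>

lemma double_stably_congruent:
  fixes a :: trunc
  assumes "a dvd 1"
  shows "stably_congruent (block_sum (scal a) (scal a)) (block_sum (scal 1) (scal 1))"
proof -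
  obtain b where ab: "a * b = 1" using assms unfolding dvd_def by metis
  then have b: "b dvd 1" by (metis dvd_triv_right)
  let ?p = "\<lambda>(i, j). [[1 + b, b, 1, b], [1, 0, 1, b], [1, 1, 1, 0], [1, 1, 0, 1]] ! i ! j"
  have two: "x + (x + y) = y" for x y :: trunc by (simp add: add.assoc[symmetric])
  have ab': "a * (b * x) = x" "b * (a * x) = x" "b * a = 1" for x
    using ab by (simp_all add: mult.assoc[symmetric] mult.commute[of b a])
  have "mat_congruent (block_sum (block_sum (scal 1) (scal 1)) (block_sum (scal 1) (scal b)))
     (block_sum (block_sum (scal a) (scal a)) (block_sum (scal 1) (scal b)))"
    unfolding scal_mat_diag block_sum_mat_diag
  proof (rule mat_congruent_mat_diagI[where p = ?p])
    let ?d = "\<lambda>i::nat. if i < 1 + 1 then if i < 1 then a else a else if i - (1 + 1) < 1 then 1 else b"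
    let ?e = "\<lambda>i::nat. if i < 1 + 1 then if i < 1 then 1 else 1 else if i - (1 + 1) < 1 then 1 else b"
    show "?e i dvd 1" for i using b by simp
    fix i j :: nat assume "i < 1 + 1 + (1 + 1)" "j < 1 + 1 + (1 + 1)"
    then have "i = 0 \<or> i = 1 \<or> i = 2 \<or> i = 3" "j = 0 \<or> j = 1 \<or> j = 2 \<or> j = 3" by auto
    then show "(\<Sum>k<1 + 1 + (1 + 1). ?p (k, i) * ?d k * ?p (k, j)) = (if i = j then ?e i else 0)"
      unfolding sum_lessThan_four
      by (elim disjE) (simp_all add: numeral_eq_Suc distrib_left distrib_right mult.assoc ab ab' ac_simps two)
  qed
  then have "mat_congruent (block_sum (block_sum (scal a) (scal a)) (block_sum (scal 1) (scal b)))
    (block_sum (block_sum (scal 1) (scal 1)) (block_sum (scal 1) (scal b)))"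
    by (rule mat_congruent_sym)
  moreover have "unimodular (block_sum (scal 1) (scal b))"
    using b by (intro unimodular_block_sum) (simp_all add: unimodular_scal)
  ultimately show ?thesis unfolding stably_congruent_def by auto
qed

lemma scal_congruent:
  assumes "c0 a" "c0 b" "disc1 a = disc1 b" "disc2 a = disc2 b"
  shows "mat_congruent (scal b) (scal a)"
proof -
  obtain s where s: "c0 s" "b = a * (s * s)" using assms disc_eq_iff[of a b] by blast
  show ?thesis
  proof (rule mat_congruentI_unimodular[of _ "scal s" _ 1])
    show "scal b = (scal s)\<^sup>T * scal a * scal s"
      by (rule eq_matI) (simp_all add: s(2) scal_def scalar_prod_def ac_simps)
  qed (simp_all add: unimodular_scal trunc_unit_iff assms)
qed

text \<open>Squares only see the two lowest coefficients, (p + q x)^2 = p + q x^2, so the search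
  runs over four bits. If \<open>a\<close> and \<open>b\<close> have the same square class, the form
  represents no unit outside that class, whence the last hypothesis.\<close>

lemma unit_binary_one:
  assumes "c0 a" "c0 b" "disc1 a = 0" "\<not> (disc1 a = disc1 b \<and> disc2 a = disc2 b)"
  shows "\<exists>s t. s * s * a + t * t * b = 1"
proof -
  have "\<exists>p q r u. Trunc p q False False * Trunc p q False False * a + Trunc r u False False * Trunc r u False False * b = 1"
    using assms by (cases a; cases b) (auto simp: disc1_def disc2_def trunc_defs ex_bool_eq)
  then show ?thesis by blast
qed

text \<open>If <a, b> represents 1, completing that vector to an orthogonal basis gives <1, ab>. If
  the square classes agree, the form is <a, a>, stably <1, 1>, and ab is a square.\<close>

lemma scal_block_sum_one_left:
  assumes "c0 a" "c0 b" "disc1 a = 0 \<or> disc1 a = disc1 b \<and> disc2 a = disc2 b"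
  shows "stably_congruent (block_sum (scal a) (scal b)) (block_sum (scal 1) (scal (a * b)))"
proof (cases "disc1 a = disc1 b \<and> disc2 a = disc2 b")
  case True
  have u: "c0 (a * b)" using assms by (simp add: times_trunc_def)
  have "disc1 (a * b) = disc1 1" "disc2 (a * b) = disc2 1"
    using True by (simp_all add: disc_mult[OF assms(1,2)] disc_one)
  then have ab: "stably_congruent (scal 1) (scal (a * b))"
    using u by (intro stably_congruent_congruent scal_congruent) (simp_all add: one_trunc_def)
  have "stably_congruent (block_sum (scal a) (scal b)) (block_sum (scal a) (scal a))"
    using True assms by (intro stably_congruent_block_sum stably_congruent_congruent[OF scal_congruent]) auto
  also have "stably_congruent \<dots> (block_sum (scal 1) (scal 1))"
    using assms by (intro double_stably_congruent) (simp add: trunc_unit_iff)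
  also have "stably_congruent \<dots> (block_sum (scal 1) (scal (a * b)))"
    by (intro stably_congruent_block_sum ab stably_congruent_refl[of _ 1]) simp
  finally show ?thesis .
next
  case False
  have "disc1 a = 0" using assms(3) False by satx
  then obtain s t where st: "s * s * a + t * t * b = 1"
    using unit_binary_one[OF assms(1,2) _ False] by blast
  have "mat_congruent (block_sum (scal a) (scal b)) (block_sum (scal 1) (scal (a * b)))"
    using binary_congruent[of a b s t] assms(1,2) unfolding st trunc_unit_iff mult_1_right
    by (simp only: one_trunc_def trunc.sel)
  then show ?thesis by (rule stably_congruent_congruent)
qed

lemma stably_congruent_commute:
  "square_mat A \<Longrightarrow> square_mat B \<Longrightarrow> stably_congruent (block_sum A B) (block_sum B A)"
  by (intro stably_congruent_congruent mat_congruent_block_sum_commute[of _ "dim_row A" _ "dim_row B"] carrier_matI) simp_all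

lemma stably_congruent_block_sum_left:
  "square_mat A \<Longrightarrow> stably_congruent B C \<Longrightarrow> stably_congruent (block_sum A B) (block_sum A C)"
  by (intro stably_congruent_block_sum stably_congruent_refl carrier_matI) simp_all

lemma stably_congruent_block_sum_right:
  "square_mat A \<Longrightarrow> stably_congruent B C \<Longrightarrow> stably_congruent (block_sum B A) (block_sum C A)"
  by (intro stably_congruent_block_sum stably_congruent_refl carrier_matI) simp_all

text \<open>The remaining case has \<open>a\<close> and \<open>b\<close> in the classes of 1 + x and
  1 + x + x^3, in some order. Every unit represented by <a, b> then has an odd x coefficient, so 1
  is not among them. The way out is to add <1>: it turns <1, a> into <c, ac> with ac in the class of
  b, then <ac, b> becomes <1, 1>, and <1> is cancelled again.\<close>

lemma scal_block_sum:
  assumes "c0 a" "c0 b"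
  shows "stably_congruent (block_sum (scal a) (scal b)) (block_sum (scal 1) (scal (a * b)))"
proof -
  consider "disc1 a = 0 \<or> disc1 a = disc1 b \<and> disc2 a = disc2 b"
    | "disc1 b = 0" | "disc1 a = 1" "disc1 b = 1" "disc2 a \<noteq> disc2 b"
    by (auto simp: disc1_def)
  then show ?thesis
  proof cases
    case 1
    then show ?thesis using assms by (intro scal_block_sum_one_left)
  next
    case 2
    have "stably_congruent (block_sum (scal a) (scal b)) (block_sum (scal b) (scal a))"
      by (rule stably_congruent_commute) simp_all
    also have "stably_congruent \<dots> (block_sum (scal 1) (scal (b * a)))"
      using assms 2 by (intro scal_block_sum_one_left) auto
    finally show ?thesis by (simp only: mult.commute)
  next
    case 3
    \<comment> \<open>A unit represented by <1, a>. Since \<open>a\<close> has constant and x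
      coefficient 1, it equals 1 + x^2 + x^3, in the square class of 1 + x^3.\<close>
    define c where "c = 1 + trunc_x * trunc_x * a"
    have c: "c0 c" "disc1 c = 0" "disc2 c = 1"
      using assms(1) 3(1) by (cases a; simp add: c_def trunc_defs trunc_x_def disc1_def disc2_def)+
    have ac: "c0 (a * c)" "disc1 (a * c) = disc1 b" "disc2 (a * c) = disc2 b"
      using assms(1) c 3 disc_mult[OF assms(1) c(1)]
      by (simp_all add: times_trunc_def disc1_def disc2_def of_bool_def split: if_splits)
    have cab: "disc1 c = disc1 (a * b)" "disc2 c = disc2 (a * b)"
      using c 3 disc_mult[OF assms] by (simp_all add: disc1_def disc2_def of_bool_def split: if_splits)
    have 1: "stably_congruent (block_sum (scal 1) (scal a)) (block_sum (scal c) (scal (a * c)))"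
      using binary_congruent[of 1 a 1 trunc_x, unfolded mult_1_left, folded c_def, unfolded trunc_unit_iff]
        assms(1) c(1)
      by (intro stably_congruent_congruent) (simp only: one_trunc_def trunc.sel)
    have 2: "stably_congruent (block_sum (scal (a * c)) (scal b)) (block_sum (scal 1) (scal 1))"
    proof -
      have "stably_congruent (block_sum (scal (a * c)) (scal b)) (block_sum (scal b) (scal b))"
        using assms ac by (intro stably_congruent_block_sum_right stably_congruent_congruent[OF scal_congruent]) simp_all
      also have "stably_congruent \<dots> (block_sum (scal 1) (scal 1))"
        using assms by (intro double_stably_congruent) (simp add: trunc_unit_iff)
      finally show ?thesis .
    qed
    have "stably_congruent (block_sum (block_sum (scal a) (scal b)) (scal 1)) (block_sum (scal 1) (block_sum (scal a) (scal b)))"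
      by (rule stably_congruent_commute) simp_all
    also have "block_sum (scal 1) (block_sum (scal a) (scal b)) = block_sum (block_sum (scal 1) (scal a)) (scal b)"
      by (rule block_sum_assoc)
    also have "stably_congruent \<dots> (block_sum (block_sum (scal c) (scal (a * c))) (scal b))"
      by (rule stably_congruent_block_sum_right[OF _ 1]) simp
    also have "block_sum (block_sum (scal c) (scal (a * c))) (scal b) = block_sum (scal c) (block_sum (scal (a * c)) (scal b))"
      by (rule block_sum_assoc[symmetric])
    also have "stably_congruent \<dots> (block_sum (scal c) (block_sum (scal 1) (scal 1)))"
      by (rule stably_congruent_block_sum_left[OF _ 2]) simp
    also have "block_sum (scal c) (block_sum (scal 1) (scal 1)) = block_sum (block_sum (scal c) (scal 1)) (scal 1)"
      by (rule block_sum_assoc)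
    finally have "stably_congruent (block_sum (scal a) (scal b)) (block_sum (scal c) (scal 1))"
      by (rule stably_congruent_cancel) (simp_all add: unimodular_scal)
    also have "stably_congruent \<dots> (block_sum (scal 1) (scal c))"
      by (rule stably_congruent_commute) simp_all
    also have "stably_congruent \<dots> (block_sum (scal 1) (scal (a * b)))"
      using c(1) cab assms
      by (intro stably_congruent_block_sum_left stably_congruent_congruent[OF scal_congruent]) (simp_all add: times_trunc_def)
    finally show ?thesis .
  qed
qed

lemma c0_sum: "\<forall>k\<in>A. \<not> c0 (f k) \<Longrightarrow> \<not> c0 (sum f A)"
  by (induction A rule: infinite_finite_induct) (simp_all add: zero_trunc_def plus_trunc_def)

text \<open>Non-units are closed under sums and multiples, so a column consisting of non-units could
  not be completed to the entry 1 of the identity matrix by a left inverse.\<close>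

lemma unimodular_unit_in_column:
  assumes "unimodular A" "A \<in> carrier_mat (Suc n) (Suc n)"
  obtains k where "k < Suc n" "c0 (A $$ (k, 0))"
proof -
  obtain Q where Q: "Q \<in> carrier_mat (Suc n) (Suc n)" "Q * A = 1\<^sub>m (Suc n)"
    using invertible_matrix[OF assms(2) unimodularD(2)[OF assms(1)]] by blast
  have "c0 ((Q * A) $$ (0, 0))"
    unfolding Q(2) by (simp add: one_trunc_def)
  then have "c0 (\<Sum>k<Suc n. Q $$ (0, k) * A $$ (k, 0))"
    unfolding mult_index_sum[OF Q(1) assms(2) zero_less_Suc zero_less_Suc] .
  then obtain k where k: "k < Suc n" "c0 (Q $$ (0, k) * A $$ (k, 0))"
    using c0_sum[of "{..<Suc n}" "\<lambda>k. Q $$ (0, k) * A $$ (k, 0)"] by blast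
  have "c0 (A $$ (k, 0))" using k(2) by (simp add: times_trunc_def)
  then show ?thesis by (rule that[OF k(1)])
qed

lemma block_sum_inject:
  assumes "block_sum A C = block_sum A' C'" "dim_row A = dim_row A'" "dim_col A = dim_col A'"
    "dim_row C = dim_row C'" "dim_col C = dim_col C'"
  shows "C = C'"
proof (rule eq_matI)
  fix i j assume ij: "i < dim_row C'" "j < dim_col C'"
  have "block_sum A C $$ (i + dim_row A, j + dim_col A) = block_sum A' C' $$ (i + dim_row A, j + dim_col A)"
    using assms(1) by simp
  then show "C $$ (i, j) = C' $$ (i, j)"
    using assms(2-5) ij by (simp add: block_sum_index)
qed (use assms in simp_all)

lemma unimodular_block_sumD:
  assumes "unimodular (block_sum A C)" "A \<in> carrier_mat n n" "C \<in> carrier_mat m m"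
  shows "unimodular C"
proof (rule unimodularI[OF assms(3)])
  have "block_sum A\<^sup>T C\<^sup>T = block_sum A C"
    using unimodularD(1)[OF assms(1)] unfolding block_sum_transpose .
  then show "C\<^sup>T = C"
    by (rule block_sum_inject) (use assms(2,3) in simp_all)
  have "det A * det C dvd 1"
    using unimodularD(2)[OF assms(1)] unfolding det_block_sum[OF assms(2,3)] .
  then show "det C dvd 1" by (rule dvd_mult_right)
qed

text \<open>The inductive step for the normal form: an entry \<open>d\<close> split off from the
  form is merged with the discriminant entry \<open>e\<close> of the rest by <e, d> = <1,
  ed>.\<close>

lemma merge_scal:
  assumes C: "stably_congruent (block_sum C (scal 1)) (block_sum (1\<^sub>m m) (scal e))"
    and "square_mat C" "c0 d" "c0 e"
  shows "stably_congruent (block_sum (block_sum (scal d) C) (scal 1)) (block_sum (1\<^sub>m (Suc m)) (scal (e * d)))"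
proof -
  have "block_sum (block_sum (scal d) C) (scal 1) = block_sum (scal d) (block_sum C (scal 1))"
    by (rule block_sum_assoc[symmetric])
  also have "stably_congruent \<dots> (block_sum (scal d) (block_sum (1\<^sub>m m) (scal e)))"
    by (rule stably_congruent_block_sum_left[OF _ C]) simp
  also have "stably_congruent \<dots> (block_sum (block_sum (1\<^sub>m m) (scal e)) (scal d))"
    by (rule stably_congruent_commute) simp_all
  also have "block_sum (block_sum (1\<^sub>m m) (scal e)) (scal d) = block_sum (1\<^sub>m m) (block_sum (scal e) (scal d))"
    by (rule block_sum_assoc[symmetric])
  also have "stably_congruent \<dots> (block_sum (1\<^sub>m m) (block_sum (scal 1) (scal (e * d))))"
    by (rule stably_congruent_block_sum_left[OF _ scal_block_sum[OF assms(4,3)]]) simp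
  also have "block_sum (1\<^sub>m m) (block_sum (scal 1) (scal (e * d))) = block_sum (block_sum (1\<^sub>m m) (scal 1)) (scal (e * d))"
    by (rule block_sum_assoc)
  also have "block_sum (1\<^sub>m m) (scal 1) = (1\<^sub>m (Suc m) :: trunc mat)"
  proof -
    have "scal 1 = (1\<^sub>m 1 :: trunc mat)" by (rule eq_matI) (auto simp: scal_def)
    then show ?thesis using block_sum_one[of m 1] by simp
  qed
  finally show ?thesis .
qed

text \<open>The case of a unit on the diagonal. The induction hypothesis is an assumption here
  because it is used in two ways: for \<open>A\<close> itself and, if \<open>A\<close> has no unit
  on the diagonal, for another form of the same size that does.\<close>

lemma stable_normal_form_aux:
  assumes A: "unimodular A" "A \<in> carrier_mat (Suc n) (Suc n)" and k: "k < Suc n" "c0 (A $$ (k, k))"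
    and IH: "\<And>C :: trunc mat. unimodular C \<Longrightarrow> C \<in> carrier_mat n n \<Longrightarrow>
      stably_congruent (block_sum C (scal 1)) (block_sum (1\<^sub>m n) (scal (det C)))"
  shows "stably_congruent (block_sum A (scal 1)) (block_sum (1\<^sub>m (Suc n)) (scal (det A)))"
proof -
  let ?d = "A $$ (k, k)"
  obtain b where b: "?d * b = 1" using k(2) trunc_square_square[of ?d] by (metis mult.assoc)
  obtain C where C: "C \<in> carrier_mat n n" "mat_congruent A (block_sum (scal ?d) C)"
    using mat_congruent_split_pivot[OF A(2) unimodularD(1)[OF A(1)] k(1) b] mat_carrier by blast
  have uC: "unimodular C"
    by (rule unimodular_block_sumD[OF mat_congruent_unimodular[OF mat_congruent_sym[OF C(2)] A(1)] scal_carrier(1) C(1)])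
  obtain s where s: "s dvd 1" "det A = det (block_sum (scal ?d) C) * (s * s)"
    using mat_congruent_det[OF C(2)] by blast
  have d: "det A = (det C * ?d) * (s * s)"
    unfolding s(2) det_block_sum[OF scal_carrier(1) C(1)] det_scal by (simp only: mult.commute)
  have u: "c0 (det C)" "c0 (det A)" "c0 (det C * ?d)"
    using unimodularD(2)[OF uC] unimodularD(2)[OF A(1)] k(2) unfolding trunc_unit_iff
    by (simp_all only: times_trunc_def trunc.sel)
  have sc: "square_mat C" using C(1) by simp
  have "stably_congruent (block_sum A (scal 1)) (block_sum (block_sum (scal ?d) C) (scal 1))"
    by (rule stably_congruent_block_sum_right[OF _ stably_congruent_congruent[OF C(2)]]) simp
  also have "stably_congruent \<dots> (block_sum (1\<^sub>m (Suc n)) (scal (det C * ?d)))"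
    by (rule merge_scal[OF IH[OF uC C(1)] sc k(2) u(1)])
  also have "stably_congruent \<dots> (block_sum (1\<^sub>m (Suc n)) (scal (det A)))"
  proof (rule stably_congruent_block_sum_left[OF _ stably_congruent_congruent[OF scal_congruent]])
    have "disc1 (det C * ?d) = disc1 (det A) \<and> disc2 (det C * ?d) = disc2 (det A)"
      using d s(1) unfolding disc_eq_iff[OF u(3,2)] trunc_unit_iff by blast
    then show "disc1 (det A) = disc1 (det C * ?d)" "disc2 (det A) = disc2 (det C * ?d)" by simp_all
  qed (use u in simp_all)
  finally show ?thesis .
qed

text \<open>If no diagonal entry of \<open>A\<close> is a unit, then in \<open>A \<oplus> \<langle>1\<rangle>\<close> we split off the sum of the last and
  the first basis vectors; its complement has a vector of unit norm since the first
  basis vector is not orthogonal to everything modulo the maximal ideal.\<close>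

lemma stable_normal_form:
  fixes A :: "trunc mat"
  assumes "unimodular A" "A \<in> carrier_mat n n"
  shows "stably_congruent (block_sum A (scal 1)) (block_sum (1\<^sub>m n) (scal (det A)))"
  using assms
proof (induction n arbitrary: A)
  case 0
  then have "det A = 1" by simp
  then have "block_sum A (scal 1) = block_sum (1\<^sub>m 0) (scal (det A))"
    using 0 by (simp add: block_sum_empty)
  moreover have "block_sum A (scal 1) \<in> carrier_mat (0 + 1) (0 + 1)"
    by (rule block_sum_carrier[OF 0(2) scal_carrier(1)])
  ultimately show ?case using stably_congruent_refl by metis
next
  case (Suc n)
  note IH = Suc.IH and A = Suc.prems
  show ?case
  proof (cases "\<exists>k<Suc n. c0 (A $$ (k, k))")
    case True
    then obtain k where "k < Suc n" "c0 (A $$ (k, k))" by blast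
    then show ?thesis by (rule stable_normal_form_aux[OF A _ _ IH])
  next
    case False
    let ?m = "Suc n"
    define B where "B = block_sum A (scal 1)"
    have uB: "unimodular B"
      unfolding B_def by (intro unimodular_block_sum A) (simp add: unimodular_scal)
    have B: "B \<in> carrier_mat (Suc ?m) (Suc ?m)"
      using block_sum_carrier[OF A(2) scal_carrier(1)] by (simp add: B_def)
    have dB: "det B = det A" unfolding B_def det_block_sum[OF A(2) scal_carrier(1)] det_scal by simp
    \<comment> \<open>The shear replaces the last basis vector by its sum with the first one. Its
      norm is 1 plus the non-unit \<open>A $$ (0, 0)\<close>, hence a unit.\<close>
    define c where "c j = (if j = ?m then 1 else 0 :: trunc)" for j
    define M where "M = mat (Suc ?m) (Suc ?m) (\<lambda>(i, j). B $$ (i, j) + B $$ (i, 0) * c j +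
      c i * (B $$ (0, j) + B $$ (0, 0) * c j))"
    have MB: "mat_congruent M B"
      unfolding M_def by (rule mat_congruent_shear[OF B]) (simp_all add: c_def)
    have uM: "unimodular M" by (rule mat_congruent_unimodular[OF MB uB])
    have M: "M \<in> carrier_mat (Suc ?m) (Suc ?m)" by (simp add: M_def)
    have BA: "B $$ (i, j) = A $$ (i, j)" if "i < ?m" "j < ?m" for i j
      using that A(2) by (simp add: B_def block_sum_index)
    have B1: "B $$ (i, ?m) = 0" "B $$ (?m, i) = 0" if "i < ?m" for i
      using that A(2) by (simp_all add: B_def block_sum_index)
    have B2: "B $$ (?m, ?m) = 1"
      using A(2) by (simp add: B_def block_sum_index)
    have M1: "M $$ (i, i) = A $$ (i, i)" "M $$ (i, ?m) = A $$ (i, 0)" if "i < ?m" for i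
      using that by (simp_all add: M_def c_def BA B1)
    have M2: "M $$ (?m, ?m) = 1 + A $$ (0, 0)"
      by (simp add: M_def c_def BA B1 B2)
    have c: "c0 (M $$ (?m, ?m))"
      using False unfolding M2 by (auto simp: plus_trunc_def one_trunc_def)
    then obtain b where b: "M $$ (?m, ?m) * b = 1"
      using trunc_square_square[of "M $$ (?m, ?m)"] by (metis mult.assoc)
    define f where "f = Transposition.transpose 0 ?m"
    define C where "C = mat ?m ?m (\<lambda>(i, j). M $$ (f (Suc i), f (Suc j)) -
      b * M $$ (f (Suc i), ?m) * M $$ (f (Suc j), ?m))"
    have C: "C \<in> carrier_mat ?m ?m" by (simp add: C_def)
    have MC: "mat_congruent M (block_sum (scal (M $$ (?m, ?m))) C)"
      unfolding C_def f_def by (rule mat_congruent_split_pivot[OF M unimodularD(1)[OF uM] lessI b])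
    have uC: "unimodular C"
      by (rule unimodular_block_sumD[OF mat_congruent_unimodular[OF mat_congruent_sym[OF MC] uM] scal_carrier(1) C])
    obtain k where k: "k < ?m" "c0 (A $$ (k, 0))"
      using unimodular_unit_in_column[OF A] by blast
    \<comment> \<open>The position of the k-th basis vector in the complement. The transposition has
      put the pivot in front and vector 0 into the last slot, hence \<open>i = n\<close> if
      \<open>k = 0\<close>.\<close>
    obtain i where i: "i < ?m" "f (Suc i) = k"
    proof (cases "k = 0")
      case True
      then show ?thesis using that[of n] by (simp add: f_def)
    next
      case False
      then show ?thesis using that[of "k - 1"] k(1) by (simp add: f_def Transposition.transpose_def)
    qed
    \<comment> \<open>A non-unit minus a product of units: \<open>A $$ (k, k)\<close> is a non-unit
      by assumption, and \<open>k\<close> was chosen with \<open>A $$ (k, 0)\<close> a unit.\<close>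
    have "C $$ (i, i) = A $$ (k, k) - b * A $$ (k, 0) * A $$ (k, 0)"
      using i k(1) by (simp add: C_def M1 del: trunc_minus)
    moreover have "c0 b"
    proof -
      have "c0 (M $$ (?m, ?m) * b)" unfolding b one_trunc_def trunc.sel ..
      then show ?thesis by (simp only: times_trunc_def trunc.sel)
    qed
    ultimately have ci: "c0 (C $$ (i, i))"
      using False k by (auto simp: times_trunc_def plus_trunc_def)
    have NC: "stably_congruent (block_sum C (scal 1)) (block_sum (1\<^sub>m ?m) (scal (det C)))"
      by (rule stable_normal_form_aux[OF uC C i(1) ci IH])
    have u: "c0 (det C)" "c0 (det A)" "c0 (det C * M $$ (?m, ?m))"
      using unimodularD(2)[OF uC] unimodularD(2)[OF A(1)] c unfolding trunc_unit_iff
      by (simp_all only: times_trunc_def trunc.sel)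
    obtain s where s: "s dvd 1" "det M = det (block_sum (scal (M $$ (?m, ?m))) C) * (s * s)"
      using mat_congruent_det[OF MC] by blast
    obtain t where t: "t dvd 1" "det M = det B * (t * t)"
      using mat_congruent_det[OF MB] by blast
    have "det A * (t * t) = (det C * M $$ (?m, ?m)) * (s * s)"
      using s(2) unfolding t(2) dB det_block_sum[OF scal_carrier(1) C] det_scal mult.commute[of "det C"] .
    then have disc: "disc1 (det A) = disc1 (det C * M $$ (?m, ?m))" "disc2 (det A) = disc2 (det C * M $$ (?m, ?m))"
      using disc_times_square[OF u(2) t(1)] disc_times_square[OF u(3) s(1)] by metis+
    have sC: "square_mat C" and sA: "square_mat A" using C A(2) by simp_all
    \<comment> \<open>One copy of <1> was consumed to produce the pivot, and the normal form of the
      complement requires a second one. The surplus copy is cancelled at the end.\<close>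
    have "stably_congruent (block_sum (block_sum A (scal 1)) (scal 1)) (block_sum (block_sum (scal (M $$ (?m, ?m))) C) (scal 1))"
      using mat_congruent_trans[OF mat_congruent_sym[OF MB] MC] unfolding B_def
      by (intro stably_congruent_block_sum_right[OF _ stably_congruent_congruent]) simp_all
    also have "stably_congruent \<dots> (block_sum (1\<^sub>m (Suc ?m)) (scal (det C * M $$ (?m, ?m))))"
      by (rule merge_scal[OF NC sC c u(1)])
    also have "stably_congruent \<dots> (block_sum (1\<^sub>m (Suc ?m)) (scal (det A)))"
      by (rule stably_congruent_block_sum_left[OF _ stably_congruent_congruent[OF scal_congruent]])
         (use u disc in simp_all)
    also have "block_sum (1\<^sub>m (Suc ?m)) (scal (det A)) = block_sum (1\<^sub>m ?m) (block_sum (scal 1) (scal (det A)))"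
    proof -
      have "(1\<^sub>m (Suc ?m) :: trunc mat) = block_sum (1\<^sub>m ?m) (1\<^sub>m 1)"
        by (simp add: block_sum_one)
      moreover have "scal 1 = (1\<^sub>m 1 :: trunc mat)" by (rule eq_matI) (auto simp: scal_def)
      ultimately show ?thesis by (simp only: block_sum_assoc)
    qed
    also have "stably_congruent \<dots> (block_sum (1\<^sub>m ?m) (block_sum (scal (det A)) (scal 1)))"
      by (intro stably_congruent_block_sum_left stably_congruent_commute) simp_all
    also have "block_sum (1\<^sub>m ?m) (block_sum (scal (det A)) (scal 1)) = block_sum (block_sum (1\<^sub>m ?m) (scal (det A))) (scal 1)"
      by (rule block_sum_assoc)
    finally show ?thesis
      by (rule stably_congruent_cancel) (use sA in \<open>simp_all add: unimodular_scal\<close>)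
  qed
qed

text \<open>The determinant of a common summand is a unit and can be divided out, which makes the
  discriminant a stable invariant; the converse compares normal forms and cancels <1>.\<close>

lemma stably_congruent_iff:
  fixes A B :: "trunc mat"
  assumes A: "unimodular A" "A \<in> carrier_mat n n" and B: "unimodular B" "B \<in> carrier_mat m m"
  shows "stably_congruent A B \<longleftrightarrow> n = m \<and> disc1 (det A) = disc1 (det B) \<and> disc2 (det A) = disc2 (det B)"
proof
  assume "stably_congruent A B"
  then obtain E where E: "unimodular E" "mat_congruent (block_sum A E) (block_sum B E)"
    unfolding stably_congruent_def by blast
  have "n = m" using mat_congruent_dim[OF E(2)] A(2) B(2) by simp
  obtain s where s: "s dvd 1" "det (block_sum A E) = det (block_sum B E) * (s * s)"
    using mat_congruent_det[OF E(2)] by blast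
  obtain q where q: "det E * q = 1"
    using unimodularD(2)[OF E(1)] unfolding dvd_def by metis
  note cE = unimodular_carrier[OF E(1)]
  have "det A * det E * q = det B * (s * s) * (det E * q)"
    using s(2) unfolding det_block_sum[OF A(2) cE] det_block_sum[OF B(2) cE] by (simp only: ac_simps)
  then have "det A = det B * (s * s)" unfolding mult.assoc[of _ "det E" q] q by simp
  then have "\<exists>s. c0 s \<and> det A = det B * (s * s)" using s(1) unfolding trunc_unit_iff by blast
  then show "n = m \<and> disc1 (det A) = disc1 (det B) \<and> disc2 (det A) = disc2 (det B)"
    using \<open>n = m\<close> disc_eq_iff[of "det B" "det A"] unimodularD(2)[OF A(1)] unimodularD(2)[OF B(1)]
    unfolding trunc_unit_iff by auto
next
  assume eq: "n = m \<and> disc1 (det A) = disc1 (det B) \<and> disc2 (det A) = disc2 (det B)"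
  have u: "c0 (det A)" "c0 (det B)"
    using unimodularD(2)[OF A(1)] unimodularD(2)[OF B(1)] unfolding trunc_unit_iff by simp_all
  have "stably_congruent (block_sum A (scal 1)) (block_sum (1\<^sub>m n) (scal (det A)))"
    by (rule stable_normal_form[OF A])
  also have "stably_congruent \<dots> (block_sum (1\<^sub>m n) (scal (det B)))"
    by (rule stably_congruent_block_sum_left[OF _ stably_congruent_congruent[OF scal_congruent]])
       (use u eq in simp_all)
  also have "stably_congruent \<dots> (block_sum B (scal 1))"
    using stably_congruent_sym[OF stable_normal_form[OF B]] eq by simp
  finally show "stably_congruent A B"
    by (rule stably_congruent_cancel) (use A(2) B(2) in \<open>simp_all add: unimodular_scal\<close>)
qed

section \<open>Gram matrices of inner product spaces\<close>

context coordinate_ring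
begin

interpretation R: cring R by (rule cring)

lemma psi_closed [simp]: "\<psi> p \<in> carrier R"
  using bij by (auto simp: bij_betw_def)

lemma psi_inject [simp]: "\<psi> p = \<psi> q \<longleftrightarrow> p = q"
  using bij by (auto simp: bij_betw_def inj_eq)

lemma psi_surj: "r \<in> carrier R \<Longrightarrow> \<exists>p. r = \<psi> p"
  using bij by (auto simp: bij_betw_def)

lemma psi_zero: "\<psi> 0 = \<zero>"
proof -
  have "\<psi> 0 \<oplus> \<psi> 0 = \<psi> 0 \<oplus> \<zero>" by (simp flip: psi_add)
  then show ?thesis by (rule R.add.l_cancel) simp_all
qed

definition coord :: "'a \<Rightarrow> 'r" where "coord = inv_into UNIV \<psi>"

lemma coord_psi [simp]: "coord (\<psi> p) = p"
  unfolding coord_def by (rule inv_f_f) (use bij in \<open>auto simp: bij_betw_def\<close>)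

lemma psi_coord [simp]: "r \<in> carrier R \<Longrightarrow> \<psi> (coord r) = r"
  using psi_surj by fastforce

text \<open>Linear maps out of R^n, where R^n consists of vectors over the coordinate type and
  scalars enter \<open>M\<close> through \<open>\<psi>\<close>. Keeping R^n in a type of vectors
  lets matrices act on it directly.\<close>

definition vec_linear :: "nat \<Rightarrow> ('a, 'b, 'n) module_scheme \<Rightarrow> ('r vec \<Rightarrow> 'b) \<Rightarrow> bool" where
  "vec_linear n M e \<longleftrightarrow> (\<forall>u\<in>carrier_vec n. e u \<in> carrier M) \<and>
    (\<forall>u\<in>carrier_vec n. \<forall>v\<in>carrier_vec n. e (u + v) = e u \<oplus>\<^bsub>M\<^esub> e v) \<and>
    (\<forall>p. \<forall>u\<in>carrier_vec n. e (p \<cdot>\<^sub>v u) = \<psi> p \<odot>\<^bsub>M\<^esub> e u)"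

lemma vec_linearI:
  assumes "\<And>u. u \<in> carrier_vec n \<Longrightarrow> e u \<in> carrier M"
    and "\<And>u v. u \<in> carrier_vec n \<Longrightarrow> v \<in> carrier_vec n \<Longrightarrow> e (u + v) = e u \<oplus>\<^bsub>M\<^esub> e v"
    and "\<And>p u. u \<in> carrier_vec n \<Longrightarrow> e (p \<cdot>\<^sub>v u) = \<psi> p \<odot>\<^bsub>M\<^esub> e u"
  shows "vec_linear n M e"
  using assms unfolding vec_linear_def by blast

lemma vec_linearD:
  assumes "vec_linear n M e" "u \<in> carrier_vec n"
  shows "e u \<in> carrier M" "v \<in> carrier_vec n \<Longrightarrow> e (u + v) = e u \<oplus>\<^bsub>M\<^esub> e v"
    "e (p \<cdot>\<^sub>v u) = \<psi> p \<odot>\<^bsub>M\<^esub> e u"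
  using assms unfolding vec_linear_def by blast+

lemma vec_linear_zero:
  assumes "module R M" "vec_linear n M e"
  shows "e (0\<^sub>v n) = \<zero>\<^bsub>M\<^esub>"
proof -
  interpret M: module R M by fact
  have "(0::'r) \<cdot>\<^sub>v 0\<^sub>v n = (0\<^sub>v n :: 'r vec)" by (rule eq_vecI) auto
  then show ?thesis
    using vec_linearD(1)[OF assms(2) zero_carrier_vec] vec_linearD(3)[OF assms(2) zero_carrier_vec, of 0] M.smult_l_null by (simp add: psi_zero)
qed

lemma vec_linear_ext:
  assumes M: "module R M" and e: "vec_linear n M e" "vec_linear n M e'"
    and eq: "\<And>i. i < n \<Longrightarrow> e (unit_vec n i) = e' (unit_vec n i)" and u: "u \<in> carrier_vec n"
  shows "e u = e' u"
proof -
  \<comment> \<open>Induction on a bound \<open>k\<close> for the support of the vector; the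
    coordinate at \<open>k\<close> is split off in each step.\<close>
  have "e u = e' u" if "u \<in> carrier_vec n" "k \<le> n" "\<forall>i<n. k \<le> i \<longrightarrow> u $ i = 0" for k u
    using that
  proof (induction k arbitrary: u)
    case 0
    then have "u = 0\<^sub>v n" by (intro eq_vecI) auto
    then show ?case using vec_linear_zero[OF M e(1)] vec_linear_zero[OF M e(2)] by simp
  next
    case (Suc k)
    define v where "v = vec n (\<lambda>i. if i = k then 0 else u $ i)"
    have v: "v \<in> carrier_vec n" by (simp add: v_def)
    have uv: "u = v + (u $ k) \<cdot>\<^sub>v unit_vec n k"
      by (rule eq_vecI) (use Suc.prems in \<open>auto simp: v_def\<close>)
    have k: "k < n" using Suc.prems by simp
    have "\<forall>i<n. k \<le> i \<longrightarrow> v $ i = 0" using Suc.prems(3) by (auto simp: v_def Suc_le_eq le_less)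
    then have ev: "e v = e' v" using Suc.IH[OF v] k by simp
    have "f u = f v \<oplus>\<^bsub>M\<^esub> (\<psi> (u $ k) \<odot>\<^bsub>M\<^esub> f (unit_vec n k))" if "vec_linear n M f" for f
      using vec_linearD(2)[OF that v, of "(u $ k) \<cdot>\<^sub>v unit_vec n k"]
        vec_linearD(3)[OF that unit_vec_carrier, of "u $ k" k] uv by simp
    from this[OF e(1)] this[OF e(2)] show ?case unfolding ev eq[OF k] by simp
  qed
  from this[of u n] u show ?thesis by simp
qed

lemma vec_linear_extend:
  assumes M: "module R M" and e: "vec_linear n M e" and x: "x \<in> carrier M"
  shows "vec_linear (Suc n) M (\<lambda>u. e (vec n (\<lambda>i. u $ i)) \<oplus>\<^bsub>M\<^esub> (\<psi> (u $ n) \<odot>\<^bsub>M\<^esub> x))"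
proof (rule vec_linearI)
  interpret M: module R M by fact
  have c: "e (vec n f) \<in> carrier M" for f using e by (simp add: vec_linear_def)
  fix u :: "'r vec" assume u: "u \<in> carrier_vec (Suc n)"
  show "e (vec n (\<lambda>i. u $ i)) \<oplus>\<^bsub>M\<^esub> (\<psi> (u $ n) \<odot>\<^bsub>M\<^esub> x) \<in> carrier M"
    using c x by simp
  show "e (vec n (\<lambda>i. (p \<cdot>\<^sub>v u) $ i)) \<oplus>\<^bsub>M\<^esub> (\<psi> ((p \<cdot>\<^sub>v u) $ n) \<odot>\<^bsub>M\<^esub> x) =
    \<psi> p \<odot>\<^bsub>M\<^esub> (e (vec n (\<lambda>i. u $ i)) \<oplus>\<^bsub>M\<^esub> (\<psi> (u $ n) \<odot>\<^bsub>M\<^esub> x))" for p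
  proof -
    have "vec n (\<lambda>i. (p \<cdot>\<^sub>v u) $ i) = p \<cdot>\<^sub>v vec n (\<lambda>i. u $ i)" using u by (intro eq_vecI) auto
    then show ?thesis
      using u x c vec_linearD(3)[OF e, of "vec n (\<lambda>i. u $ i)" p]
      by (simp add: psi_mult M.smult_r_distr M.smult_assoc1)
  qed
  fix v :: "'r vec" assume v: "v \<in> carrier_vec (Suc n)"
  have "vec n (\<lambda>i. (u + v) $ i) = vec n (\<lambda>i. u $ i) + vec n (\<lambda>i. v $ i)"
    using u v by (intro eq_vecI) auto
  then show "e (vec n (\<lambda>i. (u + v) $ i)) \<oplus>\<^bsub>M\<^esub> (\<psi> ((u + v) $ n) \<odot>\<^bsub>M\<^esub> x) =
    e (vec n (\<lambda>i. u $ i)) \<oplus>\<^bsub>M\<^esub> (\<psi> (u $ n) \<odot>\<^bsub>M\<^esub> x) \<oplus>\<^bsub>M\<^esub>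
    (e (vec n (\<lambda>i. v $ i)) \<oplus>\<^bsub>M\<^esub> (\<psi> (v $ n) \<odot>\<^bsub>M\<^esub> x))"
    using u v x c vec_linearD(2)[OF e, of "vec n (\<lambda>i. u $ i)" "vec n (\<lambda>i. v $ i)"]
    by (simp add: psi_add M.smult_l_distr M.a_ac)
qed

lemma vec_linear_exists:
  assumes M: "module R M" and "\<And>i. i < n \<Longrightarrow> v i \<in> carrier M"
  shows "\<exists>e. vec_linear n M e \<and> (\<forall>i<n. e (unit_vec n i) = v i)"
  using assms(2)
proof (induction n)
  case 0
  interpret M: module R M by fact
  have "vec_linear 0 M (\<lambda>_. \<zero>\<^bsub>M\<^esub>)" by (simp add: vec_linear_def)
  then show ?case by auto
next
  case (Suc n)
  interpret M: module R M by fact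
  obtain e where e: "vec_linear n M e" "\<forall>i<n. e (unit_vec n i) = v i" using Suc by auto
  let ?e = "\<lambda>u. e (vec n (\<lambda>i. u $ i)) \<oplus>\<^bsub>M\<^esub> (\<psi> (u $ n) \<odot>\<^bsub>M\<^esub> v n)"
  have "?e (unit_vec (Suc n) i) = v i" if i: "i < Suc n" for i
  proof (cases "i = n")
    case True
    have "vec n (\<lambda>j. unit_vec (Suc n) n $ j) = (0\<^sub>v n :: 'r vec)" by (rule eq_vecI) auto
    then show ?thesis
      using True vec_linear_zero[OF M e(1)] Suc.prems[of n] by (simp add: psi_one)
  next
    case False
    have "vec n (\<lambda>j. unit_vec (Suc n) i $ j) = (unit_vec n i :: 'r vec)"
      using False i by (intro eq_vecI) auto
    then show ?thesis using False i e(2) Suc.prems[of i] Suc.prems[of n] by (simp add: psi_zero)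
  qed
  then show ?case using vec_linear_extend[OF M e(1), of "v n"] Suc.prems[of n] by blast
qed

lemma vec_linear_compose:
  assumes "vec_linear n V e" "g \<in> linear_maps R V P"
  shows "vec_linear n P (\<lambda>u. g (e u))"
  using assms unfolding vec_linear_def linear_maps_def by (auto simp: Pi_iff)

lemma mult_mat_vec_smult:
  assumes P: "(P :: 'r mat) \<in> carrier_mat n k" and u: "u \<in> carrier_vec k"
  shows "P *\<^sub>v (p \<cdot>\<^sub>v u) = p \<cdot>\<^sub>v (P *\<^sub>v u)"
  by (rule eq_vecI) (use P u scalar_prod_smult_distrib[of _ k u p] in auto)

lemma vec_linear_mat:
  assumes e: "vec_linear n M e" and P: "P \<in> carrier_mat n k"
  shows "vec_linear k M (\<lambda>u. e (P *\<^sub>v u))"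
proof (rule vec_linearI)
  fix u :: "'r vec" assume u: "u \<in> carrier_vec k"
  have Pu: "P *\<^sub>v w \<in> carrier_vec n" if "w \<in> carrier_vec k" for w using P that by simp
  show "e (P *\<^sub>v u) \<in> carrier M" using vec_linearD(1)[OF e Pu[OF u]] .
  show "e (P *\<^sub>v (p \<cdot>\<^sub>v u)) = \<psi> p \<odot>\<^bsub>M\<^esub> e (P *\<^sub>v u)" for p
    using vec_linearD(3)[OF e Pu[OF u]] mult_mat_vec_smult[OF P u, of p] by simp
  fix v :: "'r vec" assume v: "v \<in> carrier_vec k"
  show "e (P *\<^sub>v (u + v)) = e (P *\<^sub>v u) \<oplus>\<^bsub>M\<^esub> e (P *\<^sub>v v)"
    using vec_linearD(2)[OF e Pu[OF u] Pu[OF v]] mult_add_distrib_mat_vec[OF P u v] by simp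
qed

text \<open>A basis of \<open>M\<close>, encoded as its coordinate isomorphism from R^n, so that no
  linear combinations in \<open>M\<close> have to be written.\<close>

definition frame :: "nat \<Rightarrow> ('a, 'b, 'n) module_scheme \<Rightarrow> ('r vec \<Rightarrow> 'b) \<Rightarrow> bool" where
  "frame n M e \<longleftrightarrow> vec_linear n M e \<and> bij_betw e (carrier_vec n) (carrier M)"

lemma frameD: assumes "frame n M e" shows "vec_linear n M e" "bij_betw e (carrier_vec n) (carrier M)"
  using assms by (auto simp: frame_def)

lemma frame_inv:
  assumes "frame n M e"
  shows "u \<in> carrier_vec n \<Longrightarrow> inv_into (carrier_vec n) e (e u) = u"
    "x \<in> carrier M \<Longrightarrow> inv_into (carrier_vec n) e x \<in> carrier_vec n"
    "x \<in> carrier M \<Longrightarrow> e (inv_into (carrier_vec n) e x) = x"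
  using assms unfolding frame_def
  by (auto simp: bij_betw_inv_into_left bij_betw_inv_into_right bij_betw_apply[OF bij_betw_inv_into])

lemma frame_obtain:
  assumes "frame n M e" "x \<in> carrier M"
  obtains u where "u \<in> carrier_vec n" "x = e u"
  using frame_inv[OF assms(1)] assms(2) by metis

text \<open>The standard way below to produce a map out of a free module: take coordinates and apply
  a linear map on R^n. Linearity of the coordinates is read off from linearity of their inverse
  \<open>e\<close>.\<close>

lemma frame_linear:
  assumes e: "frame n V e" and f: "vec_linear n N f"
  shows "(\<lambda>x. f (inv_into (carrier_vec n) e x)) \<in> linear_maps R V N"
  unfolding linear_maps_def
proof (intro CollectI conjI ballI funcsetI)
  let ?i = "inv_into (carrier_vec n) e"
  note i = frame_inv[OF e] and l = vec_linearD[OF frameD(1)[OF e]]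
  fix x assume x: "x \<in> carrier V"
  show "f (?i x) \<in> carrier N" by (rule vec_linearD(1)[OF f i(2)[OF x]])
  fix y assume y: "y \<in> carrier V"
  have "x \<oplus>\<^bsub>V\<^esub> y = e (?i x + ?i y)" using l(2)[OF i(2)[OF x] i(2)[OF y]] i(3)[OF x] i(3)[OF y] by simp
  then have "?i (x \<oplus>\<^bsub>V\<^esub> y) = ?i x + ?i y" using i(1)[of "?i x + ?i y"] i(2)[OF x] i(2)[OF y] by simp
  then show "f (?i (x \<oplus>\<^bsub>V\<^esub> y)) = f (?i x) \<oplus>\<^bsub>N\<^esub> f (?i y)"
    using vec_linearD(2)[OF f i(2)[OF x] i(2)[OF y]] by simp
next
  let ?i = "inv_into (carrier_vec n) e"
  note i = frame_inv[OF e] and l = vec_linearD[OF frameD(1)[OF e]]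
  fix r x assume r: "r \<in> carrier R" and x: "x \<in> carrier V"
  have "r \<odot>\<^bsub>V\<^esub> x = e (coord r \<cdot>\<^sub>v ?i x)" using l(3)[OF i(2)[OF x]] i(3)[OF x] r by simp
  then have "?i (r \<odot>\<^bsub>V\<^esub> x) = coord r \<cdot>\<^sub>v ?i x" using i(1)[of "coord r \<cdot>\<^sub>v ?i x"] i(2)[OF x] by simp
  then show "f (?i (r \<odot>\<^bsub>V\<^esub> x)) = r \<odot>\<^bsub>N\<^esub> f (?i x)"
    using vec_linearD(3)[OF f i(2)[OF x]] r by simp
qed

lemma finite_carrier_vec: "finite (carrier_vec n :: 'r vec set)"
  and card_carrier_vec: "card (carrier_vec n :: 'r vec set) = card (UNIV :: 'r set) ^ n"
proof -
  have b: "bij_betw vec_of_list {xs. set xs \<subseteq> (UNIV :: 'r set) \<and> length xs = n} (carrier_vec n)"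
  proof (rule bij_betwI[where g = list_of_vec])
    show "vec_of_list \<in> {xs. set xs \<subseteq> (UNIV :: 'r set) \<and> length xs = n} \<rightarrow> carrier_vec n"
      by (intro funcsetI carrier_vecI) simp
    show "list_of_vec \<in> carrier_vec n \<rightarrow> {xs. set xs \<subseteq> (UNIV :: 'r set) \<and> length xs = n}"
      by (intro funcsetI) simp
  qed (simp_all only: vec_list list_vec)
  show "finite (carrier_vec n :: 'r vec set)"
    using bij_betw_finite[OF b] finite_lists_length_eq[of "UNIV :: 'r set" n] by simp
  show "card (carrier_vec n :: 'r vec set) = card (UNIV :: 'r set) ^ n"
    using bij_betw_same_card[OF b] card_lists_length_eq[of "UNIV :: 'r set" n] by simp
qed

text \<open>A module of rank n has |R|^n elements, and R is finite with at least two
  elements.\<close>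

lemma frame_dim_unique:
  assumes "frame n M e" "frame m M f" shows "n = m"
proof -
  have "card (UNIV :: 'r set) ^ n = card (UNIV :: 'r set) ^ m"
    using bij_betw_same_card[OF frameD(2)[OF assms(1)]] bij_betw_same_card[OF frameD(2)[OF assms(2)]]
    by (simp add: card_carrier_vec)
  moreover have "card (UNIV :: 'r set) > 1"
    using card_mono[of "UNIV :: 'r set" "{0, 1}"] by simp
  ultimately show ?thesis by (simp add: power_inject_exp)
qed

lemma frame_finitely_generated:
  assumes M: "module R M" and e: "frame n M e"
  shows "finitely_generated R M"
proof -
  interpret M: module R M by fact
  have fin: "finite (carrier M)"
    using bij_betw_finite[OF frameD(2)[OF e]] finite_carrier_vec by simp
  \<comment> \<open>The finite carrier itself serves as generating set: an element is the
    combination of all elements with indicator coefficients.\<close>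
  have "x = (\<Oplus>\<^bsub>M\<^esub>s\<in>carrier M. (if x = s then \<one> else \<zero>) \<odot>\<^bsub>M\<^esub> s)" if x: "x \<in> carrier M" for x
  proof -
    have "(\<Oplus>\<^bsub>M\<^esub>s\<in>carrier M. (if x = s then \<one> else \<zero>) \<odot>\<^bsub>M\<^esub> s) = (\<Oplus>\<^bsub>M\<^esub>s\<in>carrier M. if x = s then s else \<zero>\<^bsub>M\<^esub>)"
      by (rule M.finsum_cong') (auto simp: M.smult_l_null)
    also have "\<dots> = x" by (rule M.finsum_singleton[OF x fin]) auto
    finally show ?thesis ..
  qed
  then show ?thesis
    unfolding finitely_generated_def using fin
    by (intro exI[of _ "carrier M"] conjI ballI subset_refl) (auto intro!: bexI[where x = "\<lambda>s. if x = s then \<one> else \<zero>" for x])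
qed

lemma frame_projective:
  assumes e: "frame n M e"
  shows "projective R M"
  unfolding projective_def
proof (intro allI impI ballI)
  fix N P :: "('a, 'a list) module" and f g
  assume "module R N \<and> module R P" and f: "f \<in> linear_maps R N P" "f ` carrier N = carrier P"
    and g: "g \<in> linear_maps R M P"
  then have N: "module R N" and P: "module R P" by auto
  have ge: "vec_linear n P (\<lambda>u. g (e u))" by (rule vec_linear_compose[OF frameD(1)[OF e] g])
  have "\<exists>x\<in>carrier N. f x = g (e (unit_vec n i))" for i
    using vec_linearD(1)[OF ge unit_vec_carrier, of i] f(2) by (metis imageE)
  then obtain x where x: "x i \<in> carrier N" "f (x i) = g (e (unit_vec n i))" for i by metis
  obtain e' where e': "vec_linear n N e'" "\<And>i. i < n \<Longrightarrow> e' (unit_vec n i) = x i"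
    using vec_linear_exists[OF N, of n x] x by auto
  have "f (e' u) = g (e u)" if "u \<in> carrier_vec n" for u
    by (rule vec_linear_ext[OF P vec_linear_compose[OF e'(1) f(1)] ge _ that]) (simp add: e' x)
  then show "\<exists>h\<in>linear_maps R M N. \<forall>x\<in>carrier M. f (h x) = g x"
    using frame_linear[OF e e'(1)] frame_inv(2,3)[OF e] by (metis (no_types, lifting))
qed

end

lemma mult_mat_unit_vec:
  fixes A :: "'r :: comm_ring_1 mat"
  assumes A: "A \<in> carrier_mat n m" and j: "j < m"
  shows "A *\<^sub>v unit_vec m j = col A j"
proof (rule eq_vecI)
  fix i assume "i < dim_vec (col A j)"
  then have i: "i < n" using A by simp
  then have "row A i \<in> carrier_vec m" using A by simp
  then show "(A *\<^sub>v unit_vec m j) $ i = col A j $ i" using A i j by simp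
qed (use A in simp)

lemma unit_vec_mult_mat_unit_vec:
  fixes A :: "'r :: comm_ring_1 mat"
  assumes A: "A \<in> carrier_mat n m" and ij: "i < n" "j < m"
  shows "unit_vec n i \<bullet> (A *\<^sub>v unit_vec m j) = A $$ (i, j)"
proof -
  have "A *\<^sub>v unit_vec m j = col A j"
    by (rule mult_mat_unit_vec[OF A ij(2)])
  then show ?thesis using A ij by simp
qed

context coordinate_ring
begin

interpretation R: cring R by (rule cring)

lemma self_module_simps [simp]:
  "carrier (self_module R) = carrier R" "x \<oplus>\<^bsub>self_module R\<^esub> y = x \<oplus> y"
  "x \<odot>\<^bsub>self_module R\<^esub> y = x \<otimes> y" "\<zero>\<^bsub>self_module R\<^esub> = \<zero>"
  by (simp_all add: self_module_def)

lemma module_self: "module R (self_module R)"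
proof (rule moduleI)
  show "abelian_group (self_module R)"
    by (rule abelian_groupI) (auto simp: R.a_ac intro: bexI[of _ "\<ominus> x" for x] R.l_neg)
qed (auto simp: R.l_distr R.r_distr R.m_assoc intro: R.cring_axioms)

lemma scalar_prod_vec_linear:
  assumes y: "y \<in> carrier_vec n"
  shows "vec_linear n (self_module R) (\<lambda>u. \<psi> (y \<bullet> u))"
  by (rule vec_linearI)
     (simp_all add: psi_add[symmetric] psi_mult[symmetric] scalar_prod_add_distrib[OF y] scalar_prod_smult_distrib[OF y])

lemma frame_closed:
  assumes f: "frame n V e"
  shows "x \<in> carrier V \<Longrightarrow> y \<in> carrier V \<Longrightarrow> x \<oplus>\<^bsub>V\<^esub> y \<in> carrier V"
    "r \<in> carrier R \<Longrightarrow> x \<in> carrier V \<Longrightarrow> r \<odot>\<^bsub>V\<^esub> x \<in> carrier V"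
proof -
  note l = vec_linearD[OF frameD(1)[OF f]] and i = frame_inv[OF f]
  show "x \<oplus>\<^bsub>V\<^esub> y \<in> carrier V" if x: "x \<in> carrier V" and y: "y \<in> carrier V"
    using l(2)[OF i(2)[OF x] i(2)[OF y]] l(1)[OF add_carrier_vec[OF i(2)[OF x] i(2)[OF y]]]
    unfolding i(3)[OF x] i(3)[OF y] by simp
  show "r \<odot>\<^bsub>V\<^esub> x \<in> carrier V" if r: "r \<in> carrier R" and x: "x \<in> carrier V"
    using l(3)[OF i(2)[OF x], of "coord r"] l(1)[OF smult_carrier_vec[THEN iffD2, OF i(2)[OF x]], of "coord r"]
    unfolding i(3)[OF x] psi_coord[OF r] by simp
qed

section \<open>Spaces with a Gram matrix: inner products, base change, isometry\<close>

definition gram_frame :: "('a, 'b) ips \<Rightarrow> 'r mat \<Rightarrow> ('r vec \<Rightarrow> 'b) \<Rightarrow> bool" where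
  "gram_frame V A e \<longleftrightarrow> square_mat A \<and> frame (dim_row A) V e \<and>
    (\<forall>u\<in>carrier_vec (dim_row A). \<forall>v\<in>carrier_vec (dim_row A). bform V (e u) (e v) = \<psi> (u \<bullet> (A *\<^sub>v v)))"

definition has_gram :: "('a, 'b) ips \<Rightarrow> 'r mat \<Rightarrow> bool" where
  "has_gram V A \<longleftrightarrow> (\<exists>e. gram_frame V A e)"

lemma gram_frameI:
  assumes "A \<in> carrier_mat n n" "frame n V e"
    "\<And>u v. u \<in> carrier_vec n \<Longrightarrow> v \<in> carrier_vec n \<Longrightarrow> bform V (e u) (e v) = \<psi> (u \<bullet> (A *\<^sub>v v))"
  shows "gram_frame V A e"
proof -
  have "square_mat A" "dim_row A = n" using assms(1) by simp_all
  then show ?thesis using assms(2,3) unfolding gram_frame_def by blast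
qed

lemma gram_frameD:
  assumes "gram_frame V A e" "A \<in> carrier_mat n n"
  shows "frame n V e"
    "\<And>u v. u \<in> carrier_vec n \<Longrightarrow> v \<in> carrier_vec n \<Longrightarrow> bform V (e u) (e v) = \<psi> (u \<bullet> (A *\<^sub>v v))"
proof -
  have "dim_row A = n" using assms(2) by simp
  then show "frame n V e"
    "\<And>u v. u \<in> carrier_vec n \<Longrightarrow> v \<in> carrier_vec n \<Longrightarrow> bform V (e u) (e v) = \<psi> (u \<bullet> (A *\<^sub>v v))"
    using assms(1) unfolding gram_frame_def by blast+
qed

lemma gram_frame_carrier:
  assumes "gram_frame V A e" obtains n where "A \<in> carrier_mat n n"
  using assms that unfolding gram_frame_def square_mat.simps by (metis carrier_matI)

lemma gram_bilinear:
  assumes A: "A \<in> carrier_mat n n" "A\<^sup>T = A" and e: "gram_frame V A e"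
  shows "bform V \<in> bilinear_maps R V V (self_module R)"
    "x \<in> carrier V \<Longrightarrow> y \<in> carrier V \<Longrightarrow> bform V x y = bform V y x"
proof -
  note f = gram_frameD[OF e A(1)]
  have sym: "u \<bullet> (A *\<^sub>v v) = v \<bullet> (A *\<^sub>v u)" if "u \<in> carrier_vec n" "v \<in> carrier_vec n" for u v
  proof -
    have "u \<bullet> (A *\<^sub>v v) = (A *\<^sub>v u) \<bullet> v"
      using transpose_vec_mult_scalar[OF A(1) that(2,1)] unfolding A(2) by simp
    also have "\<dots> = v \<bullet> (A *\<^sub>v u)" using that A(1) by (intro comm_scalar_prod[of _ n]) auto
    finally show ?thesis .
  qed
  show s: "bform V x y = bform V y x" if xy: "x \<in> carrier V" "y \<in> carrier V" for x y
  proof -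
    obtain u v where "u \<in> carrier_vec n" "x = e u" "v \<in> carrier_vec n" "y = e v"
      using frame_obtain[OF f(1) xy(1)] frame_obtain[OF f(1) xy(2)] by metis
    then show ?thesis using f(2) sym by simp
  qed
  have lin: "bform V x \<in> linear_maps R V (self_module R)" if x: "x \<in> carrier V" for x
  proof -
    obtain u where u: "u \<in> carrier_vec n" "x = e u" using frame_obtain[OF f(1) x] .
    have Au: "A *\<^sub>v u \<in> carrier_vec n" using A(1) u(1) by simp
    note l = frame_linear[OF f(1) scalar_prod_vec_linear[OF Au]]
    have eq: "\<psi> ((A *\<^sub>v u) \<bullet> inv_into (carrier_vec n) e y) = bform V x y" if y: "y \<in> carrier V" for y
    proof -
      obtain v where v: "v \<in> carrier_vec n" "y = e v" using frame_obtain[OF f(1) y] .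
      have "(A *\<^sub>v u) \<bullet> v = u \<bullet> (A *\<^sub>v v)"
        using transpose_vec_mult_scalar[OF A(1) v(1) u(1)] unfolding A(2) .
      then show ?thesis using f(2)[OF u(1) v(1)] u v frame_inv(1)[OF f(1) v(1)] by simp
    qed
    show ?thesis
      using l eq frame_closed[OF f(1)] unfolding linear_maps_def by (simp add: Pi_iff)
  qed
  have "(\<lambda>x. bform V x y) \<in> linear_maps R V (self_module R)" if y: "y \<in> carrier V" for y
  proof -
    show ?thesis
      using lin[OF y] s[OF _ y] frame_closed[OF f(1)] unfolding linear_maps_def by (simp add: Pi_iff)
  qed
  then show "bform V \<in> bilinear_maps R V V (self_module R)"
    using lin unfolding bilinear_maps_def by blast
qed

lemma gram_inner_product_space:
  assumes V: "module R V" and A: "unimodular A" and e: "gram_frame V A e"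
  shows "inner_product_space R V"
proof -
  define n where "n = dim_row A"
  have c: "A \<in> carrier_mat n n" unfolding n_def by (rule unimodular_carrier[OF A])
  note f = gram_frameD[OF e c]
  note l = frameD(1)[OF f(1)]
  obtain Q where Q: "Q \<in> carrier_mat n n" "A * Q = 1\<^sub>m n" "Q * A = 1\<^sub>m n"
    using invertible_matrix[OF c unimodularD(2)[OF A]] by blast
  have "nondegenerate R V"
    unfolding nondegenerate_def
  proof (intro ballI ex_ex1I)
    fix g assume g: "g \<in> linear_maps R V (self_module R)"
    have ge: "vec_linear n (self_module R) (\<lambda>u. g (e u))" by (rule vec_linear_compose[OF l g])
    \<comment> \<open>The vector of values of the functional \<open>g\<close> on the basis. As
      \<open>g\<close> is the scalar product with \<open>y\<close>, it is represented through the
      form by the inverse Gram matrix \<open>Q\<close> applied to \<open>y\<close>.\<close>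
    define y where "y = vec n (\<lambda>i. coord (g (e (unit_vec n i))))"
    have y: "y \<in> carrier_vec n" by (simp add: y_def)
    have gy: "g (e w) = \<psi> (y \<bullet> w)" if w: "w \<in> carrier_vec n" for w
    proof (rule vec_linear_ext[OF module_self ge scalar_prod_vec_linear[OF y] _ w])
      fix i assume i: "i < n"
      have "g (e (unit_vec n i)) \<in> carrier R" using vec_linearD(1)[OF ge unit_vec_carrier] by simp
      then show "g (e (unit_vec n i)) = \<psi> (y \<bullet> unit_vec n i)" using i by (simp add: y_def)
    qed
    have Qy: "Q *\<^sub>v y \<in> carrier_vec n" using Q y by simp
    have "bform V (e (Q *\<^sub>v y)) w = g w" if w: "w \<in> carrier V" for w
    proof -
      obtain z where z: "z \<in> carrier_vec n" "w = e z" using frame_obtain[OF f(1) w] .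
      have "(Q *\<^sub>v y) \<bullet> (A *\<^sub>v z) = (A *\<^sub>v (Q *\<^sub>v y)) \<bullet> z"
        using transpose_vec_mult_scalar[OF c z(1) Qy] unfolding unimodularD(1)[OF A] by simp
      also have "A *\<^sub>v (Q *\<^sub>v y) = y"
        using assoc_mult_mat_vec[OF c Q(1) y] y unfolding Q(2) by simp
      finally show ?thesis using f(2)[OF Qy z(1)] gy[OF z(1)] z(2) by simp
    qed
    then show "\<exists>v. v \<in> carrier V \<and> (\<forall>w\<in>carrier V. bform V v w = g w)"
      using vec_linearD(1)[OF l Qy] by blast
  next
    fix g v v' assume v: "v \<in> carrier V \<and> (\<forall>w\<in>carrier V. bform V v w = g w)"
      and v': "v' \<in> carrier V \<and> (\<forall>w\<in>carrier V. bform V v' w = g w)"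
    obtain u u' where u: "u \<in> carrier_vec n" "v = e u" and u': "u' \<in> carrier_vec n" "v' = e u'"
      using frame_obtain[OF f(1)] v v' by metis
    have eq: "u \<bullet> (A *\<^sub>v w) = u' \<bullet> (A *\<^sub>v w)" if w: "w \<in> carrier_vec n" for w
    proof -
      have "\<psi> (u \<bullet> (A *\<^sub>v w)) = \<psi> (u' \<bullet> (A *\<^sub>v w))"
        using v v' u u' f(2)[OF u(1) w] f(2)[OF u'(1) w] vec_linearD(1)[OF l w] by simp
      then show ?thesis by simp
    qed
    \<comment> \<open>The i-th coordinate is isolated by pairing with
      \<open>Q *\<^sub>v unit_vec n i\<close>, which \<open>A\<close> maps to the i-th unit
      vector.\<close>
    have "u = u'"
    proof (rule eq_vecI)
      fix i assume "i < dim_vec u'"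
      then have i: "i < n" using u'(1) by simp
      have Qi: "Q *\<^sub>v unit_vec n i \<in> carrier_vec n" using Q by simp
      have "A *\<^sub>v (Q *\<^sub>v unit_vec n i) = unit_vec n i"
        using assoc_mult_mat_vec[OF c Q(1) unit_vec_carrier, of i] unfolding Q(2) by simp
      then show "u $ i = u' $ i" using eq[OF Qi] u(1) u'(1) i by simp
    qed (use u(1) u'(1) in simp)
    then show "v = v'" using u u' by simp
  qed
  then show ?thesis
    unfolding inner_product_space_def
    using V frame_finitely_generated[OF V f(1)] frame_projective[OF f(1)]
      gram_bilinear[OF c unimodularD(1)[OF A] e] by blast
qed

lemma has_gram_congruent:
  assumes "has_gram V B" "mat_congruent A B"
  shows "has_gram V A"
proof -
  obtain e where e: "gram_frame V B e" using assms(1) unfolding has_gram_def by blast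
  obtain n P where P: "A \<in> carrier_mat n n" "B \<in> carrier_mat n n" "P \<in> carrier_mat n n"
    "det P dvd 1" "A = P\<^sup>T * B * P" using assms(2) by (elim mat_congruentE)
  obtain Q where Q: "Q \<in> carrier_mat n n" "P * Q = 1\<^sub>m n" "Q * P = 1\<^sub>m n"
    using invertible_matrix[OF P(3,4)] by blast
  note f = gram_frameD[OF e P(2)]
  have "bij_betw (\<lambda>u. P *\<^sub>v u) (carrier_vec n) (carrier_vec n)"
  proof (rule bij_betwI[where g = "\<lambda>u. Q *\<^sub>v u"])
    show "Q *\<^sub>v (P *\<^sub>v x) = x" if "x \<in> carrier_vec n" for x
      using assoc_mult_mat_vec[OF Q(1) P(3) that] that unfolding Q(3) by simp
    show "P *\<^sub>v (Q *\<^sub>v x) = x" if "x \<in> carrier_vec n" for x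
      using assoc_mult_mat_vec[OF P(3) Q(1) that] that unfolding Q(2) by simp
  qed (use P(3) Q(1) in auto)
  from bij_betw_trans[OF this frameD(2)[OF f(1)]]
  have fr: "frame n V (\<lambda>u. e (P *\<^sub>v u))"
    unfolding frame_def o_def using vec_linear_mat[OF frameD(1)[OF f(1)] P(3)] by blast
  have "gram_frame V A (\<lambda>u. e (P *\<^sub>v u))"
  proof (rule gram_frameI[OF P(1) fr])
    fix u v :: "'r vec" assume u: "u \<in> carrier_vec n" and v: "v \<in> carrier_vec n"
    have Pv: "P *\<^sub>v u \<in> carrier_vec n" "P *\<^sub>v v \<in> carrier_vec n" using P(3) u v by simp_all
    have "u \<bullet> (A *\<^sub>v v) = u \<bullet> (P\<^sup>T *\<^sub>v (B *\<^sub>v (P *\<^sub>v v)))"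
    proof -
      have "A *\<^sub>v v = (P\<^sup>T * B) *\<^sub>v (P *\<^sub>v v)"
        unfolding P(5) by (rule assoc_mult_mat_vec[of _ n n]) (use P v in auto)
      also have "\<dots> = P\<^sup>T *\<^sub>v (B *\<^sub>v (P *\<^sub>v v))"
        by (rule assoc_mult_mat_vec[of _ n n]) (use P Pv in auto)
      finally show ?thesis by simp
    qed
    also have "\<dots> = (P\<^sup>T *\<^sub>v (B *\<^sub>v (P *\<^sub>v v))) \<bullet> u"
      using P u Pv by (intro comm_scalar_prod[of _ n]) auto
    also have "\<dots> = (B *\<^sub>v (P *\<^sub>v v)) \<bullet> (P *\<^sub>v u)"
      using P u Pv by (intro transpose_vec_mult_scalar[of _ n n]) auto
    also have "\<dots> = (P *\<^sub>v u) \<bullet> (B *\<^sub>v (P *\<^sub>v v))"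
      using P u Pv by (intro comm_scalar_prod[of _ n]) auto
    finally show "bform V (e (P *\<^sub>v u)) (e (P *\<^sub>v v)) = \<psi> (u \<bullet> (A *\<^sub>v v))"
      using f(2)[OF Pv] by simp
  qed
  then show ?thesis unfolding has_gram_def by blast
qed

lemma has_gram_unique:
  assumes V: "module R V" and A: "has_gram V A" "unimodular A" and B: "has_gram V B"
  shows "mat_congruent A B"
proof -
  obtain e where e: "gram_frame V A e" using A(1) unfolding has_gram_def by blast
  obtain e' where e': "gram_frame V B e'" using B unfolding has_gram_def by blast
  obtain n where n: "A \<in> carrier_mat n n" using gram_frame_carrier[OF e] .
  obtain m where m: "B \<in> carrier_mat m m" using gram_frame_carrier[OF e'] .
  note f = gram_frameD[OF e n] and f' = gram_frameD[OF e' m]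
  have "m = n" by (rule frame_dim_unique[OF f'(1) f(1)])
  note m = m[unfolded this] and f' = f'[unfolded this]
  \<comment> \<open>Column \<open>j\<close> holds the coordinates of the j-th vector of the first
    basis in the second one. It is invertible because \<open>A\<close> is unimodular.\<close>
  define P where "P = mat n n (\<lambda>(i, j). inv_into (carrier_vec n) e' (e (unit_vec n j)) $ i)"
  have P: "P \<in> carrier_mat n n" by (simp add: P_def)
  have eP: "e u = e' (P *\<^sub>v u)" if u: "u \<in> carrier_vec n" for u
  proof (rule vec_linear_ext[OF V frameD(1)[OF f(1)] vec_linear_mat[OF frameD(1)[OF f'(1)] P] _ u])
    fix j assume j: "j < n"
    have x: "e (unit_vec n j) \<in> carrier V" by (rule vec_linearD(1)[OF frameD(1)[OF f(1)] unit_vec_carrier])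
    note i = frame_inv(2,3)[OF f'(1) x]
    have "P *\<^sub>v unit_vec n j = col P j" by (rule mult_mat_unit_vec[OF P j])
    also have "\<dots> = inv_into (carrier_vec n) e' (e (unit_vec n j))"
      using i(1) j by (intro eq_vecI) (auto simp: P_def)
    finally show "e (unit_vec n j) = e' (P *\<^sub>v unit_vec n j)" using i(2) by simp
  qed
  have "A = P\<^sup>T * B * P"
  proof (rule eq_matI)
    fix i j assume "i < dim_row (P\<^sup>T * B * P)" "j < dim_col (P\<^sup>T * B * P)"
    then have ij: "i < n" "j < n" using P by auto
    have c: "P *\<^sub>v unit_vec n k \<in> carrier_vec n" for k using P by simp
    have "\<psi> (A $$ (i, j)) = \<psi> ((P *\<^sub>v unit_vec n i) \<bullet> (B *\<^sub>v (P *\<^sub>v unit_vec n j)))"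
      using f(2)[OF unit_vec_carrier unit_vec_carrier, of i j] f'(2)[OF c c, of i j]
        eP[OF unit_vec_carrier] unit_vec_mult_mat_unit_vec[OF n ij] by simp
    then have "A $$ (i, j) = col P i \<bullet> (B *\<^sub>v col P j)"
      using mult_mat_unit_vec[OF P ij(1)] mult_mat_unit_vec[OF P ij(2)] by simp
    also have "B *\<^sub>v col P j = col (B * P) j"
      using m P ij by (intro eq_vecI) auto
    also have "col P i \<bullet> col (B * P) j = (P\<^sup>T * (B * P)) $$ (i, j)"
      using m P ij by simp
    also have "P\<^sup>T * (B * P) = P\<^sup>T * B * P"
      by (rule assoc_mult_mat[symmetric]) (use P m in auto)
    finally show "A $$ (i, j) = (P\<^sup>T * B * P) $$ (i, j)" .
  qed (use n P in auto)
  then show ?thesis by (rule mat_congruentI_unimodular[OF A(2) _ m P])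
qed

lemma has_gram_isometric:
  assumes "has_gram V A" "has_gram W A" shows "isometric R V W"
proof -
  obtain e where e: "gram_frame V A e" using assms(1) unfolding has_gram_def by blast
  obtain e' where e': "gram_frame W A e'" using assms(2) unfolding has_gram_def by blast
  obtain n where n: "A \<in> carrier_mat n n" using gram_frame_carrier[OF e] .
  note f = gram_frameD[OF e n] and f' = gram_frameD[OF e' n]
  let ?f = "\<lambda>x. e' (inv_into (carrier_vec n) e x)"
  have "bij_betw ?f (carrier V) (carrier W)"
    using bij_betw_trans[OF bij_betw_inv_into[OF frameD(2)[OF f(1)]] frameD(2)[OF f'(1)]]
    unfolding o_def .
  moreover have "?f \<in> linear_maps R V W" by (rule frame_linear[OF f(1) frameD(1)[OF f'(1)]])
  moreover have "bform W (?f x) (?f y) = bform V x y" if "x \<in> carrier V" "y \<in> carrier V" for x y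
    using f(2)[OF frame_inv(2)[OF f(1) that(1)] frame_inv(2)[OF f(1) that(2)]]
      f'(2)[OF frame_inv(2)[OF f(1) that(1)] frame_inv(2)[OF f(1) that(2)]]
      frame_inv(3)[OF f(1)] that by simp
  ultimately show ?thesis unfolding isometric_def by blast
qed

text \<open>The basis of \<open>W\<close> is pulled back along the isometry \<open>g\<close>;
  linearity of the pulled back frame is checked after applying the injective map
  \<open>g\<close>.\<close>

lemma isometric_has_gram:
  assumes V: "module R V" and iso: "isometric R V W" and B: "has_gram W B"
  shows "has_gram V B"
proof -
  obtain e where e: "gram_frame W B e" using B unfolding has_gram_def by blast
  obtain n where n: "B \<in> carrier_mat n n" using gram_frame_carrier[OF e] .
  note f = gram_frameD[OF e n]
  note l = vec_linearD[OF frameD(1)[OF f(1)]]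
  interpret V: module R V by (rule V)
  obtain g where g: "g \<in> linear_maps R V W" "bij_betw g (carrier V) (carrier W)"
    "\<forall>x\<in>carrier V. \<forall>y\<in>carrier V. bform W (g x) (g y) = bform V x y"
    using iso unfolding isometric_def by blast
  let ?h = "inv_into (carrier V) g"
  have h: "?h w \<in> carrier V" "g (?h w) = w" if "w \<in> carrier W" for w
    using that g(2) by (simp_all add: bij_betw_apply[OF bij_betw_inv_into[OF g(2)]] bij_betw_inv_into_right)
  have inj: "x = y" if "g x = g y" "x \<in> carrier V" "y \<in> carrier V" for x y
    using that g(2) unfolding bij_betw_def inj_on_def by blast
  have gl: "g (x \<oplus>\<^bsub>V\<^esub> y) = g x \<oplus>\<^bsub>W\<^esub> g y" if "x \<in> carrier V" "y \<in> carrier V" for x y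
    using g(1) that unfolding linear_maps_def by blast
  have gs: "g (r \<odot>\<^bsub>V\<^esub> x) = r \<odot>\<^bsub>W\<^esub> g x" if "r \<in> carrier R" "x \<in> carrier V" for r x
    using g(1) that unfolding linear_maps_def by blast
  have "vec_linear n V (\<lambda>u. ?h (e u))"
  proof (rule vec_linearI)
    fix u :: "'r vec" assume u: "u \<in> carrier_vec n"
    show 1: "?h (e u) \<in> carrier V" using h(1) l(1)[OF u] by blast
    show "?h (e (p \<cdot>\<^sub>v u)) = \<psi> p \<odot>\<^bsub>V\<^esub> ?h (e u)" for p
    proof (rule inj)
      have "p \<cdot>\<^sub>v u \<in> carrier_vec n" using u by simp
      then show "?h (e (p \<cdot>\<^sub>v u)) \<in> carrier V" using h(1) l(1) by blast
      show "\<psi> p \<odot>\<^bsub>V\<^esub> ?h (e u) \<in> carrier V" using 1 by simp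
      show "g (?h (e (p \<cdot>\<^sub>v u))) = g (\<psi> p \<odot>\<^bsub>V\<^esub> ?h (e u))"
        using h(2)[OF l(1)[OF \<open>p \<cdot>\<^sub>v u \<in> carrier_vec n\<close>]] h(2)[OF l(1)[OF u]] l(3)[OF u] gs[OF _ 1] by simp
    qed
    fix v :: "'r vec" assume v: "v \<in> carrier_vec n"
    have 2: "?h (e v) \<in> carrier V" using h(1) l(1)[OF v] by blast
    show "?h (e (u + v)) = ?h (e u) \<oplus>\<^bsub>V\<^esub> ?h (e v)"
    proof (rule inj)
      have uv: "u + v \<in> carrier_vec n" using u v by simp
      then show "?h (e (u + v)) \<in> carrier V" using h(1) l(1) by blast
      show "?h (e u) \<oplus>\<^bsub>V\<^esub> ?h (e v) \<in> carrier V" using 1 2 by simp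
      show "g (?h (e (u + v))) = g (?h (e u) \<oplus>\<^bsub>V\<^esub> ?h (e v))"
        using h(2)[OF l(1)[OF uv]] h(2)[OF l(1)[OF u]] h(2)[OF l(1)[OF v]] l(2)[OF u v] gl[OF 1 2] by simp
    qed
  qed
  moreover have "bij_betw (\<lambda>u. ?h (e u)) (carrier_vec n) (carrier V)"
    using bij_betw_trans[OF frameD(2)[OF f(1)] bij_betw_inv_into[OF g(2)]] unfolding o_def .
  ultimately have fr: "frame n V (\<lambda>u. ?h (e u))" unfolding frame_def by blast
  have "gram_frame V B (\<lambda>u. ?h (e u))"
  proof (rule gram_frameI[OF n fr])
    fix u v :: "'r vec" assume "u \<in> carrier_vec n" "v \<in> carrier_vec n"
    then show "bform V (?h (e u)) (?h (e v)) = \<psi> (u \<bullet> (B *\<^sub>v v))"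
      using g(3) h l(1) f(2) by metis
  qed
  then show ?thesis unfolding has_gram_def by blast
qed

section \<open>Finitely generated projective modules over the local ring are free\<close>

lemma finitely_generated_vec_linear:
  assumes M: "module R M" and fg: "finitely_generated R M"
  shows "\<exists>n e. vec_linear n M e \<and> e ` carrier_vec n = carrier M"
proof -
  interpret M: module R M by (rule M)
  obtain S where S: "finite S" "S \<subseteq> carrier M"
    "\<forall>x\<in>carrier M. \<exists>c\<in>S \<rightarrow> carrier R. x = (\<Oplus>\<^bsub>M\<^esub>s\<in>S. c s \<odot>\<^bsub>M\<^esub> s)"
    using fg unfolding finitely_generated_def by blast
  have "\<exists>n e. vec_linear n M e \<and> (\<forall>c\<in>S \<rightarrow> carrier R. (\<Oplus>\<^bsub>M\<^esub>s\<in>S. c s \<odot>\<^bsub>M\<^esub> s) \<in> e ` carrier_vec n)"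
    using S(1,2)
  proof (induction S)
    case empty
    have "vec_linear 0 M (\<lambda>_. \<zero>\<^bsub>M\<^esub>)" by (simp add: vec_linear_def)
    moreover have "\<zero>\<^bsub>M\<^esub> \<in> (\<lambda>_. \<zero>\<^bsub>M\<^esub>) ` (carrier_vec 0 :: 'r vec set)" by (rule image_eqI[OF refl zero_carrier_vec])
    ultimately show ?case by auto
  next
    case (insert s S)
    then obtain n e where e: "vec_linear n M e"
      "\<forall>c\<in>S \<rightarrow> carrier R. (\<Oplus>\<^bsub>M\<^esub>s\<in>S. c s \<odot>\<^bsub>M\<^esub> s) \<in> e ` carrier_vec n" by auto
    let ?e = "\<lambda>u. e (vec n (\<lambda>i. u $ i)) \<oplus>\<^bsub>M\<^esub> (\<psi> (u $ n) \<odot>\<^bsub>M\<^esub> s)"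
    have l: "vec_linear (Suc n) M ?e" using vec_linear_extend[OF M e(1), of s] insert.prems by blast
    have "(\<Oplus>\<^bsub>M\<^esub>s\<in>insert s S. c s \<odot>\<^bsub>M\<^esub> s) \<in> ?e ` carrier_vec (Suc n)"
      if c: "c \<in> insert s S \<rightarrow> carrier R" for c
    proof -
      have "(\<Oplus>\<^bsub>M\<^esub>s\<in>S. c s \<odot>\<^bsub>M\<^esub> s) \<in> e ` carrier_vec n" using e(2) c by blast
      then obtain u where u: "u \<in> carrier_vec n" "(\<Oplus>\<^bsub>M\<^esub>s\<in>S. c s \<odot>\<^bsub>M\<^esub> s) = e u" by blast
      define v where "v = vec (Suc n) (\<lambda>i. if i < n then u $ i else coord (c s))"
      have v: "v \<in> carrier_vec (Suc n)" "vec n (\<lambda>i. v $ i) = u" "v $ n = coord (c s)"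
        using u(1) by (auto simp: v_def)
      have cs: "c s \<in> carrier R" and s: "s \<in> carrier M" using c insert.prems by auto
      have "(\<Oplus>\<^bsub>M\<^esub>s\<in>insert s S. c s \<odot>\<^bsub>M\<^esub> s) = c s \<odot>\<^bsub>M\<^esub> s \<oplus>\<^bsub>M\<^esub> (\<Oplus>\<^bsub>M\<^esub>s\<in>S. c s \<odot>\<^bsub>M\<^esub> s)"
        by (rule M.finsum_insert) (use insert c in auto)
      also have "\<dots> = ?e v"
        unfolding u(2) v(2,3) using cs s vec_linearD(1)[OF e(1) u(1)] by (simp add: M.a_comm)
      finally show ?thesis using v(1) by blast
    qed
    then show ?case using l by blast
  qed
  then obtain n e where e: "vec_linear n M e"
    "\<forall>c\<in>S \<rightarrow> carrier R. (\<Oplus>\<^bsub>M\<^esub>s\<in>S. c s \<odot>\<^bsub>M\<^esub> s) \<in> e ` carrier_vec n" by blast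
  have "e ` carrier_vec n = carrier M"
  proof (rule subset_antisym)
    show "e ` carrier_vec n \<subseteq> carrier M" using vec_linearD(1)[OF e(1)] by blast
    show "carrier M \<subseteq> e ` carrier_vec n"
    proof
      fix x assume "x \<in> carrier M"
      then obtain c where "c \<in> S \<rightarrow> carrier R" "x = (\<Oplus>\<^bsub>M\<^esub>s\<in>S. c s \<odot>\<^bsub>M\<^esub> s)" using S(3) by blast
      then show "x \<in> e ` carrier_vec n" using e(2) by simp
    qed
  qed
  then show ?thesis using e(1) by blast
qed

text \<open>Projectivity and tensor products are tested against modules whose elements are lists
  over the ring. This embedding of R^n into that universe supplies the free test modules.\<close>

definition vec_list :: "'r vec \<Rightarrow> 'a list" where "vec_list u = map \<psi> (list_of_vec u)"

definition list_coord :: "'a list \<Rightarrow> 'r vec" where "list_coord xs = vec_of_list (map coord xs)"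

lemma list_coord_vec_list [simp]: "list_coord (vec_list u) = u"
proof -
  have "coord \<circ> \<psi> = id" by (rule ext) simp
  then show ?thesis by (simp add: list_coord_def vec_list_def Matrix.vec_list)
qed

definition list_space :: "nat \<Rightarrow> 'r mat \<Rightarrow> ('a, 'a list) ips" where
  "list_space n A = \<lparr>carrier = vec_list ` carrier_vec n, monoid.mult = undefined, one = undefined,
    ring.zero = vec_list (0\<^sub>v n), add = (\<lambda>x y. vec_list (list_coord x + list_coord y)),
    module.smult = (\<lambda>r x. vec_list (coord r \<cdot>\<^sub>v list_coord x)),
    bform = (\<lambda>x y. \<psi> (list_coord x \<bullet> (A *\<^sub>v list_coord y)))\<rparr>"

text \<open>The test modules in \<open>projective\<close> and \<open>is_tensor_product\<close> are
  plain module records, so the form is dropped; which Gram matrix is inserted here has no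
  influence.\<close>

definition list_module :: "nat \<Rightarrow> ('a, 'a list) module" where
  "list_module n = module.truncate (list_space n (1\<^sub>m n))"

lemma coord_simps:
  "r \<in> carrier R \<Longrightarrow> s \<in> carrier R \<Longrightarrow> coord (r \<oplus> s) = coord r + coord s"
  "r \<in> carrier R \<Longrightarrow> s \<in> carrier R \<Longrightarrow> coord (r \<otimes> s) = coord r * coord s" "coord \<one> = 1"
proof -
  show "coord (r \<oplus> s) = coord r + coord s" if "r \<in> carrier R" "s \<in> carrier R" for r s
    using coord_psi[of "coord r + coord s"] that by (simp add: psi_add)
  show "coord (r \<otimes> s) = coord r * coord s" if "r \<in> carrier R" "s \<in> carrier R" for r s
    using coord_psi[of "coord r * coord s"] that by (simp add: psi_mult)
  show "coord \<one> = 1" using coord_psi[of 1] by (simp add: psi_one)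
qed

lemma module_cong:
  assumes M: "module R M" and eq: "carrier N = carrier M" "add N = add M" "ring.zero N = ring.zero M" "module.smult N = module.smult M"
  shows "module R N"
proof (rule moduleI)
  interpret M: module R M by (rule M)
  show "abelian_group N"
  proof (rule abelian_groupI)
    fix x assume "x \<in> carrier N"
    then show "\<exists>y\<in>carrier N. y \<oplus>\<^bsub>N\<^esub> x = \<zero>\<^bsub>N\<^esub>"
      using M.l_neg M.a_inv_closed by (auto simp: eq)
  qed (auto simp: eq M.a_assoc intro: M.a_comm)
qed (simp_all add: eq M R.cring_axioms module.smult_closed[OF M] module.smult_l_distr[OF M]
    module.smult_r_distr[OF M] module.smult_assoc1[OF M] module.smult_one[OF M])

lemma module_list_space: "module R (list_space n A)"
proof (rule moduleI)
  show "abelian_group (list_space n A)"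
  proof (rule abelian_groupI)
    fix x assume "x \<in> carrier (list_space n A)"
    then obtain u where u: "u \<in> carrier_vec n" "x = vec_list u" by (auto simp: list_space_def)
    have "vec_list (- u) \<in> carrier (list_space n A)" using u by (auto simp: list_space_def)
    moreover have "vec_list (- u) \<oplus>\<^bsub>list_space n A\<^esub> x = \<zero>\<^bsub>list_space n A\<^esub>"
      using u by (simp add: list_space_def uminus_l_inv_vec)
    ultimately show "\<exists>y\<in>carrier (list_space n A). y \<oplus>\<^bsub>list_space n A\<^esub> x = \<zero>\<^bsub>list_space n A\<^esub>" by blast
  qed (auto simp: list_space_def intro!: arg_cong[of _ _ vec_list] comm_add_vec[of _ n])
qed (auto simp: list_space_def R.cring_axioms coord_simps add_smult_distrib_vec
    smult_add_distrib_vec[of _ n] smult_smult_assoc)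

lemma module_list_module: "module R (list_module n)"
  by (rule module_cong[OF module_list_space[of n "1\<^sub>m n"]])
     (simp_all add: list_module_def module.truncate_def)

lemma frame_list_space: "frame n (list_space n A) vec_list"
proof -
  have "inj_on vec_list (carrier_vec n)" by (rule inj_on_inverseI) (rule list_coord_vec_list)
  then show ?thesis
    unfolding frame_def by (auto simp: list_space_def bij_betw_def intro!: vec_linearI)
qed

lemma frame_list_module: "frame n (list_module n) vec_list"
  using frame_list_space[of n "1\<^sub>m n"]
  unfolding frame_def vec_linear_def by (simp add: list_module_def module.truncate_def)

lemma has_gram_list_space:
  assumes "A \<in> carrier_mat n n" shows "has_gram (list_space n A) A"
  unfolding has_gram_def
  by (rule exI[of _ vec_list], rule gram_frameI[OF assms frame_list_space]) (simp add: list_space_def)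

text \<open>A surjection \<open>R\<^sup>n \<rightarrow> V\<close> with \<open>n\<close> minimal has its kernel inside the maximal ideal, since
  otherwise a basis vector could be dropped.\<close>

lemma minimal_kernel:
  assumes M: "module R M" and e: "vec_linear n M e" "e ` carrier_vec n = carrier M"
    and min: "\<And>m f. vec_linear m M f \<Longrightarrow> f ` carrier_vec m = carrier M \<Longrightarrow> n \<le> m"
    and u: "u \<in> carrier_vec n" "e u = \<zero>\<^bsub>M\<^esub>" and i: "i < n"
  shows "\<not> u $ i dvd 1"
proof
  assume "u $ i dvd 1"
  then obtain q where q: "u $ i * q = 1" unfolding dvd_def by metis
  interpret M: module R M by (rule M)
  obtain m where m: "n = Suc m" using i by (cases n) auto
  \<comment> \<open>The inclusion of R^m into R^n that inserts a zero at position
    \<open>i\<close>.\<close>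
  define P :: "'r mat" where "P = mat n m (\<lambda>(j, k). if j = (if k < i then k else Suc k) then 1 else 0)"
  have P: "P \<in> carrier_mat n m" by (simp add: P_def)
  have "e ` carrier_vec n \<subseteq> (\<lambda>v. e (P *\<^sub>v v)) ` carrier_vec m"
  proof
    fix x assume "x \<in> e ` carrier_vec n"
    then obtain w where w: "w \<in> carrier_vec n" "x = e w" by blast
    \<comment> \<open>Subtracting the right multiple of the kernel element \<open>u\<close> clears
      coordinate \<open>i\<close> without changing the image under \<open>e\<close>;
      \<open>q\<close> is the inverse of \<open>u $ i\<close>.\<close>
    define w' where "w' = w + (- (w $ i * q)) \<cdot>\<^sub>v u"
    define v where "v = vec m (\<lambda>k. w' $ (if k < i then k else Suc k))"
    have w': "w' \<in> carrier_vec n" using w u by (simp add: w'_def)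
    have w'i: "w' $ i = 0"
    proof -
      have "w' $ i = w $ i - w $ i * (u $ i * q)" using w u i by (simp add: w'_def algebra_simps)
      then show ?thesis unfolding q by simp
    qed
    have "P *\<^sub>v v = w'"
    proof (rule eq_vecI)
      fix j assume "j < dim_vec w'"
      then have j: "j < n" using w' by simp
      have "(P *\<^sub>v v) $ j = (\<Sum>k<m. P $$ (j, k) * v $ k)"
        using P j by (simp add: scalar_prod_def v_def atLeast0LessThan)
      also have "\<dots> = (\<Sum>k<m. if j = (if k < i then k else Suc k) then w' $ j else 0)"
        by (rule sum.cong) (use j in \<open>auto simp: P_def v_def\<close>)
      also have "\<dots> = w' $ j"
      proof -
        consider "j = i" | "j < i" | "i < j" by linarith
        then show ?thesis
        proof cases
          case 1
          have "(\<Sum>k<m. if j = (if k < i then k else Suc k) then w' $ j else 0) = (\<Sum>k<m. 0)"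
            by (rule sum.cong) (use 1 in auto)
          then show ?thesis using w'i 1 by simp
        next
          case 2
          have "(\<Sum>k<m. if j = (if k < i then k else Suc k) then w' $ j else 0) = (\<Sum>k<m. if k = j then w' $ j else 0)"
            by (rule sum.cong) (use 2 in auto)
          then show ?thesis using 2 i m by simp
        next
          case 3
          have "(\<Sum>k<m. if j = (if k < i then k else Suc k) then w' $ j else 0) = (\<Sum>k<m. if k = j - 1 then w' $ j else 0)"
            by (rule sum.cong) (use 3 in auto)
          then show ?thesis using 3 j m by simp
        qed
      qed
      finally show "(P *\<^sub>v v) $ j = w' $ j" .
    qed (use P w' in simp)
    moreover have "e w' = e w"
      unfolding w'_def
      using vec_linearD(2)[OF e(1) w(1), of "(- (w $ i * q)) \<cdot>\<^sub>v u"] vec_linearD(3)[OF e(1) u(1)]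
        vec_linearD(1)[OF e(1) w(1)] u by simp
    ultimately have "x = e (P *\<^sub>v v)" using w by simp
    moreover have "v \<in> carrier_vec m" by (simp add: v_def)
    ultimately show "x \<in> (\<lambda>v. e (P *\<^sub>v v)) ` carrier_vec m" by blast
  qed
  moreover have "(\<lambda>v. e (P *\<^sub>v v)) ` carrier_vec m \<subseteq> carrier M"
    using vec_linearD(1)[OF vec_linear_mat[OF e(1) P]] by blast
  ultimately have "(\<lambda>v. e (P *\<^sub>v v)) ` carrier_vec m = carrier M" using e(2) by blast
  then have "n \<le> m" using min vec_linear_mat[OF e(1) P] by blast
  then show False using m by simp
qed

text \<open>Choose a surjection \<open>e\<close> from R^n with n minimal. Projectivity gives a
  section, hence a linear projection \<open>\<pi>\<close> of R^n onto the kernel K of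
  \<open>e\<close>. By minimality every u in K is of the form t w, and then u = \<open>\<pi>\<close>
  u = t \<open>\<pi>\<close> w with \<open>\<pi>\<close> w again in K. So K = t K, and since t is
  nilpotent, K = 0 and \<open>e\<close> is a basis.\<close>

lemma projective_frame:
  fixes M :: "('a, 'a list, 'n) module_scheme" and t :: 'r
  assumes local: "\<And>p :: 'r. \<not> p dvd 1 \<Longrightarrow> t dvd p" and nilp: "t ^ k = 0"
    and M: "module R M" and fg: "finitely_generated R M" and proj: "projective R M"
  shows "\<exists>n e. frame n M e"
proof -
  interpret M: module R M by (rule M)
  let ?S = "\<lambda>n. \<exists>e. vec_linear n M e \<and> e ` carrier_vec n = carrier M"
  define n where "n = (LEAST n. ?S n)"
  have "\<exists>n. ?S n" using finitely_generated_vec_linear[OF M fg] by blast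
  then have "?S n" unfolding n_def by (rule LeastI_ex)
  then obtain e where e: "vec_linear n M e" "e ` carrier_vec n = carrier M" by blast
  have min: "n \<le> m" if "vec_linear m M f" "f ` carrier_vec m = carrier M" for m f
    unfolding n_def by (rule Least_le) (use that in blast)
  define P :: "('a, 'a list) module" where "P = module.truncate M"
  have P: "module R P" by (rule module_cong[OF M]) (simp_all add: P_def module.truncate_def)
  have ls: "linear_maps R M P = linear_maps R M M"
    unfolding linear_maps_def by (simp add: P_def module.truncate_def)
  have eP: "vec_linear n P e" using e(1) unfolding vec_linear_def by (simp add: P_def module.truncate_def)
  let ?i = "inv_into (carrier_vec n) vec_list"
  note i = frame_inv[OF frame_list_module[of n]]
  have f: "(\<lambda>x. e (?i x)) \<in> linear_maps R (list_module n) P"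
    by (rule frame_linear[OF frame_list_module eP])
  have surj: "(\<lambda>x. e (?i x)) ` carrier (list_module n) = carrier P"
  proof -
    have "?i ` carrier (list_module n) = carrier_vec n"
      using bij_betw_imp_surj_on[OF bij_betw_inv_into[OF frameD(2)[OF frame_list_module]]] .
    then have "(\<lambda>x. e (?i x)) ` carrier (list_module n) = e ` carrier_vec n"
      by (metis image_image)
    then show ?thesis using e(2) by (simp add: P_def module.truncate_def)
  qed
  have id: "(\<lambda>x. x) \<in> linear_maps R M P" unfolding ls by (simp add: linear_maps_def)
  obtain h where h: "h \<in> linear_maps R M (list_module n)" "\<forall>x\<in>carrier M. e (?i (h x)) = x"
    \<comment> \<open>Projectivity is applied to the identity of \<open>M\<close>, read as a map
      into the plain module record \<open>P\<close> with the same operations. The lift is a section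
      of \<open>e\<close>.\<close>
    using proj[unfolded projective_def, rule_format, OF conjI[OF module_list_module P] f surj id] by blast
  have hc: "?i (h x) \<in> carrier_vec n" if "x \<in> carrier M" for x
    using i(2) h(1) that unfolding linear_maps_def by auto
  define \<pi> where "\<pi> u = u - ?i (h (e u))" for u
  have iadd: "?i (h (e (u + v))) = ?i (h (e u)) + ?i (h (e v))" if "u \<in> carrier_vec n" "v \<in> carrier_vec n" for u v
  proof -
    have hu: "h (e u) \<in> carrier (list_module n)" "h (e v) \<in> carrier (list_module n)"
      using h(1) vec_linearD(1)[OF e(1)] that unfolding linear_maps_def by auto
    have "h (e (u + v)) = h (e u) \<oplus>\<^bsub>list_module n\<^esub> h (e v)"
      using h(1) vec_linearD(1)[OF e(1)] vec_linearD(2)[OF e(1)] that unfolding linear_maps_def by simp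
    also have "\<dots> = vec_list (?i (h (e u)) + ?i (h (e v)))"
      using vec_linearD(2)[OF frameD(1)[OF frame_list_module] i(2)[OF hu(1)] i(2)[OF hu(2)]]
        i(3)[OF hu(1)] i(3)[OF hu(2)] by simp
    finally show ?thesis using i(1)[of "?i (h (e u)) + ?i (h (e v))"] i(2)[OF hu(1)] i(2)[OF hu(2)] by simp
  qed
  have ismult: "?i (h (e (p \<cdot>\<^sub>v u))) = p \<cdot>\<^sub>v ?i (h (e u))" if "u \<in> carrier_vec n" for u p
  proof -
    have hu: "h (e u) \<in> carrier (list_module n)"
      using h(1) vec_linearD(1)[OF e(1)] that unfolding linear_maps_def by auto
    have "h (e (p \<cdot>\<^sub>v u)) = \<psi> p \<odot>\<^bsub>list_module n\<^esub> h (e u)"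
      using h(1) vec_linearD(1)[OF e(1)] vec_linearD(3)[OF e(1)] that unfolding linear_maps_def by simp
    also have "\<dots> = vec_list (p \<cdot>\<^sub>v ?i (h (e u)))"
      using vec_linearD(3)[OF frameD(1)[OF frame_list_module] i(2)[OF hu]] i(3)[OF hu] by simp
    finally show ?thesis using i(1)[of "p \<cdot>\<^sub>v ?i (h (e u))"] i(2)[OF hu] by simp
  qed
  have eu: "e u \<in> carrier M" if "u \<in> carrier_vec n" for u using vec_linearD(1)[OF e(1) that] .
  have \<pi>: "\<pi> u \<in> carrier_vec n" "e (\<pi> u) = \<zero>\<^bsub>M\<^esub>" if u: "u \<in> carrier_vec n" for u
  proof -
    note c = hc[OF eu[OF u]]
    show "\<pi> u \<in> carrier_vec n" using c u by (simp add: \<pi>_def)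
    have eq: "\<pi> u + ?i (h (e u)) = u"
      unfolding \<pi>_def using c u by (intro eq_vecI) auto
    have "e (\<pi> u) \<oplus>\<^bsub>M\<^esub> e u = e u"
      using vec_linearD(2)[OF e(1) \<open>\<pi> u \<in> carrier_vec n\<close> c] h(2) eu[OF u] unfolding eq by simp
    then show "e (\<pi> u) = \<zero>\<^bsub>M\<^esub>"
      using M.add.l_cancel_one[OF eu[OF u] eu[OF \<open>\<pi> u \<in> carrier_vec n\<close>]]
        M.a_comm[OF eu[OF u] eu[OF \<open>\<pi> u \<in> carrier_vec n\<close>]] by simp
  qed
  have step: "\<exists>u'. u' \<in> carrier_vec n \<and> e u' = \<zero>\<^bsub>M\<^esub> \<and> u = t \<cdot>\<^sub>v u'"
    if u: "u \<in> carrier_vec n" "e u = \<zero>\<^bsub>M\<^esub>" for u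
  proof -
    have "\<exists>p. u $ i = t * p" if i: "i < n" for i
    proof -
      have "\<not> u $ i dvd 1" by (rule minimal_kernel[OF M e _ u i]) (rule min)
      from local[OF this] show ?thesis unfolding dvd_def .
    qed
    then obtain p where p: "\<And>i. i < n \<Longrightarrow> u $ i = t * p i" by metis
    define w where "w = vec n p"
    have w: "w \<in> carrier_vec n" by (simp add: w_def)
    have uw: "u = t \<cdot>\<^sub>v w" by (rule eq_vecI) (use u p in \<open>auto simp: w_def\<close>)
    have "u = \<pi> u"
    proof -
      have "?i (h (e u)) = 0\<^sub>v n"
      proof -
        have "?i (h (e (0 \<cdot>\<^sub>v u))) = 0 \<cdot>\<^sub>v ?i (h (e u))" by (rule ismult[OF u(1)])
        moreover have "0 \<cdot>\<^sub>v u = 0\<^sub>v n" using u(1) by (intro eq_vecI) auto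
        moreover have "0 \<cdot>\<^sub>v ?i (h (e u)) = 0\<^sub>v n" using hc[OF eu[OF u(1)]] by (intro eq_vecI) auto
        ultimately show ?thesis using vec_linear_zero[OF M e(1)] u(2) by simp
      qed
      then show ?thesis unfolding \<pi>_def using u(1) by (intro eq_vecI) auto
    qed
    also have "\<dots> = t \<cdot>\<^sub>v \<pi> w"
      unfolding \<pi>_def uw ismult[OF w] using w hc[OF eu[OF w]]
      by (intro eq_vecI) (auto simp: algebra_simps)
    finally show ?thesis using \<pi>[OF w] by blast
  qed
  have pow: "\<exists>u'. u' \<in> carrier_vec n \<and> e u' = \<zero>\<^bsub>M\<^esub> \<and> u = t ^ j \<cdot>\<^sub>v u'"
    if u: "u \<in> carrier_vec n" "e u = \<zero>\<^bsub>M\<^esub>" for u j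
  proof (induction j)
    case 0
    have "u = t ^ 0 \<cdot>\<^sub>v u" using u by (intro eq_vecI) auto
    then show ?case using u by blast
  next
    case (Suc j)
    then obtain v where v: "v \<in> carrier_vec n" "e v = \<zero>\<^bsub>M\<^esub>" "u = t ^ j \<cdot>\<^sub>v v" by blast
    obtain w where w: "w \<in> carrier_vec n" "e w = \<zero>\<^bsub>M\<^esub>" "v = t \<cdot>\<^sub>v w" using step[OF v(1,2)] by blast
    have "u = t ^ Suc j \<cdot>\<^sub>v w" unfolding v(3) w(3) by (simp add: smult_smult_assoc mult.commute)
    then show ?case using w by blast
  qed
  have ker: "u = 0\<^sub>v n" if u: "u \<in> carrier_vec n" "e u = \<zero>\<^bsub>M\<^esub>" for u
  proof -
    obtain u' where "u' \<in> carrier_vec n" "u = 0 \<cdot>\<^sub>v u'" using pow[OF u, of k] unfolding nilp by blast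
    then show ?thesis using u(1) by (intro eq_vecI) auto
  qed
  have "inj_on e (carrier_vec n)"
  proof (rule inj_onI)
    fix u v assume u: "u \<in> carrier_vec n" and v: "v \<in> carrier_vec n" and eq: "e u = e v"
    have d: "u - v \<in> carrier_vec n" using u v by simp
    have uv: "(u - v) + v = u" using u v by (intro eq_vecI) auto
    have "e (u - v) \<oplus>\<^bsub>M\<^esub> e v = e v" using vec_linearD(2)[OF e(1) d v] eq unfolding uv by simp
    then have "e (u - v) = \<zero>\<^bsub>M\<^esub>"
      using M.add.l_cancel_one[OF eu[OF v] eu[OF d]] M.a_comm[OF eu[OF v] eu[OF d]] by simp
    then have "u - v = 0\<^sub>v n" using ker[OF d] by blast
    then show "u = v" using uv v by simp
  qed
  then have "frame n M e" using e unfolding frame_def bij_betw_def by blast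
  then show ?thesis by blast
qed

end

section \<open>Gram matrices of orthogonal sums, of small spaces, and their existence in
  general\<close>

lemma zero_mat_mult_vec:
  fixes v :: "'r :: comm_ring_1 vec"
  assumes "v \<in> carrier_vec m" shows "0\<^sub>m n m *\<^sub>v v = 0\<^sub>v n"
  by (rule eq_vecI) (use assms in simp_all)

lemma block_sum_mult_vec:
  fixes A :: "'r :: comm_ring_1 mat"
  assumes A: "A \<in> carrier_mat n n" and B: "B \<in> carrier_mat m m"
    and u: "u \<in> carrier_vec n" and v: "v \<in> carrier_vec m"
  shows "block_sum A B *\<^sub>v (u @\<^sub>v v) = (A *\<^sub>v u) @\<^sub>v (B *\<^sub>v v)"
proof -
  have dims: "dim_row A = n" "dim_col A = n" "dim_row B = m" "dim_col B = m" using A B by simp_all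
  have Au: "A *\<^sub>v u \<in> carrier_vec n" and Bv: "B *\<^sub>v v \<in> carrier_vec m" using A B u v by simp_all
  show ?thesis
    unfolding block_sum_def dims
      four_block_mat_mult_vec[OF A zero_carrier_mat zero_carrier_mat B u v]
      zero_mat_mult_vec[OF u] zero_mat_mult_vec[OF v]
      right_zero_vec[OF Au] left_zero_vec[OF Bv] ..
qed

lemma append_vec_splitI:
  "u \<in> carrier_vec (n + m) \<Longrightarrow> vec n (\<lambda>i. u $ i) @\<^sub>v vec m (\<lambda>i. u $ (n + i)) = u"
  by (rule eq_vecI) auto

context coordinate_ring
begin

interpretation R: cring R by (rule cring)

lemma has_gram_orthogonal_sum:
  assumes V: "has_gram V A" and W: "has_gram W B"
  shows "has_gram (orthogonal_sum R V W) (block_sum A B)"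
proof -
  obtain e where e: "gram_frame V A e" using V unfolding has_gram_def by blast
  obtain e' where e': "gram_frame W B e'" using W unfolding has_gram_def by blast
  obtain n where n: "A \<in> carrier_mat n n" using gram_frame_carrier[OF e] .
  obtain m where m: "B \<in> carrier_mat m m" using gram_frame_carrier[OF e'] .
  note f = gram_frameD[OF e n] and f' = gram_frameD[OF e' m]
  note l = vec_linearD[OF frameD(1)[OF f(1)]] and l' = vec_linearD[OF frameD(1)[OF f'(1)]]
  let ?l = "\<lambda>u :: 'r vec. vec n (\<lambda>i. u $ i)" and ?r = "\<lambda>u :: 'r vec. vec m (\<lambda>i. u $ (n + i))"
  let ?S = "orthogonal_sum R V W"
  let ?e = "\<lambda>u. (e (?l u), e' (?r u))"
  have lr: "?l u \<in> carrier_vec n" "?r u \<in> carrier_vec m" for u by simp_all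
  have "vec_linear (n + m) ?S ?e"
  proof (rule vec_linearI)
    fix u :: "'r vec" assume u: "u \<in> carrier_vec (n + m)"
    show "?e u \<in> carrier ?S" using l(1)[OF lr(1)] l'(1)[OF lr(2)] by (simp add: orthogonal_sum_def)
    show "?e (p \<cdot>\<^sub>v u) = \<psi> p \<odot>\<^bsub>?S\<^esub> ?e u" for p
    proof -
      have "?l (p \<cdot>\<^sub>v u) = p \<cdot>\<^sub>v ?l u" "?r (p \<cdot>\<^sub>v u) = p \<cdot>\<^sub>v ?r u"
        using u by (auto intro!: eq_vecI)
      then show ?thesis using l(3)[OF lr(1)] l'(3)[OF lr(2)] by (simp add: orthogonal_sum_def)
    qed
    fix v :: "'r vec" assume v: "v \<in> carrier_vec (n + m)"
    have "?l (u + v) = ?l u + ?l v" "?r (u + v) = ?r u + ?r v"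
      using u v by (auto intro!: eq_vecI)
    then show "?e (u + v) = ?e u \<oplus>\<^bsub>?S\<^esub> ?e v"
      using l(2)[OF lr(1) lr(1)] l'(2)[OF lr(2) lr(2)] by (simp add: orthogonal_sum_def)
  qed
  moreover have "bij_betw ?e (carrier_vec (n + m)) (carrier ?S)"
  proof (rule bij_betwI[where g = "\<lambda>(x, y). inv_into (carrier_vec n) e x @\<^sub>v inv_into (carrier_vec m) e' y"])
    show "?e \<in> carrier_vec (n + m) \<rightarrow> carrier ?S"
      using l(1)[OF lr(1)] l'(1)[OF lr(2)] by (simp add: orthogonal_sum_def)
    show "(\<lambda>(x, y). inv_into (carrier_vec n) e x @\<^sub>v inv_into (carrier_vec m) e' y) \<in> carrier ?S \<rightarrow> carrier_vec (n + m)"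
      using frame_inv(2)[OF f(1)] frame_inv(2)[OF f'(1)] by (auto simp: orthogonal_sum_def)
    show "(\<lambda>(x, y). inv_into (carrier_vec n) e x @\<^sub>v inv_into (carrier_vec m) e' y) (?e u) = u"
      if "u \<in> carrier_vec (n + m)" for u
      using frame_inv(1)[OF f(1) lr(1)] frame_inv(1)[OF f'(1) lr(2)] append_vec_splitI[OF that] by simp
    show "?e ((\<lambda>(x, y). inv_into (carrier_vec n) e x @\<^sub>v inv_into (carrier_vec m) e' y) z) = z"
      if z: "z \<in> carrier ?S" for z
    proof -
      obtain x y where xy: "z = (x, y)" "x \<in> carrier V" "y \<in> carrier W"
        using z by (auto simp: orthogonal_sum_def)
      note i = frame_inv(2,3)[OF f(1) xy(2)] frame_inv(2,3)[OF f'(1) xy(3)]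
      have "?l (a @\<^sub>v b) = a" "?r (a @\<^sub>v b) = b" if "a \<in> carrier_vec n" "b \<in> carrier_vec m" for a b
        using that by (auto intro!: eq_vecI)
      then show ?thesis using i xy(1) by simp
    qed
  qed
  ultimately have fr: "frame (n + m) ?S ?e" unfolding frame_def by blast
  have "gram_frame ?S (block_sum A B) ?e"
  proof (rule gram_frameI[OF block_sum_carrier[OF n m] fr])
    fix u v :: "'r vec" assume u: "u \<in> carrier_vec (n + m)" and v: "v \<in> carrier_vec (n + m)"
    have c: "A *\<^sub>v ?l v \<in> carrier_vec n" "B *\<^sub>v ?r v \<in> carrier_vec m" using n m by simp_all
    have "u \<bullet> (block_sum A B *\<^sub>v v) = (?l u @\<^sub>v ?r u) \<bullet> (block_sum A B *\<^sub>v (?l v @\<^sub>v ?r v))"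
      unfolding append_vec_splitI[OF u] append_vec_splitI[OF v] ..
    also have "\<dots> = ?l u \<bullet> (A *\<^sub>v ?l v) + ?r u \<bullet> (B *\<^sub>v ?r v)"
      unfolding block_sum_mult_vec[OF n m lr] by (rule scalar_prod_append[OF lr c])
    finally show "bform ?S (?e u) (?e v) = \<psi> (u \<bullet> (block_sum A B *\<^sub>v v))"
      using f(2)[OF lr(1) lr(1)] f'(2)[OF lr(2) lr(2)] by (simp add: orthogonal_sum_def psi_add)
  qed
  then show ?thesis unfolding has_gram_def by blast
qed

lemma has_gram_zero_space: "has_gram (zero_space R) (1\<^sub>m 0)"
proof -
  have "(carrier_vec 0 :: 'r vec set) = {0\<^sub>v 0}" by auto
  then have "frame 0 (zero_space R) (\<lambda>_. ())"
    by (auto simp: frame_def vec_linear_def zero_space_def bij_betw_def)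
  then have "gram_frame (zero_space R) (1\<^sub>m 0) (\<lambda>_. ())"
    by (rule gram_frameI[OF one_carrier_mat]) (simp add: zero_space_def scalar_prod_def psi_zero)
  then show ?thesis unfolding has_gram_def by blast
qed

lemma has_gram_rank_one: "has_gram (rank_one_space R (\<psi> a)) (scal a)"
proof -
  let ?e = "\<lambda>u :: 'r vec. \<psi> (u $ 0)"
  have "vec_linear 1 (rank_one_space R (\<psi> a)) ?e"
    by (rule vec_linearI) (auto simp: rank_one_space_def psi_add psi_mult)
  moreover have "bij_betw ?e (carrier_vec 1) (carrier (rank_one_space R (\<psi> a)))"
  proof (rule bij_betwI[where g = "\<lambda>r. vec 1 (\<lambda>_. coord r)"])
    show "?e \<in> carrier_vec 1 \<rightarrow> carrier (rank_one_space R (\<psi> a))"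
      by (simp add: rank_one_space_def)
    show "vec 1 (\<lambda>_. coord (?e u)) = u" if "u \<in> carrier_vec 1" for u
      using that by (intro eq_vecI) auto
  qed (simp_all add: rank_one_space_def)
  ultimately have "frame 1 (rank_one_space R (\<psi> a)) ?e" unfolding frame_def by blast
  then have "gram_frame (rank_one_space R (\<psi> a)) (scal a) ?e"
  proof (rule gram_frameI[OF scal_carrier(1)])
    fix u v :: "'r vec" assume "u \<in> carrier_vec 1" "v \<in> carrier_vec 1"
    then have "u \<bullet> (scal a *\<^sub>v v) = a * u $ 0 * v $ 0"
      by (simp add: scalar_prod_def scal_def ac_simps)
    then show "bform (rank_one_space R (\<psi> a)) (?e u) (?e v) = \<psi> (u \<bullet> (scal a *\<^sub>v v))"
      by (simp add: rank_one_space_def psi_mult)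
  qed
  then show ?thesis unfolding has_gram_def by blast
qed

text \<open>By freeness only unimodularity is at stake. Non-degeneracy represents each coordinate
  functional by a vector, and these vectors are the rows of a left inverse of the Gram matrix, whose
  determinant is therefore a unit.\<close>

lemma ips_has_gram:
  fixes V :: "('a, 'a list) ips" and t :: 'r
  assumes local: "\<And>p :: 'r. \<not> p dvd 1 \<Longrightarrow> t dvd p" and nilp: "t ^ k = 0"
    and V: "inner_product_space R V"
  shows "\<exists>A. unimodular A \<and> has_gram V A"
proof -
  have M: "module R V" and bil: "bform V \<in> bilinear_maps R V V (self_module R)"
    and sym: "\<And>x y. x \<in> carrier V \<Longrightarrow> y \<in> carrier V \<Longrightarrow> bform V x y = bform V y x"
    and nd: "nondegenerate R V" and fg: "finitely_generated R V" and proj: "projective R V"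
    using V unfolding inner_product_space_def by blast+
  obtain n e where fr: "frame n V e" using projective_frame[OF local nilp M fg proj] by blast
  note l = frameD(1)[OF fr] and lD = vec_linearD[OF frameD(1)[OF fr]]
  define A where "A = mat n n (\<lambda>(i, j). coord (bform V (e (unit_vec n i)) (e (unit_vec n j))))"
  have A: "A \<in> carrier_mat n n" by (simp add: A_def)
  have bc: "bform V x y \<in> carrier R" if "x \<in> carrier V" "y \<in> carrier V" for x y
    using bil that unfolding bilinear_maps_def linear_maps_def by (auto simp: Pi_iff)
  have bl: "bform V x \<in> linear_maps R V (self_module R)" "(\<lambda>y. bform V y x) \<in> linear_maps R V (self_module R)"
    if "x \<in> carrier V" for x using bil that unfolding bilinear_maps_def by blast+
  have eu: "e (unit_vec n i) \<in> carrier V" for i by (rule lD(1)[OF unit_vec_carrier])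
  have gram1: "bform V (e (unit_vec n i)) (e v) = \<psi> (row A i \<bullet> v)"
    if i: "i < n" and v: "v \<in> carrier_vec n" for i v
  proof (rule vec_linear_ext[OF module_self vec_linear_compose[OF l bl(1)[OF eu]] scalar_prod_vec_linear _ v])
    show "row A i \<in> carrier_vec n" using A i by simp
    fix j assume j: "j < n"
    then show "bform V (e (unit_vec n i)) (e (unit_vec n j)) = \<psi> (row A i \<bullet> unit_vec n j)"
      using A i bc[OF eu eu] by (simp add: A_def)
  qed
  have gram: "bform V (e u) (e v) = \<psi> (u \<bullet> (A *\<^sub>v v))" if u: "u \<in> carrier_vec n" and v: "v \<in> carrier_vec n" for u v
  proof -
    have Av: "A *\<^sub>v v \<in> carrier_vec n" using A v by simp
    have "bform V (e u) (e v) = \<psi> ((A *\<^sub>v v) \<bullet> u)"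
    proof (rule vec_linear_ext[OF module_self vec_linear_compose[OF l bl(2)[OF lD(1)[OF v]]] scalar_prod_vec_linear[OF Av] _ u])
      fix i assume i: "i < n"
      show "bform V (e (unit_vec n i)) (e v) = \<psi> ((A *\<^sub>v v) \<bullet> unit_vec n i)"
        using gram1[OF i v] i A Av by simp
    qed
    then show ?thesis using comm_scalar_prod[OF u Av] by simp
  qed
  have gf: "gram_frame V A e" by (rule gram_frameI[OF A fr gram])
  have symA: "A\<^sup>T = A"
    by (rule eq_matI) (auto simp: A_def sym[OF eu eu])
  \<comment> \<open>The vector \<open>c\<close> represents the i-th coordinate functional of the
    chosen basis.\<close>
  have "\<exists>c\<in>carrier_vec n. \<forall>v\<in>carrier_vec n. c \<bullet> (A *\<^sub>v v) = v $ i" if i: "i < n" for i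
  proof -
    have "(\<lambda>x. \<psi> (unit_vec n i \<bullet> inv_into (carrier_vec n) e x)) \<in> linear_maps R V (self_module R)"
      by (rule frame_linear[OF fr scalar_prod_vec_linear[OF unit_vec_carrier]])
    then obtain x where x: "x \<in> carrier V"
      "\<forall>w\<in>carrier V. bform V x w = \<psi> (unit_vec n i \<bullet> inv_into (carrier_vec n) e w)"
      using nd unfolding nondegenerate_def by blast
    obtain c where c: "c \<in> carrier_vec n" "x = e c" using frame_obtain[OF fr x(1)] .
    have "c \<bullet> (A *\<^sub>v v) = v $ i" if v: "v \<in> carrier_vec n" for v
    proof -
      have "\<psi> (c \<bullet> (A *\<^sub>v v)) = \<psi> (unit_vec n i \<bullet> v)"
        using x(2)[rule_format, OF lD(1)[OF v]] gram[OF c(1) v] c(2) frame_inv(1)[OF fr v] by simp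
      then show ?thesis using i v by simp
    qed
    then show ?thesis using c(1) by blast
  qed
  then obtain c where c: "\<And>i. i < n \<Longrightarrow> c i \<in> carrier_vec n"
    "\<And>i v. i < n \<Longrightarrow> v \<in> carrier_vec n \<Longrightarrow> c i \<bullet> (A *\<^sub>v v) = v $ i" by metis
  define C where "C = mat n n (\<lambda>(i, j). c i $ j)"
  have C: "C \<in> carrier_mat n n" by (simp add: C_def)
  have "C * A = 1\<^sub>m n"
  proof (rule eq_matI)
    fix i j assume "i < dim_row (1\<^sub>m n :: 'r mat)" "j < dim_col (1\<^sub>m n :: 'r mat)"
    then have ij: "i < n" "j < n" by simp_all
    have "row C i = c i" using c(1)[OF ij(1)] ij by (intro eq_vecI) (auto simp: C_def)
    then show "(C * A) $$ (i, j) = 1\<^sub>m n $$ (i, j)"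
      using c(2)[OF ij(1) unit_vec_carrier, of j] ij C A mult_mat_unit_vec[OF A ij(2)] by simp
  qed (use A C in simp_all)
  then have "det C * det A = 1" using det_mult[OF C A] by simp
  then have "det A dvd 1" by (intro dvdI[of _ _ "det C"]) (simp only: mult.commute)
  then have "unimodular A" using A symA by (intro unimodularI)
  then show ?thesis using gf unfolding has_gram_def by blast
qed

end

section \<open>Tensor products\<close>

text \<open>The coordinates of a pure tensor, in the same coding of index pairs as for
  \<open>kron\<close>.\<close>

definition kron_vec :: "nat \<Rightarrow> nat \<Rightarrow> 'r :: times vec \<Rightarrow> 'r vec \<Rightarrow> 'r vec" where
  "kron_vec n m u v = vec (n * m) (\<lambda>k. u $ (k div m) * v $ (k mod m))"

lemma kron_vec_carrier [simp]: "kron_vec n m u v \<in> carrier_vec (n * m)"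
  by (simp add: kron_vec_def)

lemma kron_vec_index: "k < n * m \<Longrightarrow> kron_vec n m u v $ k = u $ (k div m) * v $ (k mod m)"
  by (simp add: kron_vec_def)

lemma kron_vec_add:
  fixes u :: "'r :: comm_ring_1 vec"
  assumes "u \<in> carrier_vec n" "u' \<in> carrier_vec n" "v \<in> carrier_vec m" "v' \<in> carrier_vec m"
  shows "kron_vec n m (u + u') v = kron_vec n m u v + kron_vec n m u' v"
    "kron_vec n m u (v + v') = kron_vec n m u v + kron_vec n m u v'"
  using assms div_mod_less by (auto intro!: eq_vecI simp: kron_vec_def algebra_simps)

lemma kron_vec_smult:
  fixes u :: "'r :: comm_ring_1 vec"
  assumes "u \<in> carrier_vec n" "v \<in> carrier_vec m"
  shows "kron_vec n m (p \<cdot>\<^sub>v u) v = p \<cdot>\<^sub>v kron_vec n m u v"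
    "kron_vec n m u (p \<cdot>\<^sub>v v) = p \<cdot>\<^sub>v kron_vec n m u v"
  using assms div_mod_less by (auto intro!: eq_vecI simp: kron_vec_def ac_simps)

lemma kron_vec_unit_vec:
  assumes k: "k < n * m"
  shows "kron_vec n m (unit_vec n (k div m)) (unit_vec m (k mod m)) = (unit_vec (n * m) k :: 'r :: comm_ring_1 vec)"
proof (rule eq_vecI)
  fix l assume "l < dim_vec (unit_vec (n * m) k :: 'r vec)"
  then have l: "l < n * m" by simp
  have "l div m = k div m \<and> l mod m = k mod m \<longleftrightarrow> l = k" by (metis div_mult_mod_eq)
  then show "kron_vec n m (unit_vec n (k div m)) (unit_vec m (k mod m)) $ l = (unit_vec (n * m) k :: 'r vec) $ l"
    using k l div_mod_less[OF k] div_mod_less[OF l] by (auto simp: kron_vec_index)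
qed (simp add: kron_vec_def)

lemma kron_vec_scalar_prod:
  fixes u :: "'r :: comm_ring_1 vec"
  assumes "v \<in> carrier_vec n" "w \<in> carrier_vec m"
  shows "kron_vec n m u u' \<bullet> kron_vec n m v w = (u \<bullet> v) * (u' \<bullet> w)"
proof -
  have "kron_vec n m u u' \<bullet> kron_vec n m v w = (\<Sum>k<n * m. (u $ (k div m) * v $ (k div m)) * (u' $ (k mod m) * w $ (k mod m)))"
    unfolding scalar_prod_def by (rule sum.cong) (auto simp: kron_vec_def ac_simps)
  also have "\<dots> = (\<Sum>i<n. u $ i * v $ i) * (\<Sum>j<m. u' $ j * w $ j)"
    unfolding sum_product by (rule sum_div_mod)
  also have "\<dots> = (u \<bullet> v) * (u' \<bullet> w)"
    using assms by (simp add: scalar_prod_def atLeast0LessThan)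
  finally show ?thesis .
qed

lemma kron_mult_kron_vec:
  fixes A :: "'r :: comm_ring_1 mat"
  assumes A: "A \<in> carrier_mat n n" and B: "B \<in> carrier_mat m m"
    and u: "u \<in> carrier_vec n" and v: "v \<in> carrier_vec m"
  shows "kron A B *\<^sub>v kron_vec n m u v = kron_vec n m (A *\<^sub>v u) (B *\<^sub>v v)"
proof (rule eq_vecI)
  fix k assume "k < dim_vec (kron_vec n m (A *\<^sub>v u) (B *\<^sub>v v))"
  then have k: "k < n * m" by (simp add: kron_vec_def)
  note dm = div_mod_less[OF k]
  have "row (kron A B) k = kron_vec n m (row A (k div m)) (row B (k mod m))"
  proof (rule eq_vecI)
    fix l assume "l < dim_vec (kron_vec n m (row A (k div m)) (row B (k mod m)))"
    then have l: "l < n * m" by (simp add: kron_vec_def)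
    show "row (kron A B) k $ l = kron_vec n m (row A (k div m)) (row B (k mod m)) $ l"
      using A B k l dm div_mod_less[OF l] kron_index[OF A B k l] by (simp add: kron_vec_index)
  qed (use A B in \<open>simp add: kron_vec_def\<close>)
  then have "(kron A B *\<^sub>v kron_vec n m u v) $ k = (row A (k div m) \<bullet> u) * (row B (k mod m) \<bullet> v)"
    using A B k kron_vec_scalar_prod[OF u v] by simp
  then show "(kron A B *\<^sub>v kron_vec n m u v) $ k = kron_vec n m (A *\<^sub>v u) (B *\<^sub>v v) $ k"
    using A B k dm by (simp add: kron_vec_index)
qed (use A B in \<open>simp add: kron_vec_def\<close>)

context coordinate_ring
begin

interpretation R: cring R by (rule cring)

lemma bilinear_vec_linear:
  assumes V: "frame n V e" and W: "frame m W e'" and t: "t \<in> bilinear_maps R V W P"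
  shows "v \<in> carrier_vec m \<Longrightarrow> vec_linear n P (\<lambda>u. t (e u) (e' v))"
    "u \<in> carrier_vec n \<Longrightarrow> vec_linear m P (\<lambda>v. t (e u) (e' v))"
proof -
  show "vec_linear n P (\<lambda>u. t (e u) (e' v))" if "v \<in> carrier_vec m"
  proof -
    have "(\<lambda>x. t x (e' v)) \<in> linear_maps R V P"
      using t vec_linearD(1)[OF frameD(1)[OF W] that] unfolding bilinear_maps_def by blast
    from vec_linear_compose[OF frameD(1)[OF V] this] show ?thesis .
  qed
  show "vec_linear m P (\<lambda>v. t (e u) (e' v))" if "u \<in> carrier_vec n"
  proof -
    have "t (e u) \<in> linear_maps R W P"
      using t vec_linearD(1)[OF frameD(1)[OF V] that] unfolding bilinear_maps_def by blast
    from vec_linear_compose[OF frameD(1)[OF W] this] show ?thesis .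
  qed
qed

lemma kron_vec_linear:
  assumes f: "vec_linear (n * m) P f"
  shows "v \<in> carrier_vec m \<Longrightarrow> vec_linear n P (\<lambda>u. f (kron_vec n m u v))"
    "u \<in> carrier_vec n \<Longrightarrow> vec_linear m P (\<lambda>v. f (kron_vec n m u v))"
  using vec_linearD[OF f kron_vec_carrier]
  by (auto intro!: vec_linearI simp: kron_vec_add[where n = n and m = m] kron_vec_smult)

lemma bilinear_ext:
  assumes P: "module R P"
    and F: "\<And>v. v \<in> carrier_vec m \<Longrightarrow> vec_linear n P (\<lambda>u. F u v)" "\<And>u. u \<in> carrier_vec n \<Longrightarrow> vec_linear m P (F u)"
    and G: "\<And>v. v \<in> carrier_vec m \<Longrightarrow> vec_linear n P (\<lambda>u. G u v)" "\<And>u. u \<in> carrier_vec n \<Longrightarrow> vec_linear m P (G u)"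
    and eq: "\<And>k. k < n * m \<Longrightarrow> F (unit_vec n (k div m)) (unit_vec m (k mod m)) = G (unit_vec n (k div m)) (unit_vec m (k mod m))"
    and u: "u \<in> carrier_vec n" and v: "v \<in> carrier_vec m"
  shows "F u v = G u v"
proof (rule vec_linear_ext[OF P F(1)[OF v] G(1)[OF v] _ u])
  fix i assume i: "i < n"
  show "F (unit_vec n i) v = G (unit_vec n i) v"
  proof (rule vec_linear_ext[OF P F(2)[OF unit_vec_carrier] G(2)[OF unit_vec_carrier] _ v])
    fix j assume j: "j < m"
    have "i * m + j < Suc i * m" using j by simp
    also have "\<dots> \<le> n * m" using i by (intro mult_le_mono1) simp
    finally show "F (unit_vec n i) (unit_vec m j) = G (unit_vec n i) (unit_vec m j)"
      using eq[of "i * m + j"] j by simp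
  qed
qed

text \<open>A bilinear map is determined by its values on pairs of basis vectors, and these may be
  prescribed freely. The pairs correspond to the basis vectors of R^(n m), so any free module of
  that rank carries a tensor product structure.\<close>

lemma frame_tensor_product:
  fixes U :: "('a, 'a list, 'l) module_scheme"
  assumes e: "frame n V e" and e': "frame m W e'" and U: "module R U" and f: "frame (n * m) U f"
  defines "t \<equiv> \<lambda>x y. f (kron_vec n m (inv_into (carrier_vec n) e x) (inv_into (carrier_vec m) e' y))"
  shows "is_tensor_product R V W U t"
  unfolding is_tensor_product_def
proof (intro conjI allI impI ballI U)
  note i = frame_inv[OF e] and i' = frame_inv[OF e'] and fl = frameD(1)[OF f]
  have te: "t (e u) (e' v) = f (kron_vec n m u v)" if "u \<in> carrier_vec n" "v \<in> carrier_vec m" for u v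
    using i(1)[OF that(1)] i'(1)[OF that(2)] by (simp add: t_def)
  show "t \<in> bilinear_maps R V W U"
    unfolding bilinear_maps_def t_def
    using frame_linear[OF e' kron_vec_linear(2)[OF fl i(2)]] frame_linear[OF e kron_vec_linear(1)[OF fl i'(2)]]
    by simp
  fix P :: "('a, 'a list) module" and b
  assume P: "module R P" and b: "b \<in> bilinear_maps R V W P"
  note bl = bilinear_vec_linear[OF e e' b]
  have "b (e (unit_vec n (k div m))) (e' (unit_vec m (k mod m))) \<in> carrier P" for k
    by (rule vec_linearD(1)[OF bl(1)[OF unit_vec_carrier] unit_vec_carrier])
  then obtain g where g: "vec_linear (n * m) P g"
    "\<forall>k<n * m. g (unit_vec (n * m) k) = b (e (unit_vec n (k div m))) (e' (unit_vec m (k mod m)))"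
    using vec_linear_exists[OF P, of "n * m" "\<lambda>k. b (e (unit_vec n (k div m))) (e' (unit_vec m (k mod m)))"] by blast
  have gb: "g (kron_vec n m u v) = b (e u) (e' v)" if "u \<in> carrier_vec n" "v \<in> carrier_vec m" for u v
  proof (rule bilinear_ext[OF P kron_vec_linear[OF g(1)] bl _ that])
    fix k assume "k < n * m"
    then show "g (kron_vec n m (unit_vec n (k div m)) (unit_vec m (k mod m))) =
      b (e (unit_vec n (k div m))) (e' (unit_vec m (k mod m)))"
      using g(2) by (simp add: kron_vec_unit_vec)
  qed
  show "\<exists>g\<in>linear_maps R U P. \<forall>x\<in>carrier V. \<forall>y\<in>carrier W. g (t x y) = b x y"
  proof (intro bexI ballI)
    show "(\<lambda>z. g (inv_into (carrier_vec (n * m)) f z)) \<in> linear_maps R U P"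
      by (rule frame_linear[OF f g(1)])
    fix x y assume x: "x \<in> carrier V" and y: "y \<in> carrier W"
    show "g (inv_into (carrier_vec (n * m)) f (t x y)) = b x y"
      unfolding t_def frame_inv(1)[OF f kron_vec_carrier] gb[OF i(2)[OF x] i'(2)[OF y]] i(3)[OF x] i'(3)[OF y] ..
  qed
  fix g1 g2 z
  assume g1: "g1 \<in> linear_maps R U P" and g2: "g2 \<in> linear_maps R U P"
    and eq: "\<forall>x\<in>carrier V. \<forall>y\<in>carrier W. g1 (t x y) = b x y \<and> g2 (t x y) = b x y"
    and z: "z \<in> carrier U"
  obtain w where w: "w \<in> carrier_vec (n * m)" "z = f w" using frame_obtain[OF f z] .
  have "g1 (f w) = g2 (f w)"
  proof (rule vec_linear_ext[OF P vec_linear_compose[OF fl g1] vec_linear_compose[OF fl g2] _ w(1)])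
    fix k assume k: "k < n * m"
    let ?x = "e (unit_vec n (k div m))" and ?y = "e' (unit_vec m (k mod m))"
    have "f (unit_vec (n * m) k) = t ?x ?y"
      unfolding te[OF unit_vec_carrier unit_vec_carrier] kron_vec_unit_vec[OF k] ..
    moreover have "?x \<in> carrier V" "?y \<in> carrier W"
      using vec_linearD(1)[OF frameD(1)[OF e] unit_vec_carrier] vec_linearD(1)[OF frameD(1)[OF e'] unit_vec_carrier] by blast+
    ultimately show "g1 (f (unit_vec (n * m) k)) = g2 (f (unit_vec (n * m) k))" using eq by simp
  qed
  then show "g1 z = g2 z" using w(2) by simp
qed

lemma has_gram_tensor_space:
  fixes U :: "('a, 'a list) ips"
  assumes V: "has_gram V A" and W: "has_gram W B" and U: "module R U" "has_gram U (kron A B)"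
  shows "is_tensor_space R V W U"
proof -
  obtain e where e: "gram_frame V A e" using V unfolding has_gram_def by blast
  obtain e' where e': "gram_frame W B e'" using W unfolding has_gram_def by blast
  obtain f where f: "gram_frame U (kron A B) f" using U(2) unfolding has_gram_def by blast
  obtain n where n: "A \<in> carrier_mat n n" using gram_frame_carrier[OF e] .
  obtain m where m: "B \<in> carrier_mat m m" using gram_frame_carrier[OF e'] .
  note E = gram_frameD[OF e n] and E' = gram_frameD[OF e' m] and F = gram_frameD[OF f kron_carrier[OF n m]]
  let ?t = "\<lambda>x y. f (kron_vec n m (inv_into (carrier_vec n) e x) (inv_into (carrier_vec m) e' y))"
  have "is_tensor_product R V W U ?t" by (rule frame_tensor_product[OF E(1) E'(1) U(1) F(1)])
  moreover have "bform U (?t v w) (?t v' w') = bform V v v' \<otimes> bform W w w'"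
    if v: "v \<in> carrier V" "v' \<in> carrier V" and w: "w \<in> carrier W" "w' \<in> carrier W" for v v' w w'
  proof -
    obtain a a' where a: "a \<in> carrier_vec n" "v = e a" "a' \<in> carrier_vec n" "v' = e a'"
      using frame_obtain[OF E(1) v(1)] frame_obtain[OF E(1) v(2)] by metis
    obtain b b' where b: "b \<in> carrier_vec m" "w = e' b" "b' \<in> carrier_vec m" "w' = e' b'"
      using frame_obtain[OF E'(1) w(1)] frame_obtain[OF E'(1) w(2)] by metis
    have c: "A *\<^sub>v a' \<in> carrier_vec n" "B *\<^sub>v b' \<in> carrier_vec m" using n m a b by simp_all
    show ?thesis
      unfolding a(2,4) b(2,4) frame_inv(1)[OF E(1) a(1)] frame_inv(1)[OF E(1) a(3)]
        frame_inv(1)[OF E'(1) b(1)] frame_inv(1)[OF E'(1) b(3)] F(2)[OF kron_vec_carrier kron_vec_carrier]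
        kron_mult_kron_vec[OF n m a(3) b(3)] kron_vec_scalar_prod[OF c] E(2)[OF a(1,3)] E'(2)[OF b(1,3)]
      by (rule psi_mult)
  qed
  ultimately show ?thesis unfolding is_tensor_space_def by (intro exI[of _ ?t]) blast
qed

text \<open>Here \<open>U\<close> is known only through its universal property. Mapping basis
  vectors to pure tensors defines \<open>f\<close> from R^(n m) to \<open>U\<close>; existence in
  the universal property gives \<open>g\<close> in the other direction with g f the identity, and
  uniqueness shows that f g is the identity as well. So \<open>f\<close> is a basis, and the form,
  known on pure tensors, is known everywhere by bilinearity.\<close>

lemma tensor_space_has_gram:
  fixes U :: "('a, 'a list) ips"
  assumes V: "has_gram V A" and W: "has_gram W B" and bil: "bform U \<in> bilinear_maps R U U (self_module R)"
    and t: "is_tensor_space R V W U"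
  shows "has_gram U (kron A B)"
proof -
  obtain e where e: "gram_frame V A e" using V unfolding has_gram_def by blast
  obtain e' where e': "gram_frame W B e'" using W unfolding has_gram_def by blast
  obtain n where n: "A \<in> carrier_mat n n" using gram_frame_carrier[OF e] .
  obtain m where m: "B \<in> carrier_mat m m" using gram_frame_carrier[OF e'] .
  note E = gram_frameD[OF e n] and E' = gram_frameD[OF e' m]
  obtain t where tp: "is_tensor_product R V W U t" and
    tf: "\<And>v v' w w'. v \<in> carrier V \<Longrightarrow> v' \<in> carrier V \<Longrightarrow> w \<in> carrier W \<Longrightarrow> w' \<in> carrier W \<Longrightarrow>
      bform U (t v w) (t v' w') = bform V v v' \<otimes> bform W w w'"
    using t unfolding is_tensor_space_def by blast
  have U: "module R U" and tb: "t \<in> bilinear_maps R V W U"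
    and univ: "\<And>P b. module R (P :: ('a, 'a list) module) \<Longrightarrow> b \<in> bilinear_maps R V W P \<Longrightarrow>
      \<exists>g\<in>linear_maps R U P. \<forall>x\<in>carrier V. \<forall>y\<in>carrier W. g (t x y) = b x y"
    and uniq: "\<And>P b g g' z. module R (P :: ('a, 'a list) module) \<Longrightarrow> b \<in> bilinear_maps R V W P \<Longrightarrow>
      g \<in> linear_maps R U P \<Longrightarrow> g' \<in> linear_maps R U P \<Longrightarrow>
      \<forall>x\<in>carrier V. \<forall>y\<in>carrier W. g (t x y) = b x y \<and> g' (t x y) = b x y \<Longrightarrow> z \<in> carrier U \<Longrightarrow> g z = g' z"
    using tp unfolding is_tensor_product_def by blast+
  note bl = bilinear_vec_linear[OF E(1) E'(1) tb]
  define b where "b k = t (e (unit_vec n (k div m))) (e' (unit_vec m (k mod m)))" for k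
  have "b k \<in> carrier U" for k
    unfolding b_def by (rule vec_linearD(1)[OF bl(1)[OF unit_vec_carrier] unit_vec_carrier])
  then obtain f where f: "vec_linear (n * m) U f" "\<And>k. k < n * m \<Longrightarrow> f (unit_vec (n * m) k) = b k"
    using vec_linear_exists[OF U, of "n * m" b] by blast
  have fk: "f (kron_vec n m u v) = t (e u) (e' v)" if "u \<in> carrier_vec n" "v \<in> carrier_vec m" for u v
  proof (rule bilinear_ext[OF U kron_vec_linear[OF f(1)] bl _ that])
    fix k assume "k < n * m"
    then show "f (kron_vec n m (unit_vec n (k div m)) (unit_vec m (k mod m))) =
      t (e (unit_vec n (k div m))) (e' (unit_vec m (k mod m)))"
      using f(2) by (simp add: kron_vec_unit_vec b_def)
  qed
  let ?T = "list_module (n * m)"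
  let ?i = "inv_into (carrier_vec n) e" and ?i' = "inv_into (carrier_vec m) e'"
  let ?s = "\<lambda>x y. vec_list (kron_vec n m (?i x) (?i' y))"
  note lf = frame_list_module[of "n * m"]
  have "is_tensor_product R V W ?T ?s"
    by (rule frame_tensor_product[OF E(1) E'(1) module_list_module lf])
  then have sb: "?s \<in> bilinear_maps R V W ?T" unfolding is_tensor_product_def by blast
  obtain g where g: "g \<in> linear_maps R U ?T" "\<And>x y. x \<in> carrier V \<Longrightarrow> y \<in> carrier W \<Longrightarrow> g (t x y) = ?s x y"
    using univ[OF module_list_module sb] by blast
  have gf: "g (f w) = vec_list w" if w: "w \<in> carrier_vec (n * m)" for w
  proof (rule vec_linear_ext[OF module_list_module vec_linear_compose[OF f(1) g(1)] frameD(1)[OF lf] _ w])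
    fix k assume k: "k < n * m"
    note eu = vec_linearD(1)[OF frameD(1)[OF E(1)] unit_vec_carrier] vec_linearD(1)[OF frameD(1)[OF E'(1)] unit_vec_carrier]
    show "g (f (unit_vec (n * m) k)) = vec_list (unit_vec (n * m) k)"
      unfolding f(2)[OF k] b_def g(2)[OF eu] frame_inv(1)[OF E(1) unit_vec_carrier]
        frame_inv(1)[OF E'(1) unit_vec_carrier] kron_vec_unit_vec[OF k] ..
  qed
  define P :: "('a, 'a list) module" where "P = module.truncate U"
  have P: "module R P" by (rule module_cong[OF U]) (simp_all add: P_def module.truncate_def)
  have lP: "linear_maps R U P = linear_maps R U U"
    unfolding linear_maps_def by (simp add: P_def module.truncate_def)
  have tP: "t \<in> bilinear_maps R V W P"
    using tb unfolding bilinear_maps_def linear_maps_def by (simp add: P_def module.truncate_def)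
  have fP: "vec_linear (n * m) P f"
    using f(1) unfolding vec_linear_def by (simp add: P_def module.truncate_def)
  have inj: "inj_on f (carrier_vec (n * m))"
  proof (rule inj_on_inverseI)
    show "list_coord (g (f w)) = w" if "w \<in> carrier_vec (n * m)" for w using gf[OF that] by simp
  qed
  let ?j = "inv_into (carrier_vec (n * m)) vec_list"
  have fg: "f (?j (g z)) = z" if z: "z \<in> carrier U" for z
  \<comment> \<open>Both maps are linear and agree with \<open>t\<close> on pure tensors, so the
    uniqueness clause applies with \<open>t\<close> itself as the bilinear map.\<close>
  proof (rule uniq[of P t "\<lambda>z. f (?j (g z))" "\<lambda>z. z" z, OF P tP _ _ _ z])
    have fj: "(\<lambda>x. f (?j x)) \<in> linear_maps R ?T P" by (rule frame_linear[OF lf fP])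
    show "(\<lambda>z. f (?j (g z))) \<in> linear_maps R U P"
      using fj g(1) unfolding linear_maps_def by (auto simp: Pi_iff)
    show "(\<lambda>z. z) \<in> linear_maps R U P" unfolding lP by (simp add: linear_maps_def)
    show "\<forall>x\<in>carrier V. \<forall>y\<in>carrier W. f (?j (g (t x y))) = t x y \<and> t x y = t x y"
    proof (intro ballI conjI refl)
      fix x y assume x: "x \<in> carrier V" and y: "y \<in> carrier W"
      note i = frame_inv(2,3)[OF E(1) x] frame_inv(2,3)[OF E'(1) y]
      show "f (?j (g (t x y))) = t x y"
        unfolding g(2)[OF x y] frame_inv(1)[OF lf kron_vec_carrier] fk[OF i(1,3)] i(2,4) ..
    qed
  qed
  have "f ` carrier_vec (n * m) = carrier U"
  proof (rule subset_antisym)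
    show "f ` carrier_vec (n * m) \<subseteq> carrier U" using vec_linearD(1)[OF f(1)] by blast
    show "carrier U \<subseteq> f ` carrier_vec (n * m)"
    proof
      fix z assume z: "z \<in> carrier U"
      have "g z \<in> carrier ?T" using g(1) z unfolding linear_maps_def by auto
      then have "?j (g z) \<in> carrier_vec (n * m)" by (rule frame_inv(2)[OF lf])
      then show "z \<in> f ` carrier_vec (n * m)" using fg[OF z] by (metis imageI)
    qed
  qed
  then have fr: "frame (n * m) U f" using f(1) inj unfolding frame_def bij_betw_def by blast
  have Ub: "(\<lambda>x. bform U x z) \<in> linear_maps R U (self_module R)" "bform U z \<in> linear_maps R U (self_module R)"
    if "z \<in> carrier U" for z using bil that unfolding bilinear_maps_def by blast+
  note K = kron_carrier[OF n m]
  have eu: "e u \<in> carrier V" if "u \<in> carrier_vec n" for u by (rule vec_linearD(1)[OF frameD(1)[OF E(1)] that])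
  have eu': "e' u \<in> carrier W" if "u \<in> carrier_vec m" for u by (rule vec_linearD(1)[OF frameD(1)[OF E'(1)] that])
  have basic: "bform U (f (kron_vec n m u v)) (f (kron_vec n m u' v')) =
    \<psi> (kron_vec n m u v \<bullet> (kron A B *\<^sub>v kron_vec n m u' v'))"
    if u: "u \<in> carrier_vec n" "u' \<in> carrier_vec n" and v: "v \<in> carrier_vec m" "v' \<in> carrier_vec m" for u u' v v'
  proof -
    have c: "A *\<^sub>v u' \<in> carrier_vec n" "B *\<^sub>v v' \<in> carrier_vec m" using n m u v by simp_all
    show ?thesis
      unfolding fk[OF u(1) v(1)] fk[OF u(2) v(2)] tf[OF eu[OF u(1)] eu[OF u(2)] eu'[OF v(1)] eu'[OF v(2)]]
        kron_mult_kron_vec[OF n m u(2) v(2)] kron_vec_scalar_prod[OF c] E(2)[OF u] E'(2)[OF v]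
      by (rule psi_mult[symmetric])
  qed
  have units: "bform U (f (unit_vec (n * m) k)) (f (unit_vec (n * m) l)) =
    \<psi> (unit_vec (n * m) k \<bullet> (kron A B *\<^sub>v unit_vec (n * m) l))" if k: "k < n * m" and l: "l < n * m" for k l
    using basic[OF unit_vec_carrier unit_vec_carrier unit_vec_carrier unit_vec_carrier, of "k div m" "k mod m" "l div m" "l mod m"]
    unfolding kron_vec_unit_vec[OF k] kron_vec_unit_vec[OF l] .
  have fc: "f w \<in> carrier U" if "w \<in> carrier_vec (n * m)" for w by (rule vec_linearD(1)[OF f(1) that])
  have left: "bform U (f (unit_vec (n * m) k)) (f w) = \<psi> (unit_vec (n * m) k \<bullet> (kron A B *\<^sub>v w))"
    if k: "k < n * m" and w: "w \<in> carrier_vec (n * m)" for k w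
    by (rule vec_linear_ext[OF module_self vec_linear_compose[OF f(1) Ub(2)[OF fc[OF unit_vec_carrier]]]
          vec_linear_mat[OF scalar_prod_vec_linear[OF unit_vec_carrier] K] units[OF k] w])
  have "bform U (f z) (f w) = \<psi> (z \<bullet> (kron A B *\<^sub>v w))"
    if z: "z \<in> carrier_vec (n * m)" and w: "w \<in> carrier_vec (n * m)" for z w
  proof -
    have Kw: "kron A B *\<^sub>v w \<in> carrier_vec (n * m)" using K w by simp
    have "bform U (f z) (f w) = \<psi> ((kron A B *\<^sub>v w) \<bullet> z)"
    proof (rule vec_linear_ext[OF module_self vec_linear_compose[OF f(1) Ub(1)[OF fc[OF w]]] scalar_prod_vec_linear[OF Kw] _ z])
      fix k assume k: "k < n * m"
      show "bform U (f (unit_vec (n * m) k)) (f w) = \<psi> ((kron A B *\<^sub>v w) \<bullet> unit_vec (n * m) k)"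
        unfolding left[OF k w] comm_scalar_prod[OF unit_vec_carrier Kw] ..
    qed
    then show ?thesis unfolding comm_scalar_prod[OF z Kw] .
  qed
  then have "gram_frame U (kron A B) f" by (rule gram_frameI[OF K fr])
  then show ?thesis unfolding has_gram_def by blast
qed

end

section \<open>The Grothendieck-Witt ring\<close>

text \<open>If an additive and multiplicative map \<open>\<phi>\<close> from \<open>S\<close> to a ring \<open>D\<close> identifies exactly the
  stably equal elements and its image generates \<open>D\<close>, then the Grothendieck ring of \<open>S\<close> is \<open>D\<close>. No
  semiring law of \<open>S\<close> has to be checked, since all of them hold in \<open>D\<close>.\<close>

locale grothendieck_model = D: cring D
  for D :: "('d, 'n) ring_scheme" and S :: "('s, 'm) ring_scheme" and \<phi> :: "'s \<Rightarrow> 'd" +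
  assumes phi_closed: "a \<in> carrier S \<Longrightarrow> \<phi> a \<in> carrier D"
    and phi_add: "a \<in> carrier S \<Longrightarrow> b \<in> carrier S \<Longrightarrow> a \<oplus>\<^bsub>S\<^esub> b \<in> carrier S \<and> \<phi> (a \<oplus>\<^bsub>S\<^esub> b) = \<phi> a \<oplus>\<^bsub>D\<^esub> \<phi> b"
    and phi_mult: "a \<in> carrier S \<Longrightarrow> b \<in> carrier S \<Longrightarrow> a \<otimes>\<^bsub>S\<^esub> b \<in> carrier S \<and> \<phi> (a \<otimes>\<^bsub>S\<^esub> b) = \<phi> a \<otimes>\<^bsub>D\<^esub> \<phi> b"
    and phi_zero: "\<zero>\<^bsub>S\<^esub> \<in> carrier S" "\<phi> \<zero>\<^bsub>S\<^esub> = \<zero>\<^bsub>D\<^esub>"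
    and phi_one: "\<one>\<^bsub>S\<^esub> \<in> carrier S" "\<phi> \<one>\<^bsub>S\<^esub> = \<one>\<^bsub>D\<^esub>"
    and phi_eq: "a \<in> carrier S \<Longrightarrow> b \<in> carrier S \<Longrightarrow>
      \<phi> a = \<phi> b \<longleftrightarrow> (\<exists>e\<in>carrier S. a \<oplus>\<^bsub>S\<^esub> e = b \<oplus>\<^bsub>S\<^esub> e)"
    and phi_generates: "x \<in> carrier D \<Longrightarrow> \<exists>a\<in>carrier S. \<exists>b\<in>carrier S. x = \<phi> a \<ominus>\<^bsub>D\<^esub> \<phi> b"
begin

text \<open>The equivalence classes of formal differences turn out to be the level sets of their
  value in \<open>D\<close> (\<open>groth_class_eq_fibre\<close>), which makes independence of
  representatives automatic.\<close>

definition fibre :: "'d \<Rightarrow> ('s \<times> 's) set" where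
  "fibre x = {(a, b). a \<in> carrier S \<and> b \<in> carrier S \<and> \<phi> a \<ominus>\<^bsub>D\<^esub> \<phi> b = x}"

lemma diff_eq_iff:
  assumes "x \<in> carrier D" "y \<in> carrier D" "z \<in> carrier D" "w \<in> carrier D"
  shows "x \<ominus>\<^bsub>D\<^esub> y = z \<ominus>\<^bsub>D\<^esub> w \<longleftrightarrow> x \<oplus>\<^bsub>D\<^esub> w = z \<oplus>\<^bsub>D\<^esub> y"
proof
  assume "x \<ominus>\<^bsub>D\<^esub> y = z \<ominus>\<^bsub>D\<^esub> w"
  then have "(x \<ominus>\<^bsub>D\<^esub> y) \<oplus>\<^bsub>D\<^esub> (y \<oplus>\<^bsub>D\<^esub> w) = (z \<ominus>\<^bsub>D\<^esub> w) \<oplus>\<^bsub>D\<^esub> (w \<oplus>\<^bsub>D\<^esub> y)"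
    using assms by (simp add: D.a_comm)
  moreover have "(x \<ominus>\<^bsub>D\<^esub> y) \<oplus>\<^bsub>D\<^esub> (y \<oplus>\<^bsub>D\<^esub> w) = x \<oplus>\<^bsub>D\<^esub> w" "(z \<ominus>\<^bsub>D\<^esub> w) \<oplus>\<^bsub>D\<^esub> (w \<oplus>\<^bsub>D\<^esub> y) = z \<oplus>\<^bsub>D\<^esub> y"
    using assms by algebra+
  ultimately show "x \<oplus>\<^bsub>D\<^esub> w = z \<oplus>\<^bsub>D\<^esub> y" by simp
next
  assume eq: "x \<oplus>\<^bsub>D\<^esub> w = z \<oplus>\<^bsub>D\<^esub> y"
  have "x \<ominus>\<^bsub>D\<^esub> y = (x \<oplus>\<^bsub>D\<^esub> w) \<ominus>\<^bsub>D\<^esub> (y \<oplus>\<^bsub>D\<^esub> w)" using assms by algebra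
  also have "\<dots> = z \<ominus>\<^bsub>D\<^esub> w" unfolding eq using assms by algebra
  finally show "x \<ominus>\<^bsub>D\<^esub> y = z \<ominus>\<^bsub>D\<^esub> w" .
qed

lemma groth_class_eq_fibre:
  assumes a: "a \<in> carrier S" and b: "b \<in> carrier S"
  shows "groth_class S a b = fibre (\<phi> a \<ominus>\<^bsub>D\<^esub> \<phi> b)"
proof -
  have "((a, b), (c, d)) \<in> groth_rel S \<longleftrightarrow> c \<in> carrier S \<and> d \<in> carrier S \<and> \<phi> c \<ominus>\<^bsub>D\<^esub> \<phi> d = \<phi> a \<ominus>\<^bsub>D\<^esub> \<phi> b" for c d
  proof (cases "c \<in> carrier S \<and> d \<in> carrier S")
    case True
    then have c: "c \<in> carrier S" and d: "d \<in> carrier S" by auto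
    have "((a, b), (c, d)) \<in> groth_rel S \<longleftrightarrow> \<phi> (a \<oplus>\<^bsub>S\<^esub> d) = \<phi> (c \<oplus>\<^bsub>S\<^esub> b)"
      using a b c d phi_add[OF a d] phi_add[OF c b] phi_eq[of "a \<oplus>\<^bsub>S\<^esub> d" "c \<oplus>\<^bsub>S\<^esub> b"]
      unfolding groth_rel_def by blast
    also have "\<dots> \<longleftrightarrow> \<phi> a \<ominus>\<^bsub>D\<^esub> \<phi> b = \<phi> c \<ominus>\<^bsub>D\<^esub> \<phi> d"
      using phi_add[OF a d] phi_add[OF c b] phi_closed a b c d by (simp add: diff_eq_iff)
    finally show ?thesis using c d by auto
  qed (auto simp: groth_rel_def)
  then show ?thesis unfolding groth_class_def fibre_def by auto
qed

lemma fibre_inject: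
  assumes "x \<in> carrier D" "fibre x = fibre y" shows "x = y"
proof -
  obtain a b where "a \<in> carrier S" "b \<in> carrier S" "x = \<phi> a \<ominus>\<^bsub>D\<^esub> \<phi> b" using phi_generates[OF assms(1)] by blast
  then have "(a, b) \<in> fibre y" unfolding assms(2)[symmetric] by (simp add: fibre_def)
  then show ?thesis using \<open>x = _\<close> by (simp add: fibre_def)
qed

lemma fibre_carrier: "carrier (grothendieck_ring S) = fibre ` carrier D"
proof -
  have "carrier (grothendieck_ring S) = (\<lambda>(a, b). groth_class S a b) ` (carrier S \<times> carrier S)"
    unfolding grothendieck_ring_def quotient_def groth_class_def by auto
  also have "\<dots> = fibre ` carrier D"
  proof (intro subset_antisym subsetI)
    fix Y assume "Y \<in> (\<lambda>(a, b). groth_class S a b) ` (carrier S \<times> carrier S)"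
    then obtain a b where "a \<in> carrier S" "b \<in> carrier S" "Y = groth_class S a b" by auto
    then show "Y \<in> fibre ` carrier D" using groth_class_eq_fibre phi_closed by simp
  next
    fix Y assume "Y \<in> fibre ` carrier D"
    then obtain x where x: "x \<in> carrier D" "Y = fibre x" by blast
    obtain a b where "a \<in> carrier S" "b \<in> carrier S" "x = \<phi> a \<ominus>\<^bsub>D\<^esub> \<phi> b" using phi_generates[OF x(1)] by blast
    then show "Y \<in> (\<lambda>(a, b). groth_class S a b) ` (carrier S \<times> carrier S)"
      using x(2) groth_class_eq_fibre by (intro image_eqI[of _ _ "(a, b)"]) auto
  qed
  finally show ?thesis .
qed

lemma fibre_add:
  assumes x: "x \<in> carrier D" and y: "y \<in> carrier D"
  shows "fibre x \<oplus>\<^bsub>grothendieck_ring S\<^esub> fibre y = fibre (x \<oplus>\<^bsub>D\<^esub> y)"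
proof -
  have "groth_class S (a \<oplus>\<^bsub>S\<^esub> c) (b \<oplus>\<^bsub>S\<^esub> d) = fibre (x \<oplus>\<^bsub>D\<^esub> y)"
    if ab: "(a, b) \<in> fibre x" and cd: "(c, d) \<in> fibre y" for a b c d
  proof -
    have m: "a \<in> carrier S" "b \<in> carrier S" "c \<in> carrier S" "d \<in> carrier S"
      and eq: "x = \<phi> a \<ominus>\<^bsub>D\<^esub> \<phi> b" "y = \<phi> c \<ominus>\<^bsub>D\<^esub> \<phi> d" using ab cd by (auto simp: fibre_def)
    have p: "\<phi> a \<in> carrier D" "\<phi> b \<in> carrier D" "\<phi> c \<in> carrier D" "\<phi> d \<in> carrier D" using m phi_closed by auto
    have "(\<phi> a \<oplus>\<^bsub>D\<^esub> \<phi> c) \<ominus>\<^bsub>D\<^esub> (\<phi> b \<oplus>\<^bsub>D\<^esub> \<phi> d) = (\<phi> a \<ominus>\<^bsub>D\<^esub> \<phi> b) \<oplus>\<^bsub>D\<^esub> (\<phi> c \<ominus>\<^bsub>D\<^esub> \<phi> d)"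
      using p by algebra
    then show ?thesis
      unfolding eq using groth_class_eq_fibre phi_add m by simp
  qed
  \<comment> \<open>All classes in the defining union coincide; since both fibres are inhabited, the
    union is that one class and not empty.\<close>
  moreover obtain a b where "(a, b) \<in> fibre x" using phi_generates[OF x] unfolding fibre_def by blast
  moreover obtain c d where "(c, d) \<in> fibre y" using phi_generates[OF y] unfolding fibre_def by blast
  ultimately have "{groth_class S (a \<oplus>\<^bsub>S\<^esub> c) (b \<oplus>\<^bsub>S\<^esub> d) | a b c d. (a, b) \<in> fibre x \<and> (c, d) \<in> fibre y} =
    {fibre (x \<oplus>\<^bsub>D\<^esub> y)}"
    by (auto, metis)
  then show ?thesis unfolding grothendieck_ring_def by simp
qed

lemma fibre_mult:
  assumes x: "x \<in> carrier D" and y: "y \<in> carrier D"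
  shows "fibre x \<otimes>\<^bsub>grothendieck_ring S\<^esub> fibre y = fibre (x \<otimes>\<^bsub>D\<^esub> y)"
proof -
  have "groth_class S ((a \<otimes>\<^bsub>S\<^esub> c) \<oplus>\<^bsub>S\<^esub> (b \<otimes>\<^bsub>S\<^esub> d)) ((a \<otimes>\<^bsub>S\<^esub> d) \<oplus>\<^bsub>S\<^esub> (b \<otimes>\<^bsub>S\<^esub> c)) = fibre (x \<otimes>\<^bsub>D\<^esub> y)"
    if ab: "(a, b) \<in> fibre x" and cd: "(c, d) \<in> fibre y" for a b c d
  proof -
    have m: "a \<in> carrier S" "b \<in> carrier S" "c \<in> carrier S" "d \<in> carrier S"
      and eq: "x = \<phi> a \<ominus>\<^bsub>D\<^esub> \<phi> b" "y = \<phi> c \<ominus>\<^bsub>D\<^esub> \<phi> d" using ab cd by (auto simp: fibre_def)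
    have p: "\<phi> a \<in> carrier D" "\<phi> b \<in> carrier D" "\<phi> c \<in> carrier D" "\<phi> d \<in> carrier D" using m phi_closed by auto
    have "((\<phi> a \<otimes>\<^bsub>D\<^esub> \<phi> c) \<oplus>\<^bsub>D\<^esub> (\<phi> b \<otimes>\<^bsub>D\<^esub> \<phi> d)) \<ominus>\<^bsub>D\<^esub> ((\<phi> a \<otimes>\<^bsub>D\<^esub> \<phi> d) \<oplus>\<^bsub>D\<^esub> (\<phi> b \<otimes>\<^bsub>D\<^esub> \<phi> c)) =
      (\<phi> a \<ominus>\<^bsub>D\<^esub> \<phi> b) \<otimes>\<^bsub>D\<^esub> (\<phi> c \<ominus>\<^bsub>D\<^esub> \<phi> d)"
      using p by algebra
    then show ?thesis
      unfolding eq using groth_class_eq_fibre phi_add phi_mult m by simp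
  qed
  moreover obtain a b where "(a, b) \<in> fibre x" using phi_generates[OF x] unfolding fibre_def by blast
  moreover obtain c d where "(c, d) \<in> fibre y" using phi_generates[OF y] unfolding fibre_def by blast
  ultimately have "{groth_class S ((a \<otimes>\<^bsub>S\<^esub> c) \<oplus>\<^bsub>S\<^esub> (b \<otimes>\<^bsub>S\<^esub> d)) ((a \<otimes>\<^bsub>S\<^esub> d) \<oplus>\<^bsub>S\<^esub> (b \<otimes>\<^bsub>S\<^esub> c))
      | a b c d. (a, b) \<in> fibre x \<and> (c, d) \<in> fibre y} = {fibre (x \<otimes>\<^bsub>D\<^esub> y)}"
    by (auto, metis)
  then show ?thesis unfolding grothendieck_ring_def by simp
qed

lemma fibre_iso: "fibre \<in> ring_iso D (grothendieck_ring S)"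
proof -
  have "fibre \<one>\<^bsub>D\<^esub> = \<one>\<^bsub>grothendieck_ring S\<^esub>"
    using groth_class_eq_fibre[OF phi_one(1) phi_zero(1)]
    by (simp add: grothendieck_ring_def phi_one phi_zero a_minus_def)
  moreover have "inj_on fibre (carrier D)" by (rule inj_onI) (rule fibre_inject)
  ultimately show ?thesis
    unfolding ring_iso_def bij_betw_def using fibre_carrier
    by (auto intro!: ring_hom_memI simp: fibre_add fibre_mult)
qed

lemma fibre_zero: "fibre \<zero>\<^bsub>D\<^esub> = \<zero>\<^bsub>grothendieck_ring S\<^esub>"
  using groth_class_eq_fibre[OF phi_zero(1) phi_zero(1)]
  by (simp add: grothendieck_ring_def phi_zero a_minus_def)

lemma cring_grothendieck: "cring (grothendieck_ring S)"
  using D.ring_iso_imp_img_cring[OF fibre_iso] unfolding fibre_zero by simp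

end

text \<open>Rank together with discriminant, the latter forming an ideal of square zero. The product
  rule reflects that, up to squares, det(A tensor B) is det(A)^m det(B)^n for forms of ranks n and
  m.\<close>

definition disc_ring :: "(int \<times> int \<times> int) ring" where
  "disc_ring = \<lparr>carrier = UNIV \<times> {0..<2} \<times> {0..<2},
    monoid.mult = (\<lambda>(n, s, t) (m, s', t'). (n * m, (m * s + n * s') mod 2, (m * t + n * t') mod 2)),
    one = (1, 0, 0), ring.zero = (0, 0, 0),
    add = (\<lambda>(n, s, t) (m, s', t'). (n + m, (s + s') mod 2, (t + t') mod 2))\<rparr>"

lemma disc_ring_simps:
  "\<zero>\<^bsub>disc_ring\<^esub> = (0, 0, 0)" "\<one>\<^bsub>disc_ring\<^esub> = (1, 0, 0)"
  "(n, s, t) \<oplus>\<^bsub>disc_ring\<^esub> (m, s', t') = (n + m, (s + s') mod 2, (t + t') mod 2)"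
  by (simp_all add: disc_ring_def)

lemma mod_add_mult_mod:
  "(a + f * (g mod m)) mod m = (a + f * g) mod (m :: int)" "(f * (g mod m) + a) mod m = (f * g + a) mod m"
  by (metis mod_add_right_eq mod_mult_right_eq, metis mod_add_left_eq mod_mult_right_eq)

lemma cring_disc_ring: "cring disc_ring"
proof (rule cringI)
  show "abelian_group disc_ring"
  proof (rule abelian_groupI)
    fix x assume "x \<in> carrier disc_ring"
    then obtain n s t where x: "x = (n, s, t)" "s \<in> {0..<2}" "t \<in> {0..<2}" by (auto simp: disc_ring_def)
    have "(- n, (- s) mod 2, (- t) mod 2) \<in> carrier disc_ring" by (simp add: disc_ring_def)
    moreover have "(- n, (- s) mod 2, (- t) mod 2) \<oplus>\<^bsub>disc_ring\<^esub> x = \<zero>\<^bsub>disc_ring\<^esub>"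
      using x by (simp add: disc_ring_def mod_simps)
    ultimately show "\<exists>y\<in>carrier disc_ring. y \<oplus>\<^bsub>disc_ring\<^esub> x = \<zero>\<^bsub>disc_ring\<^esub>" by blast
  qed (auto simp: disc_ring_def mod_simps add.commute add.left_commute)
  show "comm_monoid disc_ring"
  proof (rule comm_monoidI)
    fix x y z
    show "x \<otimes>\<^bsub>disc_ring\<^esub> y \<otimes>\<^bsub>disc_ring\<^esub> z = x \<otimes>\<^bsub>disc_ring\<^esub> (y \<otimes>\<^bsub>disc_ring\<^esub> z)"
      by (simp add: disc_ring_def split_beta mod_simps mod_add_mult_mod) (simp add: algebra_simps mod_add_mult_mod)
    show "x \<otimes>\<^bsub>disc_ring\<^esub> y = y \<otimes>\<^bsub>disc_ring\<^esub> x"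
      by (simp add: disc_ring_def split_beta add.commute mult.commute)
  qed (auto simp: disc_ring_def)
  fix x y z
  show "(x \<oplus>\<^bsub>disc_ring\<^esub> y) \<otimes>\<^bsub>disc_ring\<^esub> z = x \<otimes>\<^bsub>disc_ring\<^esub> z \<oplus>\<^bsub>disc_ring\<^esub> y \<otimes>\<^bsub>disc_ring\<^esub> z"
    by (simp add: disc_ring_def split_beta mod_simps mod_add_mult_mod) (simp add: algebra_simps mod_add_mult_mod)
qed

lemma disc_power:
  assumes "c0 a"
  shows "disc1 (a ^ n) = (int n * disc1 a) mod 2" "disc2 (a ^ n) = (int n * disc2 a) mod 2" "c0 (a ^ n)"
proof -
  have "disc1 (a ^ n) = (int n * disc1 a) mod 2 \<and> disc2 (a ^ n) = (int n * disc2 a) mod 2 \<and> c0 (a ^ n)"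
  proof (induction n)
    case 0
    then show ?case by (simp add: disc_one) (simp add: one_trunc_def)
  next
    case (Suc n)
    then show ?case
      using disc_mult[OF assms, of "a ^ n"] assms
      by (auto simp: mod_simps algebra_simps times_trunc_def[of a])
  qed
  then show "disc1 (a ^ n) = (int n * disc1 a) mod 2" "disc2 (a ^ n) = (int n * disc2 a) mod 2" "c0 (a ^ n)" by auto
qed

definition gram_invariant :: "trunc mat \<Rightarrow> int \<times> int \<times> int" where
  "gram_invariant A = (int (dim_row A), disc1 (det A), disc2 (det A))"

lemma disc_range: "disc1 p \<in> {0..<2}" "disc2 p \<in> {0..<2}"
  by (simp_all add: disc1_def disc2_def)

lemma gram_invariant_carrier: "gram_invariant A \<in> carrier disc_ring"
  using disc_range by (simp add: gram_invariant_def disc_ring_def)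

lemma gram_invariant_block_sum:
  assumes A: "unimodular A" and B: "unimodular B"
  shows "gram_invariant (block_sum A B) = gram_invariant A \<oplus>\<^bsub>disc_ring\<^esub> gram_invariant B"
  using disc_mult unimodularD(2)[OF A] unimodularD(2)[OF B] det_block_sum[OF unimodular_carrier[OF A] unimodular_carrier[OF B]]
  unfolding trunc_unit_iff by (simp add: gram_invariant_def disc_ring_def)

lemma gram_invariant_kron:
  assumes A: "unimodular A" and B: "unimodular B"
  shows "gram_invariant (kron A B) = gram_invariant A \<otimes>\<^bsub>disc_ring\<^esub> gram_invariant B"
proof -
  have u: "c0 (det A)" "c0 (det B)" using unimodularD(2)[OF A] unimodularD(2)[OF B] unfolding trunc_unit_iff .
  obtain s where s: "s dvd 1" "det (kron A B) = det A ^ dim_row B * det B ^ dim_row A * (s * s)"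
    using det_kron[OF unimodular_carrier[OF A] unimodular_carrier[OF B]] by blast
  note p = disc_power[OF u(1), of "dim_row B"] disc_power[OF u(2), of "dim_row A"]
  have c: "c0 (det A ^ dim_row B * det B ^ dim_row A)" using p(3,6) unfolding times_trunc_def trunc.sel by blast
  show ?thesis
    unfolding gram_invariant_def s(2) disc_times_square(1,2)[OF c s(1)] disc_mult[OF p(3,6)] p(1,2,4,5)
    by (simp add: disc_ring_def mod_simps)
qed

locale trunc_coordinate = coordinate_ring R \<psi>
  for R :: "('a, 'm) ring_scheme" (structure) and \<psi> :: "trunc \<Rightarrow> 'a"
begin

definition gram_class :: "trunc mat \<Rightarrow> ('a, 'a list) ips set" where
  "gram_class A = {U. inner_product_space R U \<and> has_gram U A}"

lemma ips_module: "inner_product_space R V \<Longrightarrow> module R V"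
  unfolding inner_product_space_def by blast

text \<open>\<open>V\<close> may have elements of any type. This covers the zero space and the rank
  one spaces, which do not lie in the universe of lists.\<close>

lemma isometry_class_gram:
  assumes "has_gram V A" shows "isometry_class R V = gram_class A"
  unfolding isometry_class_def gram_class_def
  using isometric_has_gram[OF ips_module _ assms] has_gram_isometric[OF _ assms] by blast

lemma list_space_gram_class:
  assumes "unimodular A" shows "list_space (dim_row A) A \<in> gram_class A"
proof -
  have g: "has_gram (list_space (dim_row A) A) A" by (rule has_gram_list_space[OF unimodular_carrier[OF assms]])
  then obtain e where "gram_frame (list_space (dim_row A) A) A e" unfolding has_gram_def by blast
  from gram_inner_product_space[OF module_list_space assms this] show ?thesis
    using g unfolding gram_class_def by blast
qed

lemma gram_class_eq_iff:
  assumes A: "unimodular A" and B: "unimodular B"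
  shows "gram_class A = gram_class B \<longleftrightarrow> mat_congruent A B"
proof
  assume "gram_class A = gram_class B"
  then have "list_space (dim_row A) A \<in> gram_class A \<inter> gram_class B" using list_space_gram_class[OF A] by blast
  then show "mat_congruent A B"
    using has_gram_unique[OF ips_module _ A] unfolding gram_class_def by blast
next
  assume "mat_congruent A B"
  then show "gram_class A = gram_class B"
    using has_gram_congruent mat_congruent_sym unfolding gram_class_def by blast
qed

lemma isometry_classes_carrier: "carrier (isometry_classes R) = gram_class ` {A. unimodular A}"
proof -
  have "isometry_class R ` {V :: ('a, 'a list) ips. inner_product_space R V} = gram_class ` {A. unimodular A}"
  proof (intro subset_antisym subsetI)
    fix Y assume "Y \<in> isometry_class R ` {V :: ('a, 'a list) ips. inner_product_space R V}"
    then obtain V :: "('a, 'a list) ips" where V: "inner_product_space R V" "Y = isometry_class R V" by blast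
    obtain A where "unimodular A" "has_gram V A"
      using ips_has_gram[OF trunc_x_dvd trunc_x_nilpotent V(1)] by blast
    then show "Y \<in> gram_class ` {A. unimodular A}" using V(2) isometry_class_gram by blast
  next
    fix Y assume "Y \<in> gram_class ` {A. unimodular A}"
    then obtain A where A: "unimodular A" "Y = gram_class A" by blast
    have "list_space (dim_row A) A \<in> gram_class A" by (rule list_space_gram_class[OF A(1)])
    then have "inner_product_space R (list_space (dim_row A) A)" "has_gram (list_space (dim_row A) A) A"
      unfolding gram_class_def by blast+
    then show "Y \<in> isometry_class R ` {V :: ('a, 'a list) ips. inner_product_space R V}"
      using A(2) isometry_class_gram by blast
  qed
  then show ?thesis by (simp add: isometry_classes_def)
qed

lemma isometry_classes_add:
  assumes A: "unimodular A" and B: "unimodular B"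
  shows "gram_class A \<oplus>\<^bsub>isometry_classes R\<^esub> gram_class B = gram_class (block_sum A B)"
proof -
  have "(\<exists>V\<in>gram_class A. \<exists>W\<in>gram_class B. isometric R U (orthogonal_sum R V W)) \<longleftrightarrow> has_gram U (block_sum A B)"
    if U: "inner_product_space R U" for U :: "('a, 'a list) ips"
  proof
    assume "\<exists>V\<in>gram_class A. \<exists>W\<in>gram_class B. isometric R U (orthogonal_sum R V W)"
    then obtain V W :: "('a, 'a list) ips" where "has_gram V A" "has_gram W B" "isometric R U (orthogonal_sum R V W)"
      unfolding gram_class_def by blast
    then show "has_gram U (block_sum A B)"
      using isometric_has_gram[OF ips_module[OF U]] has_gram_orthogonal_sum by blast
  next
    assume g: "has_gram U (block_sum A B)"
    have "list_space (dim_row A) A \<in> gram_class A" "list_space (dim_row B) B \<in> gram_class B"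
      using list_space_gram_class A B by blast+
    moreover from this have "has_gram (orthogonal_sum R (list_space (dim_row A) A) (list_space (dim_row B) B)) (block_sum A B)"
      using has_gram_orthogonal_sum unfolding gram_class_def by blast
    ultimately show "\<exists>V\<in>gram_class A. \<exists>W\<in>gram_class B. isometric R U (orthogonal_sum R V W)"
      using has_gram_isometric[OF g] by blast
  qed
  then show ?thesis unfolding isometry_classes_def gram_class_def[of "block_sum A B"] by auto
qed

lemma isometry_classes_mult:
  assumes A: "unimodular A" and B: "unimodular B"
  shows "gram_class A \<otimes>\<^bsub>isometry_classes R\<^esub> gram_class B = gram_class (kron A B)"
proof -
  have "(\<exists>V\<in>gram_class A. \<exists>W\<in>gram_class B. is_tensor_space R V W U) \<longleftrightarrow> has_gram U (kron A B)"
    if U: "inner_product_space R U" for U :: "('a, 'a list) ips"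
  proof
    assume "\<exists>V\<in>gram_class A. \<exists>W\<in>gram_class B. is_tensor_space R V W U"
    then obtain V W :: "('a, 'a list) ips" where "has_gram V A" "has_gram W B" "is_tensor_space R V W U"
      unfolding gram_class_def by blast
    moreover have "bform U \<in> bilinear_maps R U U (self_module R)"
      using U unfolding inner_product_space_def by blast
    ultimately show "has_gram U (kron A B)" using tensor_space_has_gram by blast
  next
    assume g: "has_gram U (kron A B)"
    have "list_space (dim_row A) A \<in> gram_class A" "list_space (dim_row B) B \<in> gram_class B"
      using list_space_gram_class A B by blast+
    then show "\<exists>V\<in>gram_class A. \<exists>W\<in>gram_class B. is_tensor_space R V W U"
      using has_gram_tensor_space[OF _ _ ips_module[OF U] g] unfolding gram_class_def by blast
  qed
  then show ?thesis unfolding isometry_classes_def gram_class_def[of "kron A B"] by auto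
qed

lemma isometry_classes_zero: "\<zero>\<^bsub>isometry_classes R\<^esub> = gram_class (1\<^sub>m 0)"
  using isometry_class_gram[OF has_gram_zero_space] by (simp add: isometry_classes_def)

lemma isometry_classes_one: "\<one>\<^bsub>isometry_classes R\<^esub> = gram_class (scal 1)"
  using isometry_class_gram[OF has_gram_rank_one[of 1]] unfolding psi_one by (simp add: isometry_classes_def)

definition class_invariant :: "('a, 'a list) ips set \<Rightarrow> int \<times> int \<times> int" where
  "class_invariant Y = gram_invariant (SOME A. unimodular A \<and> Y = gram_class A)"

lemma class_invariant_gram_class:
  assumes A: "unimodular A" shows "class_invariant (gram_class A) = gram_invariant A"
proof -
  define B where "B = (SOME B. unimodular B \<and> gram_class A = gram_class B)"
  have "unimodular B \<and> gram_class A = gram_class B"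
    unfolding B_def by (rule someI[of _ A]) (use A in blast)
  then have B: "unimodular B" "mat_congruent A B" using gram_class_eq_iff[OF A] by blast+
  obtain s where s: "s dvd 1" "det A = det B * (s * s)" using mat_congruent_det[OF B(2)] by blast
  have "c0 (det B)" using unimodularD(2)[OF B(1)] unfolding trunc_unit_iff .
  then have "gram_invariant B = gram_invariant A"
    unfolding gram_invariant_def s(2) mat_congruent_dim[OF B(2)] by (simp add: disc_times_square[OF _ s(1)])
  then show ?thesis unfolding class_invariant_def B_def .
qed

lemma gram_invariant_scal: "gram_invariant (scal a) = (1, disc1 a, disc2 a)"
  by (simp add: gram_invariant_def)

lemma gram_invariant_one: "gram_invariant (1\<^sub>m n) = (int n, 0, 0)"
  by (simp add: gram_invariant_def disc_one)

text \<open>The condition that equal invariants mean equality after adding a common class is the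
  stable classification, read through Gram matrices.\<close>

lemma grothendieck_model_isometry_classes:
  "grothendieck_model disc_ring (isometry_classes R) class_invariant"
proof (intro grothendieck_model.intro cring_disc_ring grothendieck_model_axioms.intro)
  let ?S = "isometry_classes R"
  have E: "\<exists>A. unimodular A \<and> a = gram_class A" if "a \<in> carrier ?S" for a
    using that unfolding isometry_classes_carrier by blast
  have I: "gram_class A \<in> carrier ?S" if "unimodular A" for A
    using that unfolding isometry_classes_carrier by blast
  have u1: "unimodular (scal 1 :: trunc mat)" using unimodular_scal[of "1 :: trunc"] by simp
  show "\<zero>\<^bsub>?S\<^esub> \<in> carrier ?S" "class_invariant \<zero>\<^bsub>?S\<^esub> = \<zero>\<^bsub>disc_ring\<^esub>"
    unfolding isometry_classes_zero class_invariant_gram_class[OF unimodular_one] gram_invariant_one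
    using I[OF unimodular_one] by (simp_all add: disc_ring_def)
  show "\<one>\<^bsub>?S\<^esub> \<in> carrier ?S" "class_invariant \<one>\<^bsub>?S\<^esub> = \<one>\<^bsub>disc_ring\<^esub>"
    unfolding isometry_classes_one class_invariant_gram_class[OF u1] gram_invariant_scal
    using I[OF u1] by (simp_all add: disc_ring_def disc_one)
  fix a assume "a \<in> carrier ?S"
  then obtain A where A: "unimodular A" "a = gram_class A" using E by blast
  show "class_invariant a \<in> carrier disc_ring"
    unfolding A(2) class_invariant_gram_class[OF A(1)] by (rule gram_invariant_carrier)
  fix b assume "b \<in> carrier ?S"
  then obtain B where B: "unimodular B" "b = gram_class B" using E by blast
  show "a \<oplus>\<^bsub>?S\<^esub> b \<in> carrier ?S \<and> class_invariant (a \<oplus>\<^bsub>?S\<^esub> b) = class_invariant a \<oplus>\<^bsub>disc_ring\<^esub> class_invariant b"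
    unfolding A(2) B(2) isometry_classes_add[OF A(1) B(1)] class_invariant_gram_class[OF A(1)]
      class_invariant_gram_class[OF B(1)] class_invariant_gram_class[OF unimodular_block_sum[OF A(1) B(1)]]
    using I[OF unimodular_block_sum[OF A(1) B(1)]] gram_invariant_block_sum[OF A(1) B(1)] by blast
  show "a \<otimes>\<^bsub>?S\<^esub> b \<in> carrier ?S \<and> class_invariant (a \<otimes>\<^bsub>?S\<^esub> b) = class_invariant a \<otimes>\<^bsub>disc_ring\<^esub> class_invariant b"
    unfolding A(2) B(2) isometry_classes_mult[OF A(1) B(1)] class_invariant_gram_class[OF A(1)]
      class_invariant_gram_class[OF B(1)] class_invariant_gram_class[OF unimodular_kron[OF A(1) B(1)]]
    using I[OF unimodular_kron[OF A(1) B(1)]] gram_invariant_kron[OF A(1) B(1)] by blast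
  have sq: "square_mat A" "square_mat B"
    using unimodularD(3)[OF A(1)] unimodularD(3)[OF B(1)] by simp_all
  have cong: "mat_congruent (block_sum A E) (block_sum B E) \<longleftrightarrow> a \<oplus>\<^bsub>?S\<^esub> gram_class E = b \<oplus>\<^bsub>?S\<^esub> gram_class E"
    if E: "unimodular E" for E
    unfolding A(2) B(2) isometry_classes_add[OF A(1) E] isometry_classes_add[OF B(1) E]
      gram_class_eq_iff[OF unimodular_block_sum[OF A(1) E] unimodular_block_sum[OF B(1) E]] ..
  have "class_invariant a = class_invariant b \<longleftrightarrow> stably_congruent A B"
    unfolding A(2) B(2) class_invariant_gram_class[OF A(1)] class_invariant_gram_class[OF B(1)]
      stably_congruent_iff[OF A(1) unimodular_carrier[OF A(1)] B(1) unimodular_carrier[OF B(1)]]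
    by (simp add: gram_invariant_def)
  also have "\<dots> \<longleftrightarrow> (\<exists>E. unimodular E \<and> mat_congruent (block_sum A E) (block_sum B E))"
    unfolding stably_congruent_def using sq by blast
  also have "\<dots> \<longleftrightarrow> (\<exists>E. unimodular E \<and> a \<oplus>\<^bsub>?S\<^esub> gram_class E = b \<oplus>\<^bsub>?S\<^esub> gram_class E)"
    using cong by blast
  also have "\<dots> \<longleftrightarrow> (\<exists>e\<in>carrier ?S. a \<oplus>\<^bsub>?S\<^esub> e = b \<oplus>\<^bsub>?S\<^esub> e)"
    using E I by blast
  finally show "class_invariant a = class_invariant b \<longleftrightarrow> (\<exists>e\<in>carrier ?S. a \<oplus>\<^bsub>?S\<^esub> e = b \<oplus>\<^bsub>?S\<^esub> e)" .
next
  let ?S = "isometry_classes R"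
  interpret D: cring disc_ring by (rule cring_disc_ring)
  fix x assume "x \<in> carrier disc_ring"
  then obtain n s t where x: "x = (n, s, t)" "s \<in> {0..<2}" "t \<in> {0..<2}" by (auto simp: disc_ring_def)
  define a where "a = Trunc True (s = 1) False (t = 1)"
  have a: "disc1 a = s" "disc2 a = t" "c0 a"
    using x(2,3) by (auto simp: a_def disc1_def disc2_def)
  have ua: "unimodular (scal a)" unfolding unimodular_scal trunc_unit_iff by (rule a(3))
  \<comment> \<open>The rank n may be negative, so its positive and negative parts go to different
    sides. The entry \<open>a\<close> carries the discriminant and raises the rank by one, which the
    extra 1 in \<open>?B\<close> compensates.\<close>
  let ?A = "block_sum (1\<^sub>m (nat n)) (scal a)" and ?B = "1\<^sub>m (nat (- n) + 1) :: trunc mat"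
  have uA: "unimodular ?A" and uB: "unimodular ?B"
    by (rule unimodular_block_sum[OF unimodular_one ua], rule unimodular_one)
  have iA: "gram_invariant ?A = (int (nat n) + 1, s, t)"
    unfolding gram_invariant_block_sum[OF unimodular_one ua] gram_invariant_one gram_invariant_scal a
    using x by (simp add: disc_ring_def)
  have "x \<oplus>\<^bsub>disc_ring\<^esub> gram_invariant ?B = gram_invariant ?A"
    unfolding iA gram_invariant_one using x by (simp add: disc_ring_def)
  then have "x = gram_invariant ?A \<ominus>\<^bsub>disc_ring\<^esub> gram_invariant ?B"
    using \<open>x \<in> carrier disc_ring\<close> gram_invariant_carrier[of ?B] by (metis D.add.inv_solve_right' D.minus_eq gram_invariant_carrier)
  then show "\<exists>a\<in>carrier ?S. \<exists>b\<in>carrier ?S. x = class_invariant a \<ominus>\<^bsub>disc_ring\<^esub> class_invariant b"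
    using uA uB class_invariant_gram_class[OF uA] class_invariant_gram_class[OF uB]
    unfolding isometry_classes_carrier by (intro bexI[of _ "gram_class ?A"] bexI[of _ "gram_class ?B"]) auto
qed

end

section \<open>Group rings\<close>

lemma frag_cmul_diff_right: "frag_cmul k (a - b) = frag_cmul k a - frag_cmul k b"
  by (rule poly_mapping_eqI) (simp add: lookup_minus algebra_simps)

lemma frag_extend_diff_fun: "frag_extend (\<lambda>a. f a - g a) c = frag_extend f c - frag_extend g c"
  by (simp add: frag_extend_def frag_cmul_diff_right sum_subtractf)

context comm_monoid
begin

abbreviation group_ring ("GR") where "GR \<equiv> int_group_ring G"

lemma group_ring_simps:
  "carrier GR = {c. Poly_Mapping.keys c \<subseteq> carrier G}" "\<zero>\<^bsub>GR\<^esub> = 0" "\<one>\<^bsub>GR\<^esub> = frag_of \<one>"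
  "c \<oplus>\<^bsub>GR\<^esub> d = c + d"
  by (simp_all add: int_group_ring_def)

lemma group_ring_mult_of: "frag_of a \<otimes>\<^bsub>GR\<^esub> frag_of b = frag_of (a \<otimes> b)"
  by (simp add: int_group_ring_def)

lemma group_ring_mult_diff:
  "(c - c') \<otimes>\<^bsub>GR\<^esub> d = c \<otimes>\<^bsub>GR\<^esub> d - c' \<otimes>\<^bsub>GR\<^esub> d"
  "c \<otimes>\<^bsub>GR\<^esub> (d - d') = c \<otimes>\<^bsub>GR\<^esub> d - c \<otimes>\<^bsub>GR\<^esub> d'"
  by (simp_all add: int_group_ring_def frag_extend_diff frag_extend_diff_fun)

lemma group_ring_mult_zero: "0 \<otimes>\<^bsub>GR\<^esub> d = 0" "c \<otimes>\<^bsub>GR\<^esub> 0 = 0"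
  by (simp_all add: int_group_ring_def frag_extend_eq_0)

lemma frag_of_group_ring: "a \<in> carrier G \<Longrightarrow> frag_of a \<in> carrier GR"
  by (simp add: group_ring_simps keys_frag_of)

lemma diff_group_ring: "c \<in> carrier GR \<Longrightarrow> d \<in> carrier GR \<Longrightarrow> c - d \<in> carrier GR"
  using keys_diff[of c d] by (auto simp: group_ring_simps)

text \<open>Additive statements are reduced to basis elements. Closure under differences replaces
  closure under sums and negatives.\<close>

lemma group_ring_induct [consumes 1, case_names zero one diff]:
  assumes "c \<in> carrier GR" "P 0" "\<And>a. a \<in> carrier G \<Longrightarrow> P (frag_of a)"
    "\<And>c d. P c \<Longrightarrow> P d \<Longrightarrow> P (c - d)"
  shows "P c"
  using frag_induction[of c "carrier G" P] assms by (simp add: group_ring_simps)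

lemma group_ring_mult_closed:
  assumes "c \<in> carrier GR" "d \<in> carrier GR" shows "c \<otimes>\<^bsub>GR\<^esub> d \<in> carrier GR"
  using assms(1)
proof (induction rule: group_ring_induct)
  case zero
  then show ?case by (simp add: group_ring_mult_zero group_ring_simps)
next
  case (one a)
  show ?case
    using assms(2)
  proof (induction rule: group_ring_induct)
    case zero
    then show ?case by (simp add: group_ring_mult_zero group_ring_simps)
  next
    case (one b)
    then show ?case unfolding group_ring_mult_of using \<open>a \<in> carrier G\<close> by (intro frag_of_group_ring) simp
  next
    case (diff c d)
    then show ?case unfolding group_ring_mult_diff by (rule diff_group_ring)
  qed
next
  case (diff c d)
  then show ?case unfolding group_ring_mult_diff by (rule diff_group_ring)
qed

lemma group_ring_mult_comm:
  assumes "c \<in> carrier GR" "d \<in> carrier GR" shows "c \<otimes>\<^bsub>GR\<^esub> d = d \<otimes>\<^bsub>GR\<^esub> c"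
  using assms(1)
proof (induction rule: group_ring_induct)
  case zero
  then show ?case by (simp only: group_ring_mult_zero)
next
  case (one a)
  show ?case
    using assms(2)
  proof (induction rule: group_ring_induct)
    case zero
    then show ?case by (simp only: group_ring_mult_zero)
  next
    case (one b)
    then show ?case unfolding group_ring_mult_of using \<open>a \<in> carrier G\<close> by (simp add: m_comm)
  next
    case (diff c d)
    then show ?case unfolding group_ring_mult_diff by simp
  qed
next
  case (diff c d)
  then show ?case unfolding group_ring_mult_diff by simp
qed

lemma group_ring_mult_assoc:
  assumes "c \<in> carrier GR" "d \<in> carrier GR" "e \<in> carrier GR"
  shows "(c \<otimes>\<^bsub>GR\<^esub> d) \<otimes>\<^bsub>GR\<^esub> e = c \<otimes>\<^bsub>GR\<^esub> (d \<otimes>\<^bsub>GR\<^esub> e)"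
  using assms(1)
proof (induction rule: group_ring_induct)
  case zero
  then show ?case by (simp only: group_ring_mult_zero)
next
  case (one a)
  show ?case
    using assms(2)
  proof (induction rule: group_ring_induct)
    case zero
    then show ?case by (simp only: group_ring_mult_zero)
  next
    case (one b)
    show ?case
      using assms(3)
    proof (induction rule: group_ring_induct)
      case zero
      then show ?case by (simp only: group_ring_mult_zero)
    next
      case (one c)
      then show ?case unfolding group_ring_mult_of
        using \<open>a \<in> carrier G\<close> \<open>b \<in> carrier G\<close> by (simp add: m_assoc)
    next
      case (diff c d)
      then show ?case unfolding group_ring_mult_diff by simp
    qed
  next
    case (diff c d)
    then show ?case unfolding group_ring_mult_diff by simp
  qed
next
  case (diff c d)
  then show ?case unfolding group_ring_mult_diff by simp
qed

lemma group_ring_one_mult: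
  assumes "c \<in> carrier GR" shows "frag_of \<one> \<otimes>\<^bsub>GR\<^esub> c = c"
  using assms
proof (induction rule: group_ring_induct)
  case zero
  then show ?case by (simp only: group_ring_mult_zero)
next
  case (one a)
  then show ?case unfolding group_ring_mult_of by simp
next
  case (diff c d)
  then show ?case unfolding group_ring_mult_diff by simp
qed

lemma cring_group_ring: "cring GR"
proof (rule cringI)
  show "abelian_group GR"
  proof (rule abelian_groupI)
    fix c assume "c \<in> carrier GR"
    then have "0 - c \<in> carrier GR" "(0 - c) \<oplus>\<^bsub>GR\<^esub> c = \<zero>\<^bsub>GR\<^esub>" by (simp_all add: group_ring_simps)
    then show "\<exists>d\<in>carrier GR. d \<oplus>\<^bsub>GR\<^esub> c = \<zero>\<^bsub>GR\<^esub>" by blast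
  next
    fix c d assume "c \<in> carrier GR" "d \<in> carrier GR"
    then show "c \<oplus>\<^bsub>GR\<^esub> d \<in> carrier GR" using keys_add[of c d] by (auto simp: group_ring_simps)
  qed (auto simp: group_ring_simps add.assoc add.commute)
  show "comm_monoid GR"
  proof (rule comm_monoidI)
    show "\<one>\<^bsub>GR\<^esub> \<in> carrier GR" unfolding group_ring_simps(3) by (rule frag_of_group_ring) simp
    show "\<one>\<^bsub>GR\<^esub> \<otimes>\<^bsub>GR\<^esub> c = c" if "c \<in> carrier GR" for c
      unfolding group_ring_simps(3) by (rule group_ring_one_mult[OF that])
  qed (fact group_ring_mult_closed group_ring_mult_assoc group_ring_mult_comm)+
  fix c d e assume "c \<in> carrier GR" "d \<in> carrier GR" "e \<in> carrier GR"
  have "c + d = c - (0 - d)" by simp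
  then have "(c + d) \<otimes>\<^bsub>GR\<^esub> e = c \<otimes>\<^bsub>GR\<^esub> e - (0 \<otimes>\<^bsub>GR\<^esub> e - d \<otimes>\<^bsub>GR\<^esub> e)"
    by (simp only: group_ring_mult_diff)
  then show "(c \<oplus>\<^bsub>GR\<^esub> d) \<otimes>\<^bsub>GR\<^esub> e = c \<otimes>\<^bsub>GR\<^esub> e \<oplus>\<^bsub>GR\<^esub> d \<otimes>\<^bsub>GR\<^esub> e"
    by (simp add: group_ring_simps group_ring_mult_zero)
qed

end

section \<open>Degree zero Milnor-Witt K-theory\<close>

context trunc_coordinate
begin

interpretation R: cring R by (rule cring)

lemma units_comm_group: "comm_group (units_of R)"
  by (rule R.units_comm_group)

interpretation U: comm_group "units_of R" by (rule units_comm_group)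

abbreviation "ZU \<equiv> unit_group_ring R"

interpretation ZU: cring ZU by (rule U.cring_group_ring)

lemma minus_psi: "\<ominus> \<psi> p = \<psi> p"
proof -
  have "\<psi> p \<oplus> \<psi> p = \<zero>" unfolding psi_add[symmetric] by (simp add: psi_zero)
  then show ?thesis by (intro R.minus_equality) simp_all
qed

lemma Units_psi: "\<psi> p \<in> Units R \<longleftrightarrow> c0 p"
proof
  assume "\<psi> p \<in> Units R"
  then obtain r where "r \<in> carrier R" "\<psi> p \<otimes> r = \<one>" unfolding Units_def by blast
  then obtain q where "\<psi> (p * q) = \<psi> 1" using psi_surj[of r] by (auto simp: psi_mult psi_one)
  then have "p * q = 1" by simp
  then have "p dvd 1" by (metis dvd_triv_left)
  then show "c0 p" unfolding trunc_unit_iff .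
next
  assume "c0 p"
  then have "p dvd 1" unfolding trunc_unit_iff .
  then obtain q where q: "p * q = 1" unfolding dvd_def by metis
  have "\<psi> q \<otimes> \<psi> p = \<one>" "\<psi> p \<otimes> \<psi> q = \<one>"
    using q by (simp_all add: psi_mult[symmetric] psi_one[symmetric] mult.commute)
  then show "\<psi> p \<in> Units R" unfolding Units_def using psi_closed by blast
qed

lemma Units_obtain: assumes "a \<in> Units R" obtains p where "c0 p" "a = \<psi> p"
proof -
  obtain p where "a = \<psi> p" using psi_surj[of a] assms R.Units_closed by blast
  then show ?thesis using that assms Units_psi by blast
qed

lemma ZU_simps:
  "carrier ZU = {c. Poly_Mapping.keys c \<subseteq> Units R}" "\<zero>\<^bsub>ZU\<^esub> = 0" "\<one>\<^bsub>ZU\<^esub> = frag_of (\<psi> 1)"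
  "c \<oplus>\<^bsub>ZU\<^esub> d = c + d"
  using U.group_ring_simps by (simp_all add: units_of_carrier units_of_one psi_one)

lemma ZU_mult_of: "frag_of (\<psi> p) \<otimes>\<^bsub>ZU\<^esub> frag_of (\<psi> q) = frag_of (\<psi> (p * q))"
  unfolding U.group_ring_mult_of by (simp add: units_of_mult psi_mult)

lemma frag_of_ZU: "c0 p \<Longrightarrow> frag_of (\<psi> p) \<in> carrier ZU"
  by (simp add: ZU_simps keys_frag_of Units_psi)

lemma ZU_induct [consumes 1, case_names zero one diff]:
  assumes "c \<in> carrier ZU" "P 0" "\<And>p. c0 p \<Longrightarrow> P (frag_of (\<psi> p))"
    "\<And>c d. P c \<Longrightarrow> P d \<Longrightarrow> P (c - d)"
  shows "P c"
  using assms(1)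
proof (induction rule: U.group_ring_induct)
  case (one a)
  then show ?case using assms(3) by (auto simp: units_of_carrier elim: Units_obtain)
qed (use assms in auto)

lemma ZU_minus: "c \<in> carrier ZU \<Longrightarrow> \<ominus>\<^bsub>ZU\<^esub> c = - c"
proof -
  assume c: "c \<in> carrier ZU"
  have "0 - c \<in> carrier ZU" using c by (simp add: ZU_simps)
  then have "\<ominus>\<^bsub>ZU\<^esub> c = 0 - c" using c by (intro ZU.minus_equality) (simp_all add: ZU_simps)
  then show ?thesis by simp
qed

text \<open>The additive extension of a function on units to the group ring. The augmentation, the
  discriminants and the coefficients at square classes are all of this kind.\<close>

definition weight_sum :: "(trunc \<Rightarrow> int) \<Rightarrow> ('a \<Rightarrow>\<^sub>0 int) \<Rightarrow> int" where
  "weight_sum w c = (\<Sum>p | c0 p. w p * Poly_Mapping.lookup c (\<psi> p))"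

lemma weight_sum_simps:
  "weight_sum w 0 = 0" "weight_sum w (c + d) = weight_sum w c + weight_sum w d"
  "weight_sum w (c - d) = weight_sum w c - weight_sum w d"
  by (simp_all add: weight_sum_def lookup_add lookup_minus distrib_left right_diff_distrib sum.distrib sum_subtractf)

lemma weight_sum_frag_cmul: "weight_sum w (frag_cmul k c) = k * weight_sum w c"
  by (simp add: weight_sum_def sum_distrib_left ac_simps)

lemma weight_sum_of:
  assumes "c0 p" shows "weight_sum w (frag_of (\<psi> p)) = w p"
proof -
  have "weight_sum w (frag_of (\<psi> p)) = (\<Sum>q | c0 q. if q = p then w q else 0)"
    unfolding weight_sum_def by (rule sum.cong) auto
  then show ?thesis using assms by simp
qed

lemma weight_sum_mult_of:
  assumes "c0 q" "c \<in> carrier ZU"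
  shows "weight_sum w (frag_of (\<psi> q) \<otimes>\<^bsub>ZU\<^esub> c) = weight_sum (\<lambda>p. w (q * p)) c"
  using assms(2)
proof (induction rule: ZU_induct)
  case zero
  then show ?case unfolding U.group_ring_mult_zero by (simp add: weight_sum_simps)
next
  case (one p)
  then have "c0 (q * p)" using assms(1) by (simp add: times_trunc_def)
  then show ?case unfolding ZU_mult_of by (simp add: weight_sum_of one)
next
  case (diff c d)
  then show ?case unfolding U.group_ring_mult_diff by (simp add: weight_sum_simps)
qed

abbreviation augmentation :: "('a \<Rightarrow>\<^sub>0 int) \<Rightarrow> int" where "augmentation \<equiv> weight_sum (\<lambda>_. 1)"

lemma augmentation_mult:
  assumes "c \<in> carrier ZU" "d \<in> carrier ZU"
  shows "augmentation (c \<otimes>\<^bsub>ZU\<^esub> d) = augmentation c * augmentation d"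
  using assms(1)
proof (induction rule: ZU_induct)
  case zero
  then show ?case unfolding U.group_ring_mult_zero by (simp add: weight_sum_simps)
next
  case (one p)
  then show ?case by (simp add: weight_sum_mult_of[OF one assms(2)] weight_sum_of)
next
  case (diff c d)
  then show ?case unfolding U.group_ring_mult_diff by (simp add: weight_sum_simps left_diff_distrib)
qed

text \<open>A homomorphism from the units to Z/2 extends to a derivation of the group ring along the
  augmentation. Both sides are biadditive, so basis elements suffice.\<close>

lemma weight_sum_derivation:
  assumes w: "\<And>p q. c0 p \<Longrightarrow> c0 q \<Longrightarrow> w (p * q) = (w p + w q) mod 2"
    and c: "c \<in> carrier ZU" and d: "d \<in> carrier ZU"
  shows "weight_sum w (c \<otimes>\<^bsub>ZU\<^esub> d) mod 2 = (augmentation d * weight_sum w c + augmentation c * weight_sum w d) mod 2"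
proof -
  \<comment> \<open>The defect in the product rule, taken over the integers so that it is additive
    in each argument; only its parity matters.\<close>
  define \<delta> where "\<delta> c d = weight_sum w (c \<otimes>\<^bsub>ZU\<^esub> d) - (augmentation d * weight_sum w c + augmentation c * weight_sum w d)" for c d
  have diff1: "\<delta> (c - c') d = \<delta> c d - \<delta> c' d" for c c' d
    unfolding \<delta>_def U.group_ring_mult_diff by (simp add: weight_sum_simps algebra_simps)
  have diff2: "\<delta> c (d - d') = \<delta> c d - \<delta> c d'" for c d d'
    unfolding \<delta>_def U.group_ring_mult_diff by (simp add: weight_sum_simps algebra_simps)
  have "2 dvd \<delta> c d"
    using c
  proof (induction rule: ZU_induct)
    case zero
    then show ?case by (simp only: \<delta>_def U.group_ring_mult_zero) (simp add: weight_sum_simps)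
  next
    case (one p)
    show ?case
      using d
    proof (induction rule: ZU_induct)
      case zero
      then show ?case by (simp only: \<delta>_def U.group_ring_mult_zero) (simp add: weight_sum_simps)
    next
      case (one q)
      have "c0 (p * q)" using one \<open>c0 p\<close> by (simp add: times_trunc_def)
      then show ?case
        using one \<open>c0 p\<close> unfolding \<delta>_def ZU_mult_of
        by (simp add: weight_sum_of w mod_eq_dvd_iff[symmetric])
    next
      case (diff c d)
      then show ?case unfolding diff2 by (rule dvd_diff)
    qed
  next
    case (diff c d)
    then show ?case unfolding diff1 by (rule dvd_diff)
  qed
  then show ?thesis unfolding \<delta>_def by (simp add: mod_eq_dvd_iff)
qed

text \<open>The coefficient at the square class with coordinates (s, t) after passing to the group
  ring of R^*/R^*^2.\<close>

definition class_count :: "int \<Rightarrow> int \<Rightarrow> ('a \<Rightarrow>\<^sub>0 int) \<Rightarrow> int" where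
  "class_count s t = weight_sum (\<lambda>p. of_bool (disc1 p = s \<and> disc2 p = t))"

lemma class_count_simps:
  "class_count s t 0 = 0" "class_count s t (c + d) = class_count s t c + class_count s t d"
  "class_count s t (c - d) = class_count s t c - class_count s t d"
  "class_count s t (frag_cmul k c) = k * class_count s t c"
  "c0 p \<Longrightarrow> class_count s t (frag_of (\<psi> p)) = of_bool (disc1 p = s \<and> disc2 p = t)"
  by (simp_all add: class_count_def weight_sum_simps weight_sum_frag_cmul weight_sum_of)

lemma weight_sum_class_count:
  assumes "c \<in> carrier ZU"
  shows "augmentation c = class_count 0 0 c + class_count 1 0 c + class_count 0 1 c + class_count 1 1 c"
    "weight_sum disc1 c = class_count 1 0 c + class_count 1 1 c"
    "weight_sum disc2 c = class_count 0 1 c + class_count 1 1 c"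
proof -
  have "augmentation c = class_count 0 0 c + class_count 1 0 c + class_count 0 1 c + class_count 1 1 c \<and>
    weight_sum disc1 c = class_count 1 0 c + class_count 1 1 c \<and>
    weight_sum disc2 c = class_count 0 1 c + class_count 1 1 c"
    using assms
  proof (induction rule: ZU_induct)
    case (one p)
    then show ?case by (auto simp: class_count_simps weight_sum_of disc1_def disc2_def)
  qed (simp_all add: class_count_simps weight_sum_simps)
  then show "augmentation c = class_count 0 0 c + class_count 1 0 c + class_count 0 1 c + class_count 1 1 c"
    "weight_sum disc1 c = class_count 1 0 c + class_count 1 1 c"
    "weight_sum disc2 c = class_count 0 1 c + class_count 1 1 c" by auto
qed

text \<open>This is \<open>2I\<close> modulo squares, where \<open>I\<close> is the augmentation ideal.\<close>

definition even_ideal :: "('a \<Rightarrow>\<^sub>0 int) set" where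
  "even_ideal = {c \<in> carrier ZU. augmentation c = 0 \<and> (\<forall>s t. even (class_count s t c))}"

text \<open>Multiplication by a unit translates the square classes by its discriminant, so it merely
  permutes the four counts; the augmentation is multiplicative.\<close>

lemma even_ideal_mult:
  assumes "d \<in> carrier ZU" "c \<in> even_ideal"
  shows "d \<otimes>\<^bsub>ZU\<^esub> c \<in> even_ideal"
proof -
  have c: "c \<in> carrier ZU" "augmentation c = 0" "\<And>s t. even (class_count s t c)"
    using assms(2) by (auto simp: even_ideal_def)
  have "even (class_count s t (d \<otimes>\<^bsub>ZU\<^esub> c))" for s t
    using assms(1)
  proof (induction rule: ZU_induct)
    case zero
    then show ?case unfolding U.group_ring_mult_zero by (simp add: class_count_simps)
  next
    case (one q)
    have *: "class_count s t (frag_of (\<psi> q) \<otimes>\<^bsub>ZU\<^esub> c) =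
      weight_sum (\<lambda>p. of_bool (disc1 (q * p) = s \<and> disc2 (q * p) = t)) c"
      unfolding class_count_def
      by (rule weight_sum_mult_of[OF one c(1), where w = "\<lambda>p. of_bool (disc1 p = s \<and> disc2 p = t)"])
    show ?case
    proof (cases "s \<in> {0..<2} \<and> t \<in> {0..<2}")
      case True
      have "of_bool (disc1 (q * p) = s \<and> disc2 (q * p) = t) =
        (of_bool (disc1 p = (s + disc1 q) mod 2 \<and> disc2 p = (t + disc2 q) mod 2) :: int)" if "c0 p" for p
      proof -
        have shift: "(x + y) mod 2 = r \<longleftrightarrow> y = (r + x) mod 2"
          if "x \<in> {0..<2}" "y \<in> {0..<2}" "r \<in> {0..<2}" for x y r :: int
        proof -
          have "x = 0 \<or> x = 1" "y = 0 \<or> y = 1" "r = 0 \<or> r = 1"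
            using that unfolding atLeastLessThan_iff by linarith+
          then show ?thesis by (elim disjE) simp_all
        qed
        show ?thesis
          unfolding disc_mult[OF one that] shift[OF disc_range(1) disc_range(1) conjunct1[OF True]]
            shift[OF disc_range(2) disc_range(2) conjunct2[OF True]] ..
      qed
      then have "weight_sum (\<lambda>p. of_bool (disc1 (q * p) = s \<and> disc2 (q * p) = t)) c =
        class_count ((s + disc1 q) mod 2) ((t + disc2 q) mod 2) c"
        unfolding class_count_def weight_sum_def by (intro sum.cong) auto
      then show ?thesis unfolding * using c(3) by simp
    next
      \<comment> \<open>Arguments outside {0, 1} name no square class, and the count is an empty sum
        of zeros.\<close>
      case False
      then have "weight_sum (\<lambda>p. of_bool (disc1 (q * p) = s \<and> disc2 (q * p) = t)) c = 0"
        unfolding weight_sum_def using disc_range by (intro sum.neutral) fastforce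
      then show ?thesis unfolding * by simp
    qed
  next
    case (diff c d)
    then show ?case unfolding U.group_ring_mult_diff by (simp add: class_count_simps)
  qed
  then show ?thesis
    using assms(1) c(1,2) U.group_ring_mult_closed by (simp add: even_ideal_def augmentation_mult)
qed

lemma ideal_even_ideal: "ideal even_ideal ZU"
proof (rule idealI)
  show "ring ZU" by (rule ZU.ring_axioms)
  show "subgroup even_ideal (add_monoid ZU)"
  proof (rule group.subgroupI)
    show "group (add_monoid ZU)" by (rule ZU.add.group_axioms)
    show "even_ideal \<subseteq> carrier (add_monoid ZU)" by (auto simp: even_ideal_def)
    have "0 \<in> even_ideal" by (simp add: even_ideal_def ZU_simps weight_sum_simps class_count_simps)
    then show "even_ideal \<noteq> {}" by blast
    fix c assume c: "c \<in> even_ideal"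
    have cc: "c \<in> carrier ZU" "0 \<in> carrier ZU" using c by (simp_all add: even_ideal_def ZU_simps)
    have "0 - c \<in> even_ideal"
      using c U.diff_group_ring[OF cc(2,1)] unfolding even_ideal_def mem_Collect_eq weight_sum_simps class_count_simps
      by simp
    then show "inv\<^bsub>add_monoid ZU\<^esub> c \<in> even_ideal"
      using ZU_minus[OF cc(1)] by (simp add: a_inv_def)
    fix d assume d: "d \<in> even_ideal"
    have "c \<oplus>\<^bsub>ZU\<^esub> d \<in> carrier ZU" using c d by (intro ZU.a_closed) (auto simp: even_ideal_def)
    then show "c \<otimes>\<^bsub>add_monoid ZU\<^esub> d \<in> even_ideal"
      using c d by (simp add: even_ideal_def ZU_simps(4) weight_sum_simps class_count_simps)
  qed
  fix c d assume c: "c \<in> even_ideal" and d: "d \<in> carrier ZU"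
  show "d \<otimes>\<^bsub>ZU\<^esub> c \<in> even_ideal" by (rule even_ideal_mult[OF d c])
  moreover have "c \<in> carrier ZU" using c by (simp add: even_ideal_def)
  ultimately show "c \<otimes>\<^bsub>ZU\<^esub> d \<in> even_ideal" using U.group_ring_mult_comm[OF _ d] by simp
qed

abbreviation "gens \<equiv> {pfister R (a \<otimes> a) | a. a \<in> Units R} \<union>
     {pfister R a \<otimes>\<^bsub>ZU\<^esub> hyp R | a. a \<in> Units R} \<union>
     {pfister R a \<otimes>\<^bsub>ZU\<^esub> pfister R (\<one> \<ominus> a) | a. a \<in> Units R \<and> \<one> \<ominus> a \<in> Units R}"

lemma pfister_psi: "pfister R (\<psi> p) = frag_of (\<psi> 1) - frag_of (\<psi> p)"
  by (simp add: pfister_def psi_one)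

lemma c0_one: "c0 1"
  by (simp add: one_trunc_def)

lemma pfister_ZU: "c0 p \<Longrightarrow> pfister R (\<psi> p) \<in> carrier ZU"
  unfolding pfister_psi by (intro U.diff_group_ring frag_of_ZU c0_one)

lemma hyp_psi: "hyp R = frag_cmul 2 (frag_of (\<psi> 1))"
  using minus_psi[of 1] by (simp add: hyp_def psi_one frag_cmul_distrib[of 1 1, simplified])

lemma frag_cmul_mult: "c \<otimes>\<^bsub>ZU\<^esub> frag_cmul k (frag_of (\<psi> 1)) = frag_cmul k c" if c: "c \<in> carrier ZU"
proof -
  have one: "frag_of (\<psi> 1) \<in> carrier ZU" by (rule frag_of_ZU[OF c0_one])
  have "frag_cmul k (frag_of (\<psi> 1)) \<in> carrier ZU" using one keys_cmul by (fastforce simp: ZU_simps)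
  then have "c \<otimes>\<^bsub>ZU\<^esub> frag_cmul k (frag_of (\<psi> 1)) = frag_cmul k (frag_of (\<psi> 1)) \<otimes>\<^bsub>ZU\<^esub> c"
    by (rule U.group_ring_mult_comm[OF c])
  also have "\<dots> = frag_cmul k (frag_of (\<psi> 1) \<otimes>\<^bsub>ZU\<^esub> c)"
    by (simp add: int_group_ring_def frag_extend_cmul)
  also have "frag_of (\<psi> 1) \<otimes>\<^bsub>ZU\<^esub> c = c"
    using ZU.l_one[OF c] unfolding ZU_simps(3) .
  finally show ?thesis .
qed

lemma gens_even: "gens \<subseteq> even_ideal"
proof
  fix c assume "c \<in> gens"
  then consider a where "a \<in> Units R" "c = pfister R (a \<otimes> a)"
    | a where "a \<in> Units R" "c = pfister R a \<otimes>\<^bsub>ZU\<^esub> hyp R"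
    | a where "a \<in> Units R" "\<one> \<ominus> a \<in> Units R" by blast
  then show "c \<in> even_ideal"
  proof cases
    case 1
    obtain p where p: "c0 p" "a = \<psi> p" using Units_obtain[OF 1(1)] .
    have pp: "c0 (p * p)" using p(1) by (simp add: times_trunc_def)
    have c: "c = pfister R (\<psi> (p * p))" using 1(2) p(2) by (simp add: psi_mult)
    have "disc1 (p * p) = disc1 1" "disc2 (p * p) = disc2 1"
      unfolding disc_mult[OF p(1) p(1)] disc_one by (simp_all add: disc1_def disc2_def)
    then show ?thesis
      unfolding c using pfister_ZU[OF pp]
      by (simp add: even_ideal_def pfister_psi weight_sum_simps class_count_simps weight_sum_of pp c0_one)
  next
    case 2
    obtain p where p: "c0 p" "a = \<psi> p" using Units_obtain[OF 2(1)] .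
    have c: "c = frag_cmul 2 (pfister R (\<psi> p))"
      unfolding 2(2) p(2) hyp_psi by (rule frag_cmul_mult[OF pfister_ZU[OF p(1)]])
    have "c \<in> carrier ZU" unfolding c using pfister_ZU[OF p(1)] keys_cmul by (fastforce simp: ZU_simps)
    then show ?thesis
      unfolding c by (simp add: even_ideal_def pfister_psi weight_sum_simps weight_sum_frag_cmul
          class_count_simps weight_sum_of p(1) c0_one)
  next
    case 3
    obtain p where p: "c0 p" "a = \<psi> p" using Units_obtain[OF 3(1)] .
    have "\<one> \<ominus> a = \<psi> (1 + p)" unfolding a_minus_def p(2) minus_psi by (simp add: psi_add psi_one)
    then have "c0 (1 + p)" using 3(2) Units_psi by simp
    then show ?thesis using p(1) by (simp add: plus_trunc_def one_trunc_def)
  qed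
qed

text \<open>Modulo the ideal every element is a combination of the four square classes, with
  coefficients given by the class counts.\<close>

definition normal_form :: "('a \<Rightarrow>\<^sub>0 int) \<Rightarrow> ('a \<Rightarrow>\<^sub>0 int)" where
  "normal_form c = frag_cmul (augmentation c) (frag_of (\<psi> 1)) -
    frag_cmul (class_count 1 0 c) (pfister R (\<psi> (Trunc True True False False))) -
    frag_cmul (class_count 0 1 c) (pfister R (\<psi> (Trunc True False False True))) -
    frag_cmul (class_count 1 1 c) (pfister R (\<psi> (Trunc True True False True)))"

text \<open>Every element differs from its normal form by an element of the ideal, as square classes
  may be identified. For an element of \<open>even_ideal\<close> the normal form has augmentation 0
  and even coefficients, so it is a combination of the elements 2(1 - <a>), which h = 2 puts into
  the ideal.\<close>

lemma K0MW_ideal_eq: "K0MW_ideal R = even_ideal"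
proof
  show "K0MW_ideal R \<subseteq> even_ideal"
    unfolding K0MW_ideal_def by (rule ZU.genideal_minimal[OF ideal_even_ideal gens_even])
  have gens_ZU: "gens \<subseteq> carrier ZU" using gens_even by (auto simp: even_ideal_def)
  interpret I: ideal "K0MW_ideal R" ZU
    unfolding K0MW_ideal_def by (rule ZU.genideal_ideal[OF gens_ZU])
  have gens_I: "gens \<subseteq> K0MW_ideal R"
    unfolding K0MW_ideal_def by (rule ZU.genideal_self[OF gens_ZU])
  have I_diff: "c - d \<in> K0MW_ideal R" if "c \<in> K0MW_ideal R" "d \<in> K0MW_ideal R" for c d
  proof -
    have d: "d \<in> carrier ZU" using that(2) I.a_subset by blast
    have "c \<oplus>\<^bsub>ZU\<^esub> (\<ominus>\<^bsub>ZU\<^esub> d) \<in> K0MW_ideal R" using that by (simp add: I.a_closed I.a_inv_closed)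
    then show ?thesis unfolding ZU_minus[OF d] ZU_simps(4) by simp
  qed
  have I_zero: "0 \<in> K0MW_ideal R" using I.zero_closed unfolding ZU_simps(2) .
  have I_even: "frag_cmul (2 * k) (pfister R (\<psi> p)) \<in> K0MW_ideal R" if p: "c0 p" for k p
  proof -
    have "pfister R (\<psi> p) \<otimes>\<^bsub>ZU\<^esub> hyp R \<in> K0MW_ideal R" using gens_I Units_psi p by blast
    then have g: "frag_cmul 2 (pfister R (\<psi> p)) \<in> K0MW_ideal R"
      unfolding hyp_psi frag_cmul_mult[OF pfister_ZU[OF p]] .
    have "frag_cmul k (frag_cmul 2 (pfister R (\<psi> p))) \<in> K0MW_ideal R"
      by (rule frag_closure_minus_cmul[OF I_zero I_diff g])
    then show ?thesis by (simp add: mult.commute)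
  qed
  \<comment> \<open>If q = p s^2, then <p> - <q> is <p> times the generator attached to the square
    s^2.\<close>
  have I_class: "frag_of (\<psi> p) - frag_of (\<psi> q) \<in> K0MW_ideal R"
    if p: "c0 p" "c0 q" "disc1 p = disc1 q" "disc2 p = disc2 q" for p q
  proof -
    obtain s where s: "c0 s" "q = p * (s * s)" using p disc_eq_iff[of p q] by blast
    have "pfister R (\<psi> s \<otimes> \<psi> s) \<in> K0MW_ideal R" using gens_I Units_psi s(1) by blast
    then have "frag_of (\<psi> p) \<otimes>\<^bsub>ZU\<^esub> pfister R (\<psi> (s * s)) \<in> K0MW_ideal R"
      unfolding psi_mult by (rule I.I_l_closed) (rule frag_of_ZU[OF p(1)])
    then show ?thesis unfolding pfister_psi U.group_ring_mult_diff ZU_mult_of s(2) by simp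
  qed
  have nf: "c - normal_form c \<in> K0MW_ideal R" if "c \<in> carrier ZU" for c
    using that
  proof (induction rule: ZU_induct)
    case zero
    then show ?case using I_zero by (simp add: normal_form_def weight_sum_simps class_count_simps)
  next
    case (one p)
    have "disc1 p = 0 \<or> disc1 p = 1" "disc2 p = 0 \<or> disc2 p = 1"
      using disc_range[of p] unfolding atLeastLessThan_iff by linarith+
    then consider "disc1 p = 0" "disc2 p = 0" | "disc1 p = 1" "disc2 p = 0" | "disc1 p = 0" "disc2 p = 1"
      | "disc1 p = 1" "disc2 p = 1" by blast
    then show ?case
    proof cases
      case 1
      have "normal_form (frag_of (\<psi> p)) = frag_of (\<psi> 1)"
        using 1 one by (simp add: normal_form_def weight_sum_of class_count_simps)
      then show ?thesis using I_class[OF one c0_one] 1 by (simp add: disc_one)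
    next
      case 2
      have "normal_form (frag_of (\<psi> p)) = frag_of (\<psi> (Trunc True True False False))"
        using 2 one by (simp add: normal_form_def weight_sum_of class_count_simps pfister_psi)
      then show ?thesis using I_class[OF one, of "Trunc True True False False"] 2 by (simp add: disc1_def disc2_def)
    next
      case 3
      have "normal_form (frag_of (\<psi> p)) = frag_of (\<psi> (Trunc True False False True))"
        using 3 one by (simp add: normal_form_def weight_sum_of class_count_simps pfister_psi)
      then show ?thesis using I_class[OF one, of "Trunc True False False True"] 3 by (simp add: disc1_def disc2_def)
    next
      case 4
      have "normal_form (frag_of (\<psi> p)) = frag_of (\<psi> (Trunc True True False True))"
        using 4 one by (simp add: normal_form_def weight_sum_of class_count_simps pfister_psi)
      then show ?thesis using I_class[OF one, of "Trunc True True False True"] 4 by (simp add: disc1_def disc2_def)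
    qed
  next
    case (diff c d)
    have "normal_form (c - d) = normal_form c - normal_form d"
      by (simp add: normal_form_def weight_sum_simps class_count_simps frag_cmul_diff_distrib)
    then have "(c - d) - normal_form (c - d) = (c - normal_form c) - (d - normal_form d)" by simp
    then show ?case using I_diff[OF diff] by (simp only:)
  qed
  show "even_ideal \<subseteq> K0MW_ideal R"
  proof
    fix c assume c: "c \<in> even_ideal"
    have ev: "even (class_count 1 0 c)" "even (class_count 0 1 c)" "even (class_count 1 1 c)"
      using c by (simp_all add: even_ideal_def)
    obtain k1 k2 k3 where k: "class_count 1 0 c = 2 * k1" "class_count 0 1 c = 2 * k2" "class_count 1 1 c = 2 * k3"
      using ev unfolding dvd_def by blast
    have aug: "augmentation c = 0" using c by (simp add: even_ideal_def)
    have "normal_form c \<in> K0MW_ideal R"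
      unfolding normal_form_def k aug by (intro I_diff I_even) (simp_all add: I_zero)
    moreover have "c - normal_form c \<in> K0MW_ideal R" using nf c by (simp add: even_ideal_def)
    ultimately have "(c - normal_form c) - (0 - normal_form c) \<in> K0MW_ideal R"
      using I_diff I_zero by blast
    then show "c \<in> K0MW_ideal R" by simp
  qed
qed

section \<open>Comparison\<close>

interpretation M: grothendieck_model disc_ring "isometry_classes R" class_invariant
  by (rule grothendieck_model_isometry_classes)

lemma cring_GW: "cring (GW R)"
  unfolding GW_def by (rule M.cring_grothendieck)

interpretation GW: cring "GW R" by (rule cring_GW)

lemma fibre_GW:
  "x \<in> carrier disc_ring \<Longrightarrow> M.fibre x \<in> carrier (GW R)"
  "x \<in> carrier disc_ring \<Longrightarrow> y \<in> carrier disc_ring \<Longrightarrow> M.fibre x \<oplus>\<^bsub>GW R\<^esub> M.fibre y = M.fibre (x \<oplus>\<^bsub>disc_ring\<^esub> y)"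
  "x \<in> carrier disc_ring \<Longrightarrow> y \<in> carrier disc_ring \<Longrightarrow> M.fibre x \<otimes>\<^bsub>GW R\<^esub> M.fibre y = M.fibre (x \<otimes>\<^bsub>disc_ring\<^esub> y)"
  "\<zero>\<^bsub>GW R\<^esub> = M.fibre \<zero>\<^bsub>disc_ring\<^esub>" "\<one>\<^bsub>GW R\<^esub> = M.fibre \<one>\<^bsub>disc_ring\<^esub>"
  unfolding GW_def
  using M.fibre_carrier M.fibre_add M.fibre_mult M.fibre_zero ring_iso_memE(4)[OF M.fibre_iso] by auto

lemma GW_unit_fibre: "c0 p \<Longrightarrow> GW_unit R (\<psi> p) = M.fibre (1, disc1 p, disc2 p)"
proof -
  assume p: "c0 p"
  have u: "unimodular (scal p)" unfolding unimodular_scal trunc_unit_iff by (rule p)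
  have m: "gram_class (scal p) \<in> carrier (isometry_classes R)"
    unfolding isometry_classes_carrier using u by blast
  have "gram_invariant (scal p) \<ominus>\<^bsub>disc_ring\<^esub> \<zero>\<^bsub>disc_ring\<^esub> = gram_invariant (scal p)"
    using gram_invariant_carrier[of "scal p"] by (simp add: a_minus_def)
  then show ?thesis
    unfolding GW_unit_def isometry_class_gram[OF has_gram_rank_one] M.groth_class_eq_fibre[OF m M.phi_zero(1)]
      M.phi_zero(2) class_invariant_gram_class[OF u] by (simp add: gram_invariant_scal)
qed

text \<open>The map to \<open>GW\<close> is defined through integer multiples; k copies of <a> have
  rank k and discriminant a^k. Negative k are reached by cancelling one summand at a time.\<close>

lemma GW_int_multiple:
  assumes st: "s \<in> {0..<2}" "t \<in> {0..<2}"
  shows "add_pow (GW R) (k :: int) (M.fibre (1, s, t)) = M.fibre (k, (k * s) mod 2, (k * t) mod 2)"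
proof -
  let ?x = "M.fibre (1, s, t)" and ?f = "\<lambda>k. M.fibre (k, (k * s) mod 2, (k * t) mod 2)"
  have D: "(1, s, t) \<in> carrier disc_ring" "(k, (k * s) mod 2, (k * t) mod 2) \<in> carrier disc_ring" for k
    using st by (simp_all add: disc_ring_def)
  have x: "?x \<in> carrier (GW R)" "?f k \<in> carrier (GW R)" for k using fibre_GW(1) D by blast+
  have f: "?f (k + 1) = ?f k \<oplus>\<^bsub>GW R\<^esub> ?x" for k
    unfolding fibre_GW(2)[OF D(2,1)] disc_ring_simps by (simp add: mod_simps algebra_simps)
  have p: "add_pow (GW R) (k + 1) ?x = add_pow (GW R) k ?x \<oplus>\<^bsub>GW R\<^esub> ?x" for k :: int
    using GW.add.int_pow_mult[OF x(1), of k 1] GW.add.int_pow_1[OF x(1)] by simp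
  show ?thesis
  proof (induction k rule: int_induct[where k = 0])
    case base
    have "add_pow (GW R) (0 :: int) ?x = \<zero>\<^bsub>GW R\<^esub>" by (simp add: add_pow_def int_pow_def)
    then show ?case unfolding fibre_GW(4) disc_ring_simps by simp
  next
    case (step1 i)
    then show ?case using p f by simp
  next
    case (step2 i)
    have c: "add_pow (GW R) (i - 1) ?x \<in> carrier (GW R)" using x by simp
    have "add_pow (GW R) (i - 1) ?x \<oplus>\<^bsub>GW R\<^esub> ?x = ?f (i - 1) \<oplus>\<^bsub>GW R\<^esub> ?x"
      using p[of "i - 1"] f[of "i - 1"] step2 by simp
    then show ?case using GW.add.r_cancel[OF _ c x(2) x(1)] by blast
  qed
qed

definition invariant :: "('a \<Rightarrow>\<^sub>0 int) \<Rightarrow> int \<times> int \<times> int" where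
  "invariant c = (augmentation c, weight_sum disc1 c mod 2, weight_sum disc2 c mod 2)"

lemma invariant_carrier: "invariant c \<in> carrier disc_ring"
  by (simp add: invariant_def disc_ring_def)

lemma to_GW_fibre:
  assumes c: "c \<in> carrier ZU"
  shows "unit_group_ring_to_GW R c = M.fibre (invariant c)"
proof -
  let ?g = "\<lambda>a. add_pow (GW R) (Poly_Mapping.lookup c a) (GW_unit R a)"
  let ?w = "\<lambda>w P. \<Sum>p\<in>P. w p * Poly_Mapping.lookup c (\<psi> p)"
  have g: "?g (\<psi> p) = M.fibre (Poly_Mapping.lookup c (\<psi> p), (Poly_Mapping.lookup c (\<psi> p) * disc1 p) mod 2,
    (Poly_Mapping.lookup c (\<psi> p) * disc2 p) mod 2)" if "c0 p" for p
    unfolding GW_unit_fibre[OF that] by (rule GW_int_multiple[OF disc_range])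
  have D: "(k, (l :: int) mod 2, (m :: int) mod 2) \<in> carrier disc_ring" for k l m by (simp add: disc_ring_def)
  have gc: "?g (\<psi> p) \<in> carrier (GW R)" if "c0 p" for p
    unfolding g[OF that] by (rule fibre_GW(1)[OF D])
  have inj: "inj_on \<psi> A" for A by (rule inj_onI) simp
  have *: "finsum (GW R) ?g (\<psi> ` P) = M.fibre (?w (\<lambda>_. 1) P, ?w disc1 P mod 2, ?w disc2 P mod 2)"
    if "finite P" "P \<subseteq> {p. c0 p}" for P
    using that
  proof (induction P)
    case empty
    show ?case unfolding image_empty GW.finsum_empty fibre_GW(4) disc_ring_simps by simp
  next
    case (insert p P)
    have p: "c0 p" and n: "\<psi> p \<notin> \<psi> ` P" using insert by auto
    have "finsum (GW R) ?g (\<psi> ` insert p P) = ?g (\<psi> p) \<oplus>\<^bsub>GW R\<^esub> finsum (GW R) ?g (\<psi> ` P)"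
      unfolding image_insert
      by (rule GW.finsum_insert) (use insert.hyps insert.prems n p gc in auto)
    also have "\<dots> = M.fibre (Poly_Mapping.lookup c (\<psi> p), (Poly_Mapping.lookup c (\<psi> p) * disc1 p) mod 2,
        (Poly_Mapping.lookup c (\<psi> p) * disc2 p) mod 2) \<oplus>\<^bsub>GW R\<^esub> M.fibre (?w (\<lambda>_. 1) P, ?w disc1 P mod 2, ?w disc2 P mod 2)"
      using g[OF p] insert by simp
    also have "\<dots> = M.fibre (?w (\<lambda>_. 1) (insert p P), ?w disc1 (insert p P) mod 2, ?w disc2 (insert p P) mod 2)"
      unfolding fibre_GW(2)[OF D D] disc_ring_simps using insert.hyps by (simp add: mod_simps mult.commute)
    finally show ?case .
  qed
  \<comment> \<open>The defining sum runs over the support in the carrier of \<open>R\<close>. It is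
    reindexed along \<open>\<psi>\<close> by units of the coordinate type, where the discriminants
    are defined.\<close>
  define P where "P = {p. c0 p \<and> \<psi> p \<in> Poly_Mapping.keys c}"
  have keys: "\<psi> ` P = Poly_Mapping.keys c"
  proof (intro subset_antisym subsetI)
    fix a assume a: "a \<in> Poly_Mapping.keys c"
    then have "a \<in> Units R" using c unfolding ZU_simps(1) by blast
    then obtain p where "c0 p" "a = \<psi> p" using Units_obtain by blast
    then show "a \<in> \<psi> ` P" using a by (simp add: P_def)
  qed (auto simp: P_def)
  have w: "?w v P = weight_sum v c" for v
    unfolding weight_sum_def by (rule sum.mono_neutral_left) (auto simp: P_def in_keys_iff)
  have "finite P" "P \<subseteq> {p. c0 p}" by (auto simp: P_def)
  from *[OF this] show ?thesis
    unfolding unit_group_ring_to_GW_def keys w invariant_def .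
qed

lemma invariant_add: "invariant (c + d) = invariant c \<oplus>\<^bsub>disc_ring\<^esub> invariant d"
  by (simp add: invariant_def disc_ring_def weight_sum_simps mod_simps)

lemma invariant_mult:
  "c \<in> carrier ZU \<Longrightarrow> d \<in> carrier ZU \<Longrightarrow> invariant (c \<otimes>\<^bsub>ZU\<^esub> d) = invariant c \<otimes>\<^bsub>disc_ring\<^esub> invariant d"
  by (simp add: invariant_def augmentation_mult weight_sum_derivation disc_mult)
     (simp add: disc_ring_def mod_simps mod_add_mult_mod)

lemma to_GW_hom: "unit_group_ring_to_GW R \<in> Ring.ring_hom ZU (GW R)"
proof (rule ring_hom_memI)
  fix c assume c: "c \<in> carrier ZU"
  show "unit_group_ring_to_GW R c \<in> carrier (GW R)"
    unfolding to_GW_fibre[OF c] by (rule fibre_GW(1)[OF invariant_carrier])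
  fix d assume d: "d \<in> carrier ZU"
  show "unit_group_ring_to_GW R (c \<otimes>\<^bsub>ZU\<^esub> d) = unit_group_ring_to_GW R c \<otimes>\<^bsub>GW R\<^esub> unit_group_ring_to_GW R d"
    unfolding to_GW_fibre[OF c] to_GW_fibre[OF d] to_GW_fibre[OF ZU.m_closed[OF c d]]
      fibre_GW(3)[OF invariant_carrier invariant_carrier] invariant_mult[OF c d] ..
  show "unit_group_ring_to_GW R (c \<oplus>\<^bsub>ZU\<^esub> d) = unit_group_ring_to_GW R c \<oplus>\<^bsub>GW R\<^esub> unit_group_ring_to_GW R d"
    unfolding to_GW_fibre[OF c] to_GW_fibre[OF d] to_GW_fibre[OF ZU.a_closed[OF c d]]
      fibre_GW(2)[OF invariant_carrier invariant_carrier] invariant_add[symmetric]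
    unfolding ZU_simps(4) ..
next
  show "unit_group_ring_to_GW R \<one>\<^bsub>ZU\<^esub> = \<one>\<^bsub>GW R\<^esub>"
    unfolding to_GW_fibre[OF ZU.one_closed] fibre_GW(5) disc_ring_simps
    by (simp add: invariant_def ZU_simps(3) weight_sum_of[OF c0_one] disc_one)
qed

lemma to_GW_surj: "unit_group_ring_to_GW R ` carrier ZU = carrier (GW R)"
proof (intro subset_antisym subsetI)
  fix x assume "x \<in> carrier (GW R)"
  then obtain n s t where x: "s \<in> {0..<2}" "t \<in> {0..<2}" "x = M.fibre (n, s, t)"
    unfolding GW_def M.fibre_carrier by (auto simp: disc_ring_def)
  define a where "a = Trunc True (s = 1) False (t = 1)"
  have a: "disc1 a = s" "disc2 a = t" "c0 a"
    using x(1,2) by (auto simp: a_def disc1_def disc2_def)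
  \<comment> \<open><a> supplies the discriminant, and a multiple of <1>, whose discriminant is
    trivial, corrects the rank from 1 to n.\<close>
  define c where "c = frag_of (\<psi> a) - frag_cmul (1 - n) (frag_of (\<psi> 1))"
  have "frag_cmul (1 - n) (frag_of (\<psi> 1)) \<in> carrier ZU"
    using frag_of_ZU[OF c0_one] keys_cmul by (fastforce simp: ZU_simps)
  then have c: "c \<in> carrier ZU" unfolding c_def by (intro U.diff_group_ring frag_of_ZU a(3))
  have "invariant c = (n, s, t)"
    using x(1,2) a by (simp add: c_def invariant_def weight_sum_simps weight_sum_frag_cmul weight_sum_of c0_one disc_one)
  then have "x = unit_group_ring_to_GW R c" unfolding to_GW_fibre[OF c] x(3) by simp
  then show "x \<in> unit_group_ring_to_GW R ` carrier ZU" using c by blast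
qed (use ring_hom_closed[OF to_GW_hom] in blast)

section \<open>The quotient ring and the natural map\<close>

interpretation I: ideal "K0MW_ideal R" ZU
  unfolding K0MW_ideal_eq by (rule ideal_even_ideal)

lemma cring_K0MW: "cring (K0MW R)"
  unfolding K0MW_def by (rule I.quotient_is_cring[OF ZU.cring_axioms])

definition coset :: "('a \<Rightarrow>\<^sub>0 int) \<Rightarrow> ('a \<Rightarrow>\<^sub>0 int) set" where
  "coset c = K0MW_ideal R +>\<^bsub>ZU\<^esub> c"

lemma K0MW_coset: "carrier (K0MW R) = coset ` carrier ZU"
  unfolding K0MW_def FactRing_def coset_def by (auto simp: A_RCOSETS_def')

lemma coset_hom:
  assumes "c \<in> carrier ZU" "d \<in> carrier ZU"
  shows "coset c \<oplus>\<^bsub>K0MW R\<^esub> coset d = coset (c + d)" "coset c \<otimes>\<^bsub>K0MW R\<^esub> coset d = coset (c \<otimes>\<^bsub>ZU\<^esub> d)"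
  using ring_hom_add[OF I.rcos_ring_hom assms] ring_hom_mult[OF I.rcos_ring_hom assms]
  unfolding coset_def K0MW_def ZU_simps(4) by simp_all

lemma coset_one: "\<one>\<^bsub>K0MW R\<^esub> = coset \<one>\<^bsub>ZU\<^esub>"
  using ring_hom_one[OF I.rcos_ring_hom] unfolding coset_def K0MW_def by simp

lemma coset_mem:
  assumes c: "c \<in> carrier ZU"
  shows "d \<in> coset c \<longleftrightarrow> d \<in> carrier ZU \<and> d - c \<in> even_ideal"
proof
  assume "d \<in> coset c"
  then obtain j where j: "j \<in> even_ideal" "d = j + c"
    unfolding coset_def K0MW_ideal_eq a_r_coset_def' ZU_simps(4) by blast
  then have "j \<in> carrier ZU" by (simp add: even_ideal_def)
  then show "d \<in> carrier ZU \<and> d - c \<in> even_ideal" using j c ZU.a_closed[of j c] by (simp add: ZU_simps(4))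
next
  assume d: "d \<in> carrier ZU \<and> d - c \<in> even_ideal"
  have "d = (d - c) + c" by simp
  then show "d \<in> coset c"
    unfolding coset_def K0MW_ideal_eq a_r_coset_def' ZU_simps(4) using d by blast
qed

lemma coset_eq_iff:
  assumes c: "c \<in> carrier ZU" and d: "d \<in> carrier ZU"
  shows "coset c = coset d \<longleftrightarrow> c - d \<in> even_ideal"
proof
  have "0 \<in> even_ideal" using I.zero_closed unfolding ZU_simps(2) K0MW_ideal_eq .
  then have "c \<in> coset c" using c by (simp add: coset_mem)
  moreover assume "coset c = coset d"
  ultimately show "c - d \<in> even_ideal" using d by (simp add: coset_mem)
next
  assume "c - d \<in> even_ideal"
  then have "c \<in> coset d" using c d by (simp add: coset_mem)
  then show "coset c = coset d"
    using I.a_repr_independence'[OF _ d] unfolding coset_def by blast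
qed

text \<open>The count of the trivial class is the augmentation minus the other three, so its parity
  comes for free. This leaves three independent parities, one for each nontrivial square
  class.\<close>

lemma even_ideal_iff:
  assumes c: "c \<in> carrier ZU"
  shows "c \<in> even_ideal \<longleftrightarrow> augmentation c = 0 \<and> even (class_count 1 0 c) \<and> even (class_count 0 1 c) \<and> even (class_count 1 1 c)"
proof
  assume a: "augmentation c = 0 \<and> even (class_count 1 0 c) \<and> even (class_count 0 1 c) \<and> even (class_count 1 1 c)"
  have "even (class_count s t c)" for s t
  proof (cases "s \<in> {0..<2} \<and> t \<in> {0..<2}")
    case True
    then have "(s = 0 \<or> s = 1) \<and> (t = 0 \<or> t = 1)" unfolding atLeastLessThan_iff by linarith
    moreover have "even (class_count 0 0 c)" using a weight_sum_class_count(1)[OF c] by presburger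
    ultimately show ?thesis using a by auto
  next
    case False
    then have "class_count s t c = 0"
      unfolding class_count_def weight_sum_def using disc_range by (intro sum.neutral) fastforce
    then show ?thesis by simp
  qed
  then show "c \<in> even_ideal" using a c by (simp add: even_ideal_def)
qed (simp add: even_ideal_def)

lemma invariant_even_ideal: "c \<in> even_ideal \<Longrightarrow> invariant c = (0, 0, 0)"
  using weight_sum_class_count(2,3)[of c] by (auto simp: even_ideal_def invariant_def)

text \<open>Elements of the ideal have trivial rank and discriminant, so the map is constant on each
  coset and \<open>the_elem\<close> meets a singleton.\<close>

lemma to_GW_coset:
  assumes c: "c \<in> carrier ZU"
  shows "K0MW_to_GW R (coset c) = unit_group_ring_to_GW R c"
proof -
  have "unit_group_ring_to_GW R d = unit_group_ring_to_GW R c" if "d \<in> coset c" for d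
  proof -
    have d: "d \<in> carrier ZU" "d - c \<in> even_ideal" using that c by (simp_all add: coset_mem)
    have "invariant d = invariant (c + (d - c))" by simp
    also have "\<dots> = invariant c"
      unfolding invariant_add invariant_even_ideal[OF d(2)] using invariant_carrier[of c]
      by (auto simp: disc_ring_def)
    finally show ?thesis unfolding to_GW_fibre[OF c] to_GW_fibre[OF d(1)] by simp
  qed
  moreover have "c \<in> coset c" using c coset_eq_iff[OF c c] coset_mem[OF c] by simp
  ultimately have "unit_group_ring_to_GW R ` coset c = {unit_group_ring_to_GW R c}" by blast
  then show ?thesis unfolding K0MW_to_GW_def by simp
qed

lemma K0MW_to_GW_hom: "ring_hom_cring (K0MW R) (GW R) (K0MW_to_GW R)"
proof (intro ring_hom_cring.intro cring_K0MW cring_GW ring_hom_cring_axioms.intro ring_hom_memI)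
  fix x assume "x \<in> carrier (K0MW R)"
  then obtain c where c: "c \<in> carrier ZU" "x = coset c" unfolding K0MW_coset by blast
  show "K0MW_to_GW R x \<in> carrier (GW R)"
    unfolding c(2) to_GW_coset[OF c(1)] by (rule ring_hom_closed[OF to_GW_hom c(1)])
  fix y assume "y \<in> carrier (K0MW R)"
  then obtain d where d: "d \<in> carrier ZU" "y = coset d" unfolding K0MW_coset by blast
  show "K0MW_to_GW R (x \<otimes>\<^bsub>K0MW R\<^esub> y) = K0MW_to_GW R x \<otimes>\<^bsub>GW R\<^esub> K0MW_to_GW R y"
    unfolding c(2) d(2) coset_hom(2)[OF c(1) d(1)] to_GW_coset[OF c(1)] to_GW_coset[OF d(1)]
      to_GW_coset[OF ZU.m_closed[OF c(1) d(1)]] by (rule ring_hom_mult[OF to_GW_hom c(1) d(1)])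
  show "K0MW_to_GW R (x \<oplus>\<^bsub>K0MW R\<^esub> y) = K0MW_to_GW R x \<oplus>\<^bsub>GW R\<^esub> K0MW_to_GW R y"
    unfolding c(2) d(2) coset_hom(1)[OF c(1) d(1), folded ZU_simps(4)] to_GW_coset[OF c(1)] to_GW_coset[OF d(1)]
      to_GW_coset[OF ZU.a_closed[OF c(1) d(1)]] by (rule ring_hom_add[OF to_GW_hom c(1) d(1)])
next
  show "K0MW_to_GW R \<one>\<^bsub>K0MW R\<^esub> = \<one>\<^bsub>GW R\<^esub>"
    unfolding coset_one to_GW_coset[OF ZU.one_closed] by (rule ring_hom_one[OF to_GW_hom])
qed

lemma K0MW_to_GW_unit:
  assumes "a \<in> Units R" shows "K0MW_to_GW R (K0MW_unit R a) = GW_unit R a"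
proof -
  obtain p where p: "c0 p" "a = \<psi> p" using Units_obtain[OF assms] .
  have "invariant (frag_of (\<psi> p)) = (1, disc1 p, disc2 p)"
    using disc_range[of p] by (simp add: invariant_def weight_sum_of p(1))
  then show ?thesis
    unfolding K0MW_unit_def coset_def[symmetric] p(2) to_GW_coset[OF frag_of_ZU[OF p(1)]]
      to_GW_fibre[OF frag_of_ZU[OF p(1)]] GW_unit_fibre[OF p(1)] by simp
qed

lemma K0MW_to_GW_surj: "K0MW_to_GW R ` carrier (K0MW R) = carrier (GW R)"
  unfolding K0MW_coset image_image to_GW_surj[symmetric] by (rule image_cong) (simp_all add: to_GW_coset)

section \<open>The additive groups and the kernel\<close>

lemma GW_additive: "add_monoid (GW R) \<cong> integer_group \<times>\<times> (integer_mod_group 2 \<times>\<times> integer_mod_group 2)"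
proof -
  let ?G = "integer_group \<times>\<times> (integer_mod_group 2 \<times>\<times> integer_mod_group 2)"
  \<comment> \<open>Carrier and addition of \<open>disc_ring\<close> are literally those of the
    product group, so \<open>M.fibre\<close> is already the isomorphism, up to direction.\<close>
  have c: "carrier ?G = carrier disc_ring"
    by (simp add: disc_ring_def DirProd_def carrier_integer_mod_group)
  have m: "x \<otimes>\<^bsub>?G\<^esub> y = x \<oplus>\<^bsub>disc_ring\<^esub> y" for x y
    by (simp add: disc_ring_def DirProd_def split_beta)
  have "bij_betw M.fibre (carrier disc_ring) (carrier (GW R))"
    using M.fibre_iso unfolding GW_def ring_iso_def by blast
  then have "M.fibre \<in> iso ?G (add_monoid (GW R))"
    unfolding iso_def hom_def c m using fibre_GW(1,2) by simp
  then have "?G \<cong> add_monoid (GW R)" by (rule is_isoI)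
  then show ?thesis by (rule group.iso_sym[rotated]) (intro DirProd_group; simp)
qed

text \<open>Coordinates on Z plus I/2I: the elements 1 - <a> for the three nontrivial square classes
  form a basis of the augmentation ideal I of the group ring of square classes, and up to sign the
  class counts are the coefficients.\<close>

definition K0MW_invariant :: "('a \<Rightarrow>\<^sub>0 int) \<Rightarrow> int \<times> int \<times> int \<times> int" where
  "K0MW_invariant c = (augmentation c, class_count 1 0 c mod 2, class_count 0 1 c mod 2, class_count 1 1 c mod 2)"

lemma K0MW_invariant_eq_iff:
  assumes c: "c \<in> carrier ZU" and d: "d \<in> carrier ZU"
  shows "K0MW_invariant c = K0MW_invariant d \<longleftrightarrow> coset c = coset d"
  unfolding coset_eq_iff[OF c d] even_ideal_iff[OF U.diff_group_ring[OF c d]] K0MW_invariant_def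
  by (simp add: weight_sum_simps class_count_simps mod_eq_dvd_iff)

definition coset_invariant :: "('a \<Rightarrow>\<^sub>0 int) set \<Rightarrow> int \<times> int \<times> int \<times> int" where
  "coset_invariant x = K0MW_invariant (SOME c. c \<in> carrier ZU \<and> x = coset c)"

lemma coset_invariant_coset:
  assumes c: "c \<in> carrier ZU" shows "coset_invariant (coset c) = K0MW_invariant c"
proof -
  define d where "d = (SOME d. d \<in> carrier ZU \<and> coset c = coset d)"
  have "d \<in> carrier ZU \<and> coset c = coset d" unfolding d_def by (rule someI[of _ c]) (use c in blast)
  then show ?thesis
    unfolding coset_invariant_def d_def[symmetric] using K0MW_invariant_eq_iff[OF c, of d] by simp
qed

lemma ZU_of_class_counts:
  "\<exists>c\<in>carrier ZU. augmentation c = n \<and> class_count 1 0 c = i \<and> class_count 0 1 c = j \<and> class_count 1 1 c = k"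
proof -
  define a b d where "a = Trunc True True False False" and "b = Trunc True False False True"
    and "d = Trunc True True False True"
  have u: "c0 a" "c0 b" "c0 d" "disc1 a = 1" "disc2 a = 0" "disc1 b = 0" "disc2 b = 1" "disc1 d = 1" "disc2 d = 1"
    by (simp_all add: a_def b_def d_def disc1_def disc2_def)
  \<comment> \<open>One unit from each square class. The multiple of <1> adjusts the augmentation
    and does not enter the three counts; sums are written as differences, for which closure of the
    carrier is at hand.\<close>
  define c where "c = frag_cmul (n - i - j - k) (frag_of (\<psi> 1)) - frag_cmul (- i) (frag_of (\<psi> a)) -
    frag_cmul (- j) (frag_of (\<psi> b)) - frag_cmul (- k) (frag_of (\<psi> d))"
  have "frag_cmul l (frag_of (\<psi> p)) \<in> carrier ZU" if "c0 p" for l p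
    using frag_of_ZU[OF that] keys_cmul by (fastforce simp: ZU_simps)
  then have "c \<in> carrier ZU"
    unfolding c_def using c0_one u(1-3) by (intro U.diff_group_ring) blast+
  moreover have "augmentation c = n" "class_count 1 0 c = i" "class_count 0 1 c = j" "class_count 1 1 c = k"
    by (simp_all add: c_def weight_sum_simps weight_sum_frag_cmul weight_sum_of class_count_simps u c0_one disc_one)
  ultimately show ?thesis by blast
qed

lemma K0MW_additive:
  "add_monoid (K0MW R) \<cong> integer_group \<times>\<times> (integer_mod_group 2 \<times>\<times> integer_mod_group 2 \<times>\<times> integer_mod_group 2)"
proof -
  let ?G = "integer_group \<times>\<times> (integer_mod_group 2 \<times>\<times> integer_mod_group 2 \<times>\<times> integer_mod_group 2)"
  have G: "carrier ?G = UNIV \<times> {0..<2} \<times> {0..<2} \<times> {0..<2}"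
    by (simp add: DirProd_def carrier_integer_mod_group)
  have closed: "K0MW_invariant c \<in> carrier ?G" for c unfolding G K0MW_invariant_def by simp
  have "coset_invariant \<in> iso (add_monoid (K0MW R)) ?G"
  proof (rule isoI)
    show "coset_invariant \<in> hom (add_monoid (K0MW R)) ?G"
    proof (rule homI)
      fix x assume "x \<in> carrier (add_monoid (K0MW R))"
      then obtain c where c: "c \<in> carrier ZU" "x = coset c" by (auto simp: K0MW_coset)
      show "coset_invariant x \<in> carrier ?G" unfolding c(2) coset_invariant_coset[OF c(1)] by (rule closed)
      fix y assume "y \<in> carrier (add_monoid (K0MW R))"
      then obtain d where d: "d \<in> carrier ZU" "y = coset d" by (auto simp: K0MW_coset)
      have "K0MW_invariant (c + d) = K0MW_invariant c \<otimes>\<^bsub>?G\<^esub> K0MW_invariant d"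
        by (simp add: K0MW_invariant_def DirProd_def weight_sum_simps class_count_simps mod_simps)
      then show "coset_invariant (x \<otimes>\<^bsub>add_monoid (K0MW R)\<^esub> y) = coset_invariant x \<otimes>\<^bsub>?G\<^esub> coset_invariant y"
        using coset_hom(1)[OF c(1) d(1)] coset_invariant_coset[OF c(1)] coset_invariant_coset[OF d(1)]
          coset_invariant_coset[OF ZU.a_closed[OF c(1) d(1)]] unfolding c(2) d(2) ZU_simps(4) by simp
    qed
    show "bij_betw coset_invariant (carrier (add_monoid (K0MW R))) (carrier ?G)"
    proof (rule bij_betw_imageI)
      show "inj_on coset_invariant (carrier (add_monoid (K0MW R)))"
        by (rule inj_onI) (auto simp: K0MW_coset coset_invariant_coset K0MW_invariant_eq_iff)
      show "coset_invariant ` carrier (add_monoid (K0MW R)) = carrier ?G"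
      proof (intro subset_antisym subsetI)
        fix z assume "z \<in> carrier ?G"
        then obtain n i j k where z: "z = (n, i, j, k)" "i \<in> {0..<2}" "j \<in> {0..<2}" "k \<in> {0..<2}"
          unfolding G by auto
        obtain c where c: "c \<in> carrier ZU"
          "augmentation c = n" "class_count 1 0 c = i" "class_count 0 1 c = j" "class_count 1 1 c = k"
          using ZU_of_class_counts by blast
        then have "z = coset_invariant (coset c)"
          using z by (simp add: coset_invariant_coset K0MW_invariant_def)
        then show "z \<in> coset_invariant ` carrier (add_monoid (K0MW R))" using c(1) by (simp add: K0MW_coset)
      qed (auto simp: K0MW_coset coset_invariant_coset closed simp del: carrier_DirProd)
    qed
  qed
  then show ?thesis by (rule is_isoI)
qed

text \<open>The discriminant adds the counts of (1, 0) and (1, 1), respectively of (0, 1) and (1,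
  1). It vanishes when the three parities agree: all even gives zero, all odd gives the class of (1
  - <1 + x>)(1 - <1 + x^3>).\<close>

lemma coset_kernel:
  assumes c: "c \<in> carrier ZU"
  shows "coset c \<in> a_kernel (K0MW R) (GW R) (K0MW_to_GW R) \<longleftrightarrow> augmentation c = 0 \<and>
    class_count 1 0 c mod 2 = class_count 1 1 c mod 2 \<and> class_count 0 1 c mod 2 = class_count 1 1 c mod 2"
proof -
  have z: "\<zero>\<^bsub>disc_ring\<^esub> = (0, 0, 0)" by (simp add: disc_ring_def)
  have even_add_iff: "even (a + b) \<longleftrightarrow> a mod 2 = b mod 2" for a b :: int by presburger
  have "coset c \<in> a_kernel (K0MW R) (GW R) (K0MW_to_GW R) \<longleftrightarrow> M.fibre (invariant c) = M.fibre \<zero>\<^bsub>disc_ring\<^esub>"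
    unfolding a_kernel_def' K0MW_coset mem_Collect_eq to_GW_coset[OF c] to_GW_fibre[OF c] fibre_GW(4) using c by blast
  also have "\<dots> \<longleftrightarrow> invariant c = (0, 0, 0)"
    using M.fibre_inject[OF invariant_carrier, of c "\<zero>\<^bsub>disc_ring\<^esub>"] by (auto simp only: z)
  also have "\<dots> \<longleftrightarrow> augmentation c = 0 \<and> even (class_count 1 0 c + class_count 1 1 c) \<and>
    even (class_count 0 1 c + class_count 1 1 c)"
    unfolding invariant_def weight_sum_class_count(2,3)[OF c] by (simp add: even_iff_mod_2_eq_zero)
  also have "\<dots> \<longleftrightarrow> augmentation c = 0 \<and>
    class_count 1 0 c mod 2 = class_count 1 1 c mod 2 \<and> class_count 0 1 c mod 2 = class_count 1 1 c mod 2"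
    unfolding even_add_iff ..
  finally show ?thesis .
qed

lemma kernel_additive:
  "(add_monoid (K0MW R))\<lparr>carrier := a_kernel (K0MW R) (GW R) (K0MW_to_GW R)\<rparr> \<cong> integer_mod_group 2"
proof -
  let ?K = "(add_monoid (K0MW R))\<lparr>carrier := a_kernel (K0MW R) (GW R) (K0MW_to_GW R)\<rparr>"
  \<comment> \<open>On the kernel the augmentation is 0 and the three parities coincide, so the last
    one alone is a complete coordinate.\<close>
  let ?f = "\<lambda>x. snd (snd (snd (coset_invariant x)))"
  have E: "\<exists>c. c \<in> carrier ZU \<and> x = coset c" if "x \<in> carrier ?K" for x
    using that by (auto simp: a_kernel_def' K0MW_coset)
  have f: "?f (coset c) = class_count 1 1 c mod 2" if "c \<in> carrier ZU" for c
    unfolding coset_invariant_coset[OF that] K0MW_invariant_def by simp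
  have "?f \<in> iso ?K (integer_mod_group 2)"
  proof (rule isoI)
    show "?f \<in> hom ?K (integer_mod_group 2)"
    proof (rule homI)
      fix x assume "x \<in> carrier ?K"
      then obtain c where c: "c \<in> carrier ZU" "x = coset c" using E by blast
      show "?f x \<in> carrier (integer_mod_group 2)" unfolding c(2) f[OF c(1)] by (simp add: carrier_integer_mod_group)
      fix y assume "y \<in> carrier ?K"
      then obtain d where d: "d \<in> carrier ZU" "y = coset d" using E by blast
      have s: "x \<otimes>\<^bsub>?K\<^esub> y = coset (c + d)" unfolding c(2) d(2) using coset_hom(1)[OF c(1) d(1)] by simp
      show "?f (x \<otimes>\<^bsub>?K\<^esub> y) = ?f x \<otimes>\<^bsub>integer_mod_group 2\<^esub> ?f y"
        unfolding s f[OF ZU.a_closed[OF c(1) d(1), unfolded ZU_simps(4)]] unfolding c(2) d(2) f[OF c(1)] f[OF d(1)]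
        by (simp add: class_count_simps mod_simps)
    qed
    show "bij_betw ?f (carrier ?K) (carrier (integer_mod_group 2))"
    proof (rule bij_betw_imageI)
      show "inj_on ?f (carrier ?K)"
      proof (rule inj_onI)
        fix x y assume x: "x \<in> carrier ?K" and y: "y \<in> carrier ?K" and eq: "?f x = ?f y"
        obtain c where c: "c \<in> carrier ZU" "x = coset c" using E[OF x] by blast
        obtain d where d: "d \<in> carrier ZU" "y = coset d" using E[OF y] by blast
        have "coset c \<in> a_kernel (K0MW R) (GW R) (K0MW_to_GW R)" "coset d \<in> a_kernel (K0MW R) (GW R) (K0MW_to_GW R)"
          using x y c(2) d(2) by simp_all
        then have "K0MW_invariant c = K0MW_invariant d"
          using eq unfolding c(2) d(2) f[OF c(1)] f[OF d(1)] coset_kernel[OF c(1)] coset_kernel[OF d(1)]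
          by (simp add: K0MW_invariant_def)
        then show "x = y" using K0MW_invariant_eq_iff[OF c(1) d(1)] c(2) d(2) by simp
      qed
      show "?f ` carrier ?K = carrier (integer_mod_group 2)"
      proof (intro subset_antisym subsetI)
        fix z assume "z \<in> carrier (integer_mod_group 2)"
        then have z: "z mod 2 = z" by (simp add: carrier_integer_mod_group)
        obtain c where c: "c \<in> carrier ZU"
          "augmentation c = 0" "class_count 1 0 c = z" "class_count 0 1 c = z" "class_count 1 1 c = z"
          using ZU_of_class_counts by blast
        have "coset c \<in> carrier ?K" using coset_kernel[OF c(1)] c by simp
        moreover have "z = ?f (coset c)" unfolding f[OF c(1)] c(5) z ..
        ultimately show "z \<in> ?f ` carrier ?K" by blast
      next
        fix z assume "z \<in> ?f ` carrier ?K"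
        then obtain x where "x \<in> carrier ?K" "z = ?f x" by blast
        then obtain c where "c \<in> carrier ZU" "z = ?f (coset c)" using E by blast
        then show "z \<in> carrier (integer_mod_group 2)" unfolding f[OF \<open>c \<in> carrier ZU\<close>]
          by (simp add: carrier_integer_mod_group)
      qed
    qed
  qed
  then show ?thesis by (rule is_isoI)
qed

end

theorem proposition4p1:
  "ring_hom_cring (K0MW F2x4) (GW F2x4) (K0MW_to_GW F2x4) \<and>
   (\<forall>a\<in>Units F2x4. K0MW_to_GW F2x4 (K0MW_unit F2x4 a) = GW_unit F2x4 a) \<and>
   K0MW_to_GW F2x4 ` carrier (K0MW F2x4) = carrier (GW F2x4) \<and>
   (add_monoid (K0MW F2x4))\<lparr>carrier := a_kernel (K0MW F2x4) (GW F2x4) (K0MW_to_GW F2x4)\<rparr>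
     \<cong> integer_mod_group 2 \<and>
   add_monoid (GW F2x4) \<cong>
     integer_group \<times>\<times> (integer_mod_group 2 \<times>\<times> integer_mod_group 2) \<and>
   add_monoid (K0MW F2x4) \<cong>
     integer_group \<times>\<times> (integer_mod_group 2 \<times>\<times> integer_mod_group 2 \<times>\<times> integer_mod_group 2)"
proof -
  obtain \<psi> :: "trunc \<Rightarrow> (nat \<Rightarrow> int) set" where "coordinate_ring F2x4 \<psi>"
    using coordinate_ring_F2x4 by blast
  then interpret trunc_coordinate F2x4 \<psi> by (rule trunc_coordinate.intro)
  show ?thesis
    using K0MW_to_GW_hom K0MW_to_GW_unit K0MW_to_GW_surj kernel_additive GW_additive K0MW_additive by blast
qed

end
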